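(* Let $E$ be an oriented 2-dimensional real vector space with a fixed positive volume element $\omega\in\Lambda^2E^*$, and let $\mathcal{M}^0_{1,1}$ be the space of Lorentzian inner products on $E$ whose volume form is $\omega$. Then $\mathcal{M}_{1,1}^0$ carries a natural Lorentzian metric making it $\mathrm{SL}(2,\mathbb{R})$-equivariantly isometric to the 2-dimensional de Sitter universe. For $g,g'\in\mathcal{M}_{1,1}^0$ there is a unique endomorphism $A$ of $E$ such that $g'=g(A\cdot,\cdot)$. Moreover, the following holds: \begin{itemize} \item If $\operatorname{tr}(A)>2$, then there is a unique geodesic in $\mathcal{M}_{1,1}^0$ joining $g$ and $g'$. This geodesic is timelike. \item If $\operatorname{tr}(A)=2$, then there is a unique geodesic in $\mathcal{M}_{1,1}^0$ joining $g$ and $g'$. This geodesic is null. \item If $-2<\operatorname{tr}(A)<2$, then there is a unique geodesic in $\mathcal{M}_{1,1}^0$ joining $g$ and $g'$. This geodesic is spacelike. \item If $\operatorname{tr}(A)<-2$, then there is no geodesic in $\mathcal{M}_{1,1}^0$ joining $g$ and $g'$. \item If $\operatorname{tr}(A)=-2$ and $g\neq-g'$, then there is no geodesic in $\mathcal{M}_{1,1}^0$ joining $g$ and $g'$. \item If $\operatorname{tr}(A)=-2$ and $g=-g'$, then all spacelike geodesics in $\mathcal{M}_{1,1}^0$ emanating from $g$ pass through $g'$, while the timelike and null geodesics in $\mathcal{M}_{1,1}^0$ emanating from $g$ miss $g'$. \end{itemize}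
   Context: $\mathrm{SL}(E)\cong\mathrm{SL}(2,\mathbb{R})$ acts on $\mathcal{M}^0_{1,1}$ by $(\gamma\cdot g)(u,v)=g(\gamma^{-1}u,\gamma^{-1}v)$ and on the Lie algebra $\mathfrak{g}=\mathfrak{sl}(E)$ of trace-free endomorphisms of $E$ by conjugation. On $\mathfrak{g}\cong\mathbb{R}^3$ let $\langle\cdot,\cdot\rangle$ be the symmetric bilinear form with $\langle u,u\rangle=-\det u=\frac12\operatorname{tr}(u^2)$, of signature $(2,1)$. The 2-dimensional de Sitter universe is the pseudosphere $\mathbb{M}^{1,1}_1=\{u\in\mathfrak{g}:\langle u,u\rangle=1\}$ with the induced Lorentzian metric. For $g\in\mathcal{M}^0_{1,1}$ let $I_g$ be the unique automorphism of $E$ with $g=\omega(\cdot,I_g\cdot)$; it is trace-free of determinant $-1$, and the natural Lorentzian metric on $\mathcal{M}^0_{1,1}$ is the one for which $g\mapsto I_g$ is an isometry onto $\mathbb{M}^{1,1}_1$. A nonzero tangent vector $X$ is timelike, null or spacelike according to whether $\langle X,X\rangle$ is negative, zero or positive, and geodesics are classified by their tangent vectors. The geodesics of $\mathbb{M}^{1,1}_1$ are cut out by the 2-dimensional vector subspaces of $\mathfrak{g}$: timelike geodesics (hyperbolas) correspond to Minkowski planes, spacelike geodesics (ellipses) to spacelike planes, and null geodesics (straight lines) to degenerate planes; in the timelike and null cases the intersection of the plane with $\mathbb{M}^{1,1}_1$ has two connected components.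
   Formalization: In the case tr(A)=2 the formal statement assumes g≠g'; for g=g' one has A=id and tr(A)=2, but infinitely many geodesics of all causal types pass through g, so uniqueness fails there. *)

theory Defs
  imports "HOL-Analysis.Analysis" "HOL-Library.Function_Algebras"
begin

text \<open>
  Bilinear forms on \<open>E\<close> live in \<open>'e \<Rightarrow> 'e \<Rightarrow> real\<close> and endomorphisms of \<open>E\<close> in \<open>'e \<Rightarrow> 'e\<close>; the
  pointwise scalar multiplication completes the pointwise group structure of
  \<^theory>\<open>HOL-Library.Function_Algebras\<close> to a real vector space.
\<close>

instantiation "fun" :: (type, real_vector) real_vector
begin

definition "a *\<^sub>R f = (\<lambda>x. a *\<^sub>R f x)"

instance
  by standard (simp_all add: scaleR_fun_def fun_eq_iff algebra_simps)

end

lemma scaleR_fun_apply [simp]: "(a *\<^sub>R f) x = a *\<^sub>R f x"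
  by (simp add: scaleR_fun_def)

text \<open>Trace and determinant (Leibniz formula) of the matrix of an endomorphism with respect to
  some basis; they do not depend on the basis.\<close>

definition some_basis :: "'v::real_vector set" where
  "some_basis = (SOME B. independent B \<and> span B = UNIV)"

definition lin_trace :: "('v::real_vector \<Rightarrow> 'v) \<Rightarrow> real" where
  "lin_trace f = (\<Sum>b\<in>some_basis. representation some_basis (f b) b)"

definition lin_det :: "('v::real_vector \<Rightarrow> 'v) \<Rightarrow> real" where
  "lin_det f = (\<Sum>p | p permutes (some_basis :: 'v set).
     of_int (sign p) * (\<Prod>b\<in>some_basis. representation some_basis (f b) (p b)))"

definition SL :: "('v::real_vector \<Rightarrow> 'v) set" where
  "SL = {\<gamma>. linear \<gamma> \<and> lin_det \<gamma> = 1}"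

text \<open>An orientation of a 2-dimensional space, given as the set of positively oriented ordered
  bases: an orbit of the automorphisms of positive determinant.\<close>

definition ordered_basis2 :: "'v::real_vector \<Rightarrow> 'v \<Rightarrow> bool" where
  "ordered_basis2 u v \<longleftrightarrow> u \<noteq> v \<and> independent {u, v} \<and> span {u, v} = UNIV"

definition orientation2 :: "('v::real_vector \<times> 'v) set \<Rightarrow> bool" where
  "orientation2 Or \<longleftrightarrow> Or \<noteq> {} \<and>
     (\<forall>(u, v)\<in>Or. ordered_basis2 u v \<and>
        (\<forall>f. linear f \<and> bij f \<longrightarrow> ((f u, f v) \<in> Or \<longleftrightarrow> lin_det f > 0)))"

definition area_form :: "('v::real_vector \<Rightarrow> 'v \<Rightarrow> real) \<Rightarrow> bool" where
  "area_form \<omega> \<longleftrightarrow> bilinear \<omega> \<and> (\<forall>u. \<omega> u u = 0)"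

definition positive_area_form :: "('v::real_vector \<times> 'v) set \<Rightarrow> ('v \<Rightarrow> 'v \<Rightarrow> real) \<Rightarrow> bool" where
  "positive_area_form Or \<omega> \<longleftrightarrow> area_form \<omega> \<and> (\<forall>(u, v)\<in>Or. \<omega> u v > 0)"

text \<open>\<open>g\<close> restricts to an inner product of signature (1,1) on the subspace \<open>V\<close>; in particular \<open>V\<close> is
  2-dimensional. Values of \<open>g\<close> outside \<open>V\<close> are irrelevant.\<close>

definition lorentzian_on :: "'v::real_vector set \<Rightarrow> ('v \<Rightarrow> 'v \<Rightarrow> real) \<Rightarrow> bool" where
  "lorentzian_on V g \<longleftrightarrow>
     (\<forall>u\<in>V. \<forall>v\<in>V. g u v = g v u) \<and>
     (\<forall>u\<in>V. \<forall>v\<in>V. \<forall>w\<in>V. \<forall>a b. g (a *\<^sub>R u + b *\<^sub>R v) w = a * g u w + b * g v w) \<and>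
     (\<exists>e f. V = span {e, f} \<and> g e e = 1 \<and> g f f = -1 \<and> g e f = 0)"

text \<open>The volume form of \<open>g\<close> is the alternating form with value 1 on every positively oriented
  (pseudo-)orthonormal basis.\<close>

definition is_volume_form ::
    "('v::real_vector \<times> 'v) set \<Rightarrow> ('v \<Rightarrow> 'v \<Rightarrow> real) \<Rightarrow> ('v \<Rightarrow> 'v \<Rightarrow> real) \<Rightarrow> bool" where
  "is_volume_form Or g \<omega> \<longleftrightarrow> area_form \<omega> \<and>
     (\<forall>(e, f)\<in>Or. \<bar>g e e\<bar> = 1 \<and> \<bar>g f f\<bar> = 1 \<and> g e f = 0 \<longrightarrow> \<omega> e f = 1)"

definition lorentz_forms :: "('v::real_vector \<times> 'v) set \<Rightarrow> ('v \<Rightarrow> 'v \<Rightarrow> real) \<Rightarrow> ('v \<Rightarrow> 'v \<Rightarrow> real) set" where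
  "lorentz_forms Or \<omega> = {g. lorentzian_on UNIV g \<and> is_volume_form Or g \<omega>}"

text \<open>\<open>D is\<close> is the iterated partial derivative of \<open>f\<close> in the directions listed in \<open>is\<close>; existence
  of all of them, each being totally differentiable, is \<open>C\<^sup>\<infinity>\<close>-smoothness on the open set \<open>U\<close>.\<close>

definition smooth_on :: "'a::euclidean_space set \<Rightarrow> ('a \<Rightarrow> real) \<Rightarrow> bool" where
  "smooth_on U f \<longleftrightarrow> (\<exists>D :: 'a list \<Rightarrow> 'a \<Rightarrow> real.
     (\<forall>x\<in>U. D [] x = f x) \<and>
     (\<forall>is. set is \<subseteq> Basis \<longrightarrow>
        (\<forall>x\<in>U. (D is has_derivative (\<lambda>d. \<Sum>i\<in>Basis. D (i # is) x * (d \<bullet> i))) (at x))))"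

text \<open>The target \<open>'v\<close> carries no norm. Smoothness, derivatives and the topology are therefore taken
  with respect to all linear functionals. This is used only for maps with values in a
  finite-dimensional subspace of \<open>'v\<close>, where it gives the usual notions.\<close>

definition smooth_map :: "'a::euclidean_space set \<Rightarrow> ('a \<Rightarrow> 'v::real_vector) \<Rightarrow> bool" where
  "smooth_map U F \<longleftrightarrow> (\<forall>l :: 'v \<Rightarrow> real. linear l \<longrightarrow> smooth_on U (\<lambda>x. l (F x)))"

definition dirderiv :: "('a::euclidean_space \<Rightarrow> 'v::real_vector) \<Rightarrow> 'a \<Rightarrow> 'a \<Rightarrow> 'v" where
  "dirderiv F x d = (THE w. \<forall>l :: 'v \<Rightarrow> real. linear l \<longrightarrow>
     ((\<lambda>s. l (F (x + s *\<^sub>R d))) has_real_derivative l w) (at 0))"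

abbreviation velocity :: "(real \<Rightarrow> 'v::real_vector) \<Rightarrow> real \<Rightarrow> 'v" where
  "velocity c t \<equiv> dirderiv c t 1"

definition functional_topology :: "'v::real_vector topology" where
  "functional_topology = topology_generated_by {l -` T |(l :: 'v \<Rightarrow> real) T. linear l \<and> open T}"

text \<open>A local parametrization of \<open>S\<close>: an injective immersion that is a homeomorphism of \<open>U\<close> onto a
  relatively open subset of \<open>S\<close> (continuity is part of smoothness).\<close>

definition chart :: "'v::real_vector set \<Rightarrow> (real \<times> real) set \<Rightarrow> (real \<times> real \<Rightarrow> 'v) \<Rightarrow> bool" where
  "chart S U \<phi> \<longleftrightarrow> open U \<and> \<phi> ` U \<subseteq> S \<and> smooth_map U \<phi> \<and> inj_on \<phi> U \<and>
     (\<forall>x\<in>U. inj (dirderiv \<phi> x)) \<and>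
     open_map (top_of_set U) (subtopology functional_topology S) \<phi>"

definition smooth_surface :: "'v::real_vector set \<Rightarrow> bool" where
  "smooth_surface S \<longleftrightarrow> (\<forall>p\<in>S. \<exists>U \<phi>. chart S U \<phi> \<and> p \<in> \<phi> ` U)"

definition smooth_curve :: "'v::real_vector set \<Rightarrow> real set \<Rightarrow> (real \<Rightarrow> 'v) \<Rightarrow> bool" where
  "smooth_curve S J c \<longleftrightarrow> open J \<and> is_interval J \<and> J \<noteq> {} \<and> smooth_map J c \<and> c ` J \<subseteq> S"

definition tangent_space :: "'v::real_vector set \<Rightarrow> 'v \<Rightarrow> 'v set" where
  "tangent_space S p = {velocity c 0 |c. \<exists>J. smooth_curve S J c \<and> 0 \<in> J \<and> c 0 = p}"

text \<open>A metric on \<open>S\<close> is a function \<open>h\<close> such that \<open>h p\<close> is an inner product on the tangent space at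
  \<open>p\<close>; its values elsewhere play no role.\<close>

definition metric_coeff ::
    "('v::real_vector \<Rightarrow> 'v \<Rightarrow> 'v \<Rightarrow> real) \<Rightarrow> (real \<times> real \<Rightarrow> 'v) \<Rightarrow>
     real \<times> real \<Rightarrow> real \<times> real \<Rightarrow> real \<times> real \<Rightarrow> real" where
  "metric_coeff h \<phi> i j x = h (\<phi> x) (dirderiv \<phi> x i) (dirderiv \<phi> x j)"

definition lorentzian_surface ::
    "'v::real_vector set \<Rightarrow> ('v \<Rightarrow> 'v \<Rightarrow> 'v \<Rightarrow> real) \<Rightarrow> bool" where
  "lorentzian_surface S h \<longleftrightarrow> smooth_surface S \<and>
     (\<forall>p\<in>S. lorentzian_on (tangent_space S p) (h p)) \<and>
     (\<forall>U \<phi>. chart S U \<phi> \<longrightarrow> (\<forall>i\<in>Basis. \<forall>j\<in>Basis. smooth_on U (metric_coeff h \<phi> i j)))"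

definition diffeomorphism :: "'v::real_vector set \<Rightarrow> 'w::real_vector set \<Rightarrow> ('v \<Rightarrow> 'w) \<Rightarrow> bool" where
  "diffeomorphism S S' F \<longleftrightarrow> bij_betw F S S' \<and>
     (\<forall>U \<phi>. chart S U \<phi> \<longrightarrow> smooth_map U (F \<circ> \<phi>)) \<and>
     (\<forall>U \<phi>. chart S' U \<phi> \<longrightarrow> smooth_map U (inv_into S F \<circ> \<phi>))"

text \<open>The differential of \<open>F\<close> maps the velocity of \<open>c\<close> to the velocity of \<open>F \<circ> c\<close>.\<close>

definition surface_isometry ::
    "'v::real_vector set \<Rightarrow> ('v \<Rightarrow> 'v \<Rightarrow> 'v \<Rightarrow> real) \<Rightarrow>
     'w::real_vector set \<Rightarrow> ('w \<Rightarrow> 'w \<Rightarrow> 'w \<Rightarrow> real) \<Rightarrow> ('v \<Rightarrow> 'w) \<Rightarrow> bool" where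
  "surface_isometry S h S' h' F \<longleftrightarrow> diffeomorphism S S' F \<and>
     (\<forall>J c J' c'. smooth_curve S J c \<and> 0 \<in> J \<and> smooth_curve S J' c' \<and> 0 \<in> J' \<and> c 0 = c' 0 \<longrightarrow>
        h' (F (c 0)) (velocity (F \<circ> c) 0) (velocity (F \<circ> c') 0) =
        h (c 0) (velocity c 0) (velocity c' 0))"

text \<open>Christoffel symbols of the first kind:
  \<open>\<Gamma>\<^bsub>k,ij\<^esub> = (\<partial>\<^sub>i h\<^bsub>jk\<^esub> + \<partial>\<^sub>j h\<^bsub>ik\<^esub> - \<partial>\<^sub>k h\<^bsub>ij\<^esub>) / 2\<close>.\<close>

definition christoffel ::
    "('v::real_vector \<Rightarrow> 'v \<Rightarrow> 'v \<Rightarrow> real) \<Rightarrow> (real \<times> real \<Rightarrow> 'v) \<Rightarrow>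
     real \<times> real \<Rightarrow> real \<times> real \<Rightarrow> real \<times> real \<Rightarrow> real \<times> real \<Rightarrow> real" where
  "christoffel h \<phi> k i j x =
     (frechet_derivative (metric_coeff h \<phi> j k) (at x) i +
      frechet_derivative (metric_coeff h \<phi> i k) (at x) j -
      frechet_derivative (metric_coeff h \<phi> i j) (at x) k) / 2"

text \<open>The geodesic equation of the Levi-Civita connection in local coordinates, with the free index
  lowered by the (nondegenerate) metric:
  \<open>\<Sum>\<^sub>j h\<^bsub>kj\<^esub> x\<^sub>j'' + \<Sum>\<^bsub>i,j\<^esub> \<Gamma>\<^bsub>k,ij\<^esub> x\<^sub>i' x\<^sub>j' = 0\<close>.\<close>

definition geodesic_equation ::
    "('v::real_vector \<Rightarrow> 'v \<Rightarrow> 'v \<Rightarrow> real) \<Rightarrow> (real \<times> real \<Rightarrow> 'v) \<Rightarrow>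
     (real \<Rightarrow> real \<times> real) \<Rightarrow> real \<Rightarrow> bool" where
  "geodesic_equation h \<phi> x t \<longleftrightarrow> (\<forall>k\<in>Basis.
     let x' = (\<lambda>s. vector_derivative x (at s)); x'' = vector_derivative x' (at t) in
     (\<Sum>j\<in>Basis. metric_coeff h \<phi> k j (x t) * (x'' \<bullet> j)) +
     (\<Sum>i\<in>Basis. \<Sum>j\<in>Basis. christoffel h \<phi> k i j (x t) * (x' t \<bullet> i) * (x' t \<bullet> j)) = 0)"

text \<open>Affinely parametrized geodesics on open intervals; constant curves are excluded.\<close>

definition geodesic ::
    "'v::real_vector set \<Rightarrow> ('v \<Rightarrow> 'v \<Rightarrow> 'v \<Rightarrow> real) \<Rightarrow> real set \<Rightarrow> (real \<Rightarrow> 'v) \<Rightarrow> bool" where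
  "geodesic S h J c \<longleftrightarrow> smooth_curve S J c \<and> (\<forall>t\<in>J. velocity c t \<noteq> 0) \<and>
     (\<forall>t\<in>J. \<exists>U \<phi> J' x. chart S U \<phi> \<and> t \<in> J' \<and> J' \<subseteq> J \<and> smooth_curve U J' x \<and>
        (\<forall>s\<in>J'. \<phi> (x s) = c s \<and> geodesic_equation h \<phi> x s))"

definition maximal_geodesic ::
    "'v::real_vector set \<Rightarrow> ('v \<Rightarrow> 'v \<Rightarrow> 'v \<Rightarrow> real) \<Rightarrow> real set \<Rightarrow> (real \<Rightarrow> 'v) \<Rightarrow> bool" where
  "maximal_geodesic S h J c \<longleftrightarrow> geodesic S h J c \<and>
     (\<forall>J' c'. geodesic S h J' c' \<and> J \<subseteq> J' \<and> (\<forall>t\<in>J. c' t = c t) \<longrightarrow> J' = J)"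

definition timelike_curve :: "('v::real_vector \<Rightarrow> 'v \<Rightarrow> 'v \<Rightarrow> real) \<Rightarrow> real set \<Rightarrow> (real \<Rightarrow> 'v) \<Rightarrow> bool" where
  "timelike_curve h J c \<longleftrightarrow> (\<forall>t\<in>J. h (c t) (velocity c t) (velocity c t) < 0)"

definition null_curve :: "('v::real_vector \<Rightarrow> 'v \<Rightarrow> 'v \<Rightarrow> real) \<Rightarrow> real set \<Rightarrow> (real \<Rightarrow> 'v) \<Rightarrow> bool" where
  "null_curve h J c \<longleftrightarrow> (\<forall>t\<in>J. h (c t) (velocity c t) (velocity c t) = 0)"

definition spacelike_curve :: "('v::real_vector \<Rightarrow> 'v \<Rightarrow> 'v \<Rightarrow> real) \<Rightarrow> real set \<Rightarrow> (real \<Rightarrow> 'v) \<Rightarrow> bool" where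
  "spacelike_curve h J c \<longleftrightarrow> (\<forall>t\<in>J. h (c t) (velocity c t) (velocity c t) > 0)"

definition geodesic_joining ::
    "'v::real_vector set \<Rightarrow> ('v \<Rightarrow> 'v \<Rightarrow> 'v \<Rightarrow> real) \<Rightarrow> 'v \<Rightarrow> 'v \<Rightarrow> real set \<Rightarrow> (real \<Rightarrow> 'v) \<Rightarrow> bool" where
  "geodesic_joining S h p q J c \<longleftrightarrow> maximal_geodesic S h J c \<and> p \<in> c ` J \<and> q \<in> c ` J"

text \<open>Uniqueness refers to unparametrized maximal geodesics, i.e. to their traces: a closed geodesic
  through \<open>p\<close> and \<open>q\<close> (an ellipse) counts once although it contains two arcs from \<open>p\<close> to \<open>q\<close>.\<close>

definition unique_geodesic_joining ::
    "'v::real_vector set \<Rightarrow> ('v \<Rightarrow> 'v \<Rightarrow> 'v \<Rightarrow> real) \<Rightarrow> 'v \<Rightarrow> 'v \<Rightarrow> bool" where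
  "unique_geodesic_joining S h p q \<longleftrightarrow> (\<exists>!G. \<exists>J c. geodesic_joining S h p q J c \<and> G = c ` J)"

text \<open>\<open>\<langle>u, v\<rangle> = tr(uv)/2\<close> on trace-free endomorphisms, so that \<open>\<langle>u, u\<rangle> = - det u\<close>.\<close>

definition sl_form :: "('e::real_vector \<Rightarrow> 'e) \<Rightarrow> ('e \<Rightarrow> 'e) \<Rightarrow> real" where
  "sl_form u v = lin_trace (u \<circ> v) / 2"

definition de_sitter :: "('e::real_vector \<Rightarrow> 'e) set" where
  "de_sitter = {u. linear u \<and> lin_trace u = 0 \<and> sl_form u u = 1}"

definition de_sitter_metric :: "('e::real_vector \<Rightarrow> 'e) \<Rightarrow> ('e \<Rightarrow> 'e) \<Rightarrow> ('e \<Rightarrow> 'e) \<Rightarrow> real" where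
  "de_sitter_metric p X Y = sl_form X Y"

definition form_endo :: "('e::real_vector \<Rightarrow> 'e \<Rightarrow> real) \<Rightarrow> ('e \<Rightarrow> 'e \<Rightarrow> real) \<Rightarrow> 'e \<Rightarrow> 'e" where
  "form_endo \<omega> g = (THE I. linear I \<and> g = (\<lambda>u v. \<omega> u (I v)))"

text \<open>The pullback of the de Sitter metric along \<open>form_endo \<omega>\<close>, which is linear in \<open>g\<close> and hence its
  own differential.\<close>

definition natural_metric ::
    "('e::real_vector \<Rightarrow> 'e \<Rightarrow> real) \<Rightarrow>
     ('e \<Rightarrow> 'e \<Rightarrow> real) \<Rightarrow> ('e \<Rightarrow> 'e \<Rightarrow> real) \<Rightarrow> ('e \<Rightarrow> 'e \<Rightarrow> real) \<Rightarrow> real" where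
  "natural_metric \<omega> g X Y = de_sitter_metric (form_endo \<omega> g) (form_endo \<omega> X) (form_endo \<omega> Y)"

definition act_form :: "('e \<Rightarrow> 'e) \<Rightarrow> ('e \<Rightarrow> 'e \<Rightarrow> real) \<Rightarrow> 'e \<Rightarrow> 'e \<Rightarrow> real" where
  "act_form \<gamma> g = (\<lambda>u v. g (inv \<gamma> u) (inv \<gamma> v))"

definition act_endo :: "('e \<Rightarrow> 'e) \<Rightarrow> ('e \<Rightarrow> 'e) \<Rightarrow> 'e \<Rightarrow> 'e" where
  "act_endo \<gamma> u = \<gamma> \<circ> u \<circ> inv \<gamma>"

end

theory Submission
  imports Defs
begin

text \<open>
  The inner product \<open>g = \<omega>(\<sqdot>, I\<sqdot>)\<close> is determined by \<open>I\<close>. Symmetry of \<open>g\<close> means \<open>tr I = 0\<close>, and the Gram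
  determinant of \<open>g\<close> on a pair \<open>(e, f)\<close> is \<open>det I \<sqdot> \<omega>(e, f)\<^sup>2\<close>, so that \<open>g\<close> is Lorentzian with volume form
  \<open>\<omega>\<close> exactly when \<open>det I = -1\<close>. The matrix entries of \<open>I\<close> are linear coordinates in which both the
  space of inner products and the de Sitter universe become the quadric \<open>\<langle>x, x\<rangle> = 1\<close> in
  \<open>\<real>\<^sup>3\<close> with the Minkowski product \<open>mink\<close>. Everything that concerns the metric is
  therefore proved once, for the locale \<open>pseudosphere\<close> of linear copies of this quadric, and is then
  applied to \<open>form_frame\<close> and to \<open>sl_frame\<close>.

  Let \<open>\<gamma>\<close> be a curve on the quadric. Its geodesic equation in a chart says that \<open>\<gamma>''\<close> is orthogonal to the
  tangent plane, which is \<open>\<gamma>\<^sup>\<bottom>\<close>; hence \<open>\<gamma>''\<close> is a multiple of \<open>\<gamma>\<close>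
  (\<open>geodesic_iff_acceleration_normal\<close>). Differentiating \<open>\<langle>\<gamma>', \<gamma>\<rangle> = 0\<close> gives \<open>\<gamma>'' = -\<kappa> \<gamma>\<close>
  with \<open>\<kappa> = \<langle>\<gamma>', \<gamma>'\<rangle>\<close>, and \<open>\<kappa>\<close> is constant. Thus the geodesics are the curves
  \<open>C(t) p + S(t) v\<close>, where \<open>(C, S)\<close> is \<open>(cos, sin)\<close>, \<open>(1, t)\<close> or \<open>(cosh, sinh)\<close> up to scaling, according
  to the sign of \<open>\<kappa> = \<langle>v, v\<rangle>\<close> (\<open>geodesic_eq_geod\<close>). They are defined for all times, so a geodesic is maximal if and
  only if its domain is the whole line.

  If such a curve starts at \<open>p\<close> and reaches \<open>q\<close> at time \<open>t\<close>, then \<open>\<tau> = \<langle>p, q\<rangle>\<close> equals \<open>C(t)\<close>. Since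
  \<open>cosh \<ge> 1\<close> and \<open>-1 \<le> cos \<le> 1\<close>, the value \<open>\<tau>\<close> decides the causal type. Moreover
  \<open>C\<^sup>2 + \<kappa> S\<^sup>2 = 1\<close>, hence \<open>S(t) = 0\<close> only if \<open>q = p\<close> or \<open>q = -p\<close>; otherwise \<open>v\<close> is a multiple of
  \<open>q - \<tau> p\<close> and the trace of the geodesic is unique (\<open>geodesic_joining_causal_type\<close>).
  Finally \<open>g' = g(A\<sqdot>, \<sqdot>)\<close> holds if and only if \<open>A = I\<^sub>g \<circ> I\<^sub>g\<^sub>'\<close>
  (\<open>relative_endomorphism\<close>), so \<open>tr A = 2\<tau>\<close>, which turns the conditions on \<open>\<tau>\<close> into those on \<open>tr A\<close>.
\<close>

section \<open>Smooth functions\<close>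

text \<open>
  Smoothness of \<open>f\<close> asks for a whole tree of iterated partial derivatives. It is enough to find a set
  \<open>P\<close> of functions whose first partial derivatives are polynomials in members of \<open>P\<close>, since this
  property is inherited by all polynomials in \<open>P\<close>; see \<open>smooth_on_coinduct\<close>.
\<close>

inductive poly_in :: "(('a \<Rightarrow> real) \<Rightarrow> bool) \<Rightarrow> ('a \<Rightarrow> real) \<Rightarrow> bool" for P where
  base: "P f \<Longrightarrow> poly_in P f"
| const: "poly_in P (\<lambda>_. c)"
| add: "poly_in P f \<Longrightarrow> poly_in P g \<Longrightarrow> poly_in P (\<lambda>x. f x + g x)"
| mult: "poly_in P f \<Longrightarrow> poly_in P g \<Longrightarrow> poly_in P (\<lambda>x. f x * g x)"

definition has_partials ::
    "'a::euclidean_space set \<Rightarrow> ('a \<Rightarrow> 'b::real_normed_vector) \<Rightarrow> ('a \<Rightarrow> 'a \<Rightarrow> 'b) \<Rightarrow> bool" where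
  "has_partials U f g \<longleftrightarrow>
     (\<forall>x\<in>U. (f has_derivative (\<lambda>d. \<Sum>i\<in>Basis. (d \<bullet> i) *\<^sub>R g i x)) (at x))"

lemma has_partials_const: "has_partials U (\<lambda>_. c) (\<lambda>_ _. 0)"
  by (simp add: has_partials_def)

lemma has_partials_add:
  assumes "has_partials U f f'" "has_partials U g g'"
  shows "has_partials U (\<lambda>x. f x + g x) (\<lambda>i x. f' i x + g' i x)"
  using assms unfolding has_partials_def
  by (auto intro!: derivative_eq_intros simp: sum.distrib scaleR_add_right)

lemma has_partials_mult:
  fixes f g :: "_ \<Rightarrow> real"
  assumes "has_partials U f f'" "has_partials U g g'"
  shows "has_partials U (\<lambda>x. f x * g x) (\<lambda>i x. f x * g' i x + f' i x * g x)"
  using assms unfolding has_partials_def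
  by (auto intro!: derivative_eq_intros
      simp: sum.distrib sum_distrib_left sum_distrib_right algebra_simps)

lemma has_partials_linear:
  fixes l :: "'a::euclidean_space \<Rightarrow> 'b::real_normed_vector"
  assumes "linear l"
  shows "has_partials U l (\<lambda>i _. l i)"
proof -
  have *: "l d = (\<Sum>i\<in>Basis. (d \<bullet> i) *\<^sub>R l i)" for d
    using linear_sum[OF assms, of "\<lambda>i. (d \<bullet> i) *\<^sub>R i" Basis]
    by (simp add: euclidean_representation linear_scale[OF assms])
  have "(l has_derivative l) (at x)" for x
    using assms by (simp add: bounded_linear_imp_has_derivative linear_conv_bounded_linear)
  moreover have "l = (\<lambda>d. \<Sum>i\<in>Basis. (d \<bullet> i) *\<^sub>R l i)"
    using * by blast
  ultimately show ?thesis
    unfolding has_partials_def by metis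
qed

lemma has_partials_real:
  fixes f :: "real \<Rightarrow> 'b::real_normed_vector"
  shows "has_partials U f f' \<longleftrightarrow> (\<forall>t\<in>U. (f has_vector_derivative f' 1 t) (at t))"
  by (simp add: has_partials_def has_vector_derivative_def)

text \<open>
  The sum rule and the product rule.
\<close>

lemma poly_in_partials:
  assumes P: "\<And>f. P f \<Longrightarrow> \<exists>g. (\<forall>i\<in>Basis. poly_in P (g i)) \<and> has_partials U f g"
    and "poly_in P f"
  shows "\<exists>g. (\<forall>i\<in>Basis. poly_in P (g i)) \<and> has_partials U f g"
  using assms(2)
proof induction
  case (base f)
  then show ?case by (rule P)
next
  case (const c)
  show ?case
    by (rule exI[of _ "\<lambda>_ _. 0"]) (auto intro: has_partials_const poly_in.const)
next
  case (add f g)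
  then obtain f' g' where *: "\<forall>i\<in>Basis. poly_in P (f' i)" "has_partials U f f'"
    "\<forall>i\<in>Basis. poly_in P (g' i)" "has_partials U g g'"
    by blast
  then have "\<forall>i\<in>Basis. poly_in P (\<lambda>x. f' i x + g' i x)"
    by (auto intro: poly_in.add)
  with has_partials_add[OF *(2,4)] show ?case
    by (intro exI[of _ "\<lambda>i x. f' i x + g' i x"] conjI)
next
  case (mult f g)
  then obtain f' g' where *: "\<forall>i\<in>Basis. poly_in P (f' i)" "has_partials U f f'"
    "\<forall>i\<in>Basis. poly_in P (g' i)" "has_partials U g g'"
    by blast
  have "\<forall>i\<in>Basis. poly_in P (\<lambda>x. f x * g' i x + f' i x * g x)"
    using * mult.hyps by (intro ballI poly_in.add poly_in.mult) auto
  with has_partials_mult[OF *(2,4)] show ?case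
    by (intro exI[of _ "\<lambda>i x. f x * g' i x + f' i x * g x"] conjI)
qed

text \<open>
  Choosing for every polynomial in \<open>P\<close> partial derivatives of the same kind, one iterates the choice
  along the list of directions. Products of smooth functions, the function \<open>1/x\<close> and trigonometric
  functions are all treated in this way, without a formula for the higher derivatives.
\<close>

lemma smooth_on_coinduct:
  assumes P: "\<And>f. P f \<Longrightarrow> \<exists>g. (\<forall>i\<in>Basis. poly_in P (g i)) \<and> has_partials U f g"
    and f: "poly_in P f"
  shows "smooth_on U f"
proof -
  obtain G where G: "\<And>f. poly_in P f \<Longrightarrow> (\<forall>i\<in>Basis. poly_in P (G f i)) \<and> has_partials U f (G f)"
    using poly_in_partials[of P U, OF P] by metis
  define D where "D is = foldr (\<lambda>i h. G h i) is f" for "is"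
  have D: "poly_in P (D is)" if "set is \<subseteq> Basis" for "is"
    using that by (induction "is") (auto simp: D_def f G)
  show ?thesis
    unfolding smooth_on_def
  proof (intro exI[of _ D] conjI allI ballI impI)
    show "D [] x = f x" for x by (simp add: D_def)
    fix "is" x assume "set is \<subseteq> (Basis::'a set)" "x \<in> U"
    then have "has_partials U (D is) (G (D is))"
      using G D by blast
    then show "(D is has_derivative (\<lambda>d. \<Sum>i\<in>Basis. D (i # is) x * (d \<bullet> i))) (at x)"
      using \<open>x \<in> U\<close> by (simp add: has_partials_def D_def mult.commute)
  qed
qed

lemma smooth_on_partials:
  assumes f: "smooth_on U f" and "open U"
  shows "\<exists>g. (\<forall>i\<in>Basis. smooth_on U (g i)) \<and> has_partials U f g"
proof -
  obtain D where D0: "\<And>x. x \<in> U \<Longrightarrow> D [] x = f x"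
    and D: "\<And>is x. set is \<subseteq> Basis \<Longrightarrow> x \<in> U \<Longrightarrow>
        (D is has_derivative (\<lambda>d. \<Sum>i\<in>Basis. D (i # is) x * (d \<bullet> i))) (at x)"
    using f unfolding smooth_on_def by blast
  have "smooth_on U (D [i])" if "i \<in> Basis" for i
    unfolding smooth_on_def
    by (rule exI[of _ "\<lambda>js. D (js @ [i])"]) (use D that in auto)
  moreover have "has_partials U f (\<lambda>i. D [i])"
    unfolding has_partials_def
  proof
    fix x assume x: "x \<in> U"
    have "(D [] has_derivative (\<lambda>d. \<Sum>i\<in>Basis. (d \<bullet> i) *\<^sub>R D [i] x)) (at x)"
      using D[of "[]", OF _ x] by (simp add: mult.commute)
    then show "(f has_derivative (\<lambda>d. \<Sum>i\<in>Basis. (d \<bullet> i) *\<^sub>R D [i] x)) (at x)"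
      by (rule has_derivative_transform_within_open[OF _ \<open>open U\<close> x]) (simp add: D0)
  qed
  ultimately show ?thesis
    by (intro exI[of _ "\<lambda>i. D [i]"]) auto
qed

lemma smooth_on_cong:
  assumes "\<And>x. x \<in> U \<Longrightarrow> f x = g x" "smooth_on U f"
  shows "smooth_on U g"
proof -
  obtain D where D: "\<forall>x\<in>U. D [] x = f x"
    "\<forall>is. set is \<subseteq> Basis \<longrightarrow>
      (\<forall>x\<in>U. (D is has_derivative (\<lambda>d. \<Sum>i\<in>Basis. D (i # is) x * (d \<bullet> i))) (at x))"
    using assms(2) unfolding smooth_on_def by blast
  then show ?thesis
    using assms(1) unfolding smooth_on_def by (intro exI[of _ D] conjI) simp_all
qed

lemma smooth_on_subset:
  assumes "smooth_on U f" "V \<subseteq> U"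
  shows "smooth_on V f"
proof -
  obtain D where D: "\<forall>x\<in>U. D [] x = f x"
    "\<forall>is. set is \<subseteq> Basis \<longrightarrow>
      (\<forall>x\<in>U. (D is has_derivative (\<lambda>d. \<Sum>i\<in>Basis. D (i # is) x * (d \<bullet> i))) (at x))"
    using assms(1) unfolding smooth_on_def by blast
  then show ?thesis
    using assms(2) unfolding smooth_on_def by (intro exI[of _ D] conjI) blast+
qed

lemma smooth_on_poly:
  assumes "open U" "poly_in (smooth_on U) f"
  shows "smooth_on U f"
  by (rule smooth_on_coinduct[of "smooth_on U"])
    (use smooth_on_partials[OF _ assms(1)] assms in \<open>blast intro: poly_in.base\<close>)+

lemma smooth_on_const [simp]: "smooth_on U (\<lambda>_. c)"
  by (rule smooth_on_coinduct[of "\<lambda>_. False"]) (auto intro: poly_in.const)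

lemma smooth_on_add:
  assumes "open U" "smooth_on U f" "smooth_on U g"
  shows "smooth_on U (\<lambda>x. f x + g x)"
  using poly_in.add[OF poly_in.base[of "smooth_on U", OF assms(2)]
      poly_in.base[of "smooth_on U", OF assms(3)]]
  by (rule smooth_on_poly[OF assms(1)])

lemma smooth_on_mult:
  assumes "open U" "smooth_on U f" "smooth_on U g"
  shows "smooth_on U (\<lambda>x. f x * g x)"
  using poly_in.mult[OF poly_in.base[of "smooth_on U", OF assms(2)]
      poly_in.base[of "smooth_on U", OF assms(3)]]
  by (rule smooth_on_poly[OF assms(1)])

lemma smooth_on_diff:
  assumes "open U" "smooth_on U f" "smooth_on U g"
  shows "smooth_on U (\<lambda>x. f x - g x)"
  using smooth_on_add[OF assms(1,2) smooth_on_mult[OF assms(1) smooth_on_const[of U "-1"] assms(3)]]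
  by simp

lemma smooth_on_sum:
  assumes "open U" "\<And>i. i \<in> I \<Longrightarrow> smooth_on U (f i)"
  shows "smooth_on U (\<lambda>x. \<Sum>i\<in>I. f i x)"
  using assms(2)
  by (induction I rule: infinite_finite_induct) (auto intro!: smooth_on_add assms(1))

lemma smooth_on_linear:
  fixes l :: "'a::euclidean_space \<Rightarrow> real"
  assumes "linear l"
  shows "smooth_on U l"
proof (rule smooth_on_coinduct[of "\<lambda>f. f = l"])
  show "\<exists>g. (\<forall>i\<in>Basis. poly_in (\<lambda>f. f = l) (g i)) \<and> has_partials U f g" if "f = l" for f
    using has_partials_linear[OF assms, of U] that
    by (intro exI[of _ "\<lambda>i _. l i"]) (auto intro: poly_in.const)
qed (simp add: poly_in.base)

text \<open>
  Here \<open>P\<close> consists of \<open>1/l\<close> alone: its partial derivatives are constant multiples of its square.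
\<close>

lemma smooth_on_inverse:
  assumes "linear l" "\<And>x. x \<in> U \<Longrightarrow> l x \<noteq> 0"
  shows "smooth_on U (\<lambda>x. inverse (l x) :: real)"
proof (rule smooth_on_coinduct[of "\<lambda>f. f = (\<lambda>x. inverse (l x))"])
  fix f assume f: "f = (\<lambda>x. inverse (l x) :: real)"
  have "has_partials U f (\<lambda>i x. - l i * (inverse (l x) * inverse (l x)))"
    unfolding has_partials_def f
  proof
    fix x assume x: "x \<in> U"
    have "(l has_derivative (\<lambda>d. \<Sum>i\<in>Basis. (d \<bullet> i) *\<^sub>R l i)) (at x)"
      using has_partials_linear[OF assms(1), of UNIV] by (simp add: has_partials_def)
    from Deriv.has_derivative_inverse[OF assms(2)[OF x] this]
    show "((\<lambda>x. inverse (l x)) has_derivative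
        (\<lambda>d. \<Sum>i\<in>Basis. (d \<bullet> i) *\<^sub>R (- l i * (inverse (l x) * inverse (l x))))) (at x)"
      by (simp add: sum_distrib_left sum_distrib_right sum_negf algebra_simps)
  qed
  moreover have "poly_in (\<lambda>f. f = (\<lambda>x. inverse (l x))) (\<lambda>x. - l i * (inverse (l x) * inverse (l x)))" for i
    by (intro poly_in.mult poly_in.const poly_in.base) simp_all
  ultimately show "\<exists>g. (\<forall>i\<in>Basis. poly_in (\<lambda>f. f = (\<lambda>x. inverse (l x))) (g i)) \<and> has_partials U f g"
    by (intro exI[of _ "\<lambda>i x. - l i * (inverse (l x) * inverse (l x))"] conjI ballI)
qed (simp add: poly_in.base)

lemma has_partials_unique:
  fixes f :: "'a::euclidean_space \<Rightarrow> 'b::real_normed_vector"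
  assumes "has_partials U f g" "has_partials U f g'" "x \<in> U" "i \<in> Basis"
  shows "g i x = g' i x"
proof -
  have "(\<lambda>d. \<Sum>i\<in>Basis. (d \<bullet> i) *\<^sub>R g i x) = (\<lambda>d. \<Sum>i\<in>Basis. (d \<bullet> i) *\<^sub>R g' i x)"
    using assms(1-3) unfolding has_partials_def by (blast intro: has_derivative_unique)
  from fun_cong[OF this, of i] show ?thesis
    using assms(4) by (simp add: inner_Basis if_distrib[of "\<lambda>c. c *\<^sub>R _"] sum.delta cong: if_cong)
qed

lemma has_partials_line:
  fixes f :: "'a::euclidean_space \<Rightarrow> real"
  assumes "has_partials U f g" "i \<in> Basis" "x + s *\<^sub>R i \<in> U"
  shows "((\<lambda>s. f (x + s *\<^sub>R i)) has_real_derivative g i (x + s *\<^sub>R i)) (at s)"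
proof -
  have f: "(f has_derivative (\<lambda>d. \<Sum>j\<in>Basis. (d \<bullet> j) *\<^sub>R g j (x + s *\<^sub>R i))) (at (x + s *\<^sub>R i))"
    using assms by (auto simp: has_partials_def)
  have l: "((\<lambda>s. x + s *\<^sub>R i) has_derivative (\<lambda>h. h *\<^sub>R i)) (at s)"
    by (auto intro!: derivative_eq_intros)
  have "((\<lambda>s. f (x + s *\<^sub>R i)) has_derivative (\<lambda>h. \<Sum>j\<in>Basis. ((h *\<^sub>R i) \<bullet> j) *\<^sub>R g j (x + s *\<^sub>R i))) (at s)"
    using has_derivative_compose[OF l f] .
  moreover have "(\<Sum>j\<in>Basis. ((h *\<^sub>R i) \<bullet> j) *\<^sub>R g j (x + s *\<^sub>R i)) = g i (x + s *\<^sub>R i) * h" for h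
    using assms(2)
    by (simp add: inner_Basis if_distrib[of "\<lambda>c. _ * c"] if_distrib[of "\<lambda>c. c * _"] sum.delta cong: if_cong)
  ultimately show ?thesis
    by (simp add: has_field_derivative_def)
qed

text \<open>
  The mean value theorem, applied first in direction \<open>i\<close> and then in direction \<open>k\<close>, expresses a second
  difference, which is symmetric in \<open>i\<close> and \<open>k\<close>, by a mixed second derivative at a nearby point.
\<close>

lemma second_difference:
  fixes f :: "'a::euclidean_space \<Rightarrow> real"
  assumes f: "has_partials (ball x r) f g" and gi: "has_partials (ball x r) (g i) g'"
    and ik: "i \<in> Basis" "k \<in> Basis" and h: "h > 0" "2 * h < r"
  obtains y where "dist x y < 2 * h"
    "f (x + h *\<^sub>R i + h *\<^sub>R k) - f (x + h *\<^sub>R i) - f (x + h *\<^sub>R k) + f x = h * h * g' k y"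
proof -
  have near: "dist x (x + s *\<^sub>R i + t *\<^sub>R k) \<le> s + t" if "0 \<le> s" "0 \<le> t" for s t
  proof -
    have "dist x (x + s *\<^sub>R i + t *\<^sub>R k) = norm (s *\<^sub>R i + t *\<^sub>R k)"
      by (subst dist_commute) (simp add: dist_norm add.assoc)
    then show ?thesis
      using norm_triangle_ineq[of "s *\<^sub>R i" "t *\<^sub>R k"] that ik by simp
  qed
  have inball: "x + s *\<^sub>R i + t *\<^sub>R k \<in> ball x r" if "0 \<le> s" "0 \<le> t" "s \<le> h" "t \<le> h" for s t
    using near[OF that(1,2)] that h by (simp add: mem_ball)
  let ?u = "\<lambda>s. f ((x + h *\<^sub>R k) + s *\<^sub>R i) - f (x + s *\<^sub>R i)"
  have "\<exists>z. 0 < z \<and> z < h \<and> ?u h - ?u 0 =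
      (h - 0) * (g i ((x + h *\<^sub>R k) + z *\<^sub>R i) - g i (x + z *\<^sub>R i))"
  proof (rule MVT2[OF h(1)])
    fix s assume s: "0 \<le> s" "s \<le> h"
    have "(x + h *\<^sub>R k) + s *\<^sub>R i \<in> ball x r" "x + s *\<^sub>R i \<in> ball x r"
      using inball[of s h] inball[of s 0] s h by (simp_all add: algebra_simps)
    then show "((\<lambda>s. f ((x + h *\<^sub>R k) + s *\<^sub>R i) - f (x + s *\<^sub>R i)) has_real_derivative
        g i ((x + h *\<^sub>R k) + s *\<^sub>R i) - g i (x + s *\<^sub>R i)) (at s)"
      by (intro DERIV_diff has_partials_line[OF f ik(1)])
  qed
  then obtain z where z: "0 < z" "z < h"
    "?u h - ?u 0 = h * (g i ((x + h *\<^sub>R k) + z *\<^sub>R i) - g i (x + z *\<^sub>R i))"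
    by auto
  let ?v = "\<lambda>t. g i ((x + z *\<^sub>R i) + t *\<^sub>R k)"
  have "\<exists>w. 0 < w \<and> w < h \<and> ?v h - ?v 0 = (h - 0) * g' k ((x + z *\<^sub>R i) + w *\<^sub>R k)"
  proof (rule MVT2[OF h(1)])
    fix t assume t: "0 \<le> t" "t \<le> h"
    then have "(x + z *\<^sub>R i) + t *\<^sub>R k \<in> ball x r"
      using inball[of z t] z by auto
    then show "(?v has_real_derivative g' k ((x + z *\<^sub>R i) + t *\<^sub>R k)) (at t)"
      by (rule has_partials_line[OF gi ik(2)])
  qed
  then obtain w where w: "0 < w" "w < h"
    "?v h - ?v 0 = h * g' k ((x + z *\<^sub>R i) + w *\<^sub>R k)"
    by auto
  show ?thesis
  proof
    show "dist x ((x + z *\<^sub>R i) + w *\<^sub>R k) < 2 * h"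
      using near[of z w] z w by simp
    have "g i ((x + h *\<^sub>R k) + z *\<^sub>R i) - g i (x + z *\<^sub>R i) = h * g' k ((x + z *\<^sub>R i) + w *\<^sub>R k)"
      using w(3) by (simp add: algebra_simps)
    then have "?u h - ?u 0 = h * h * g' k ((x + z *\<^sub>R i) + w *\<^sub>R k)"
      using z(3) by simp
    then show "f (x + h *\<^sub>R i + h *\<^sub>R k) - f (x + h *\<^sub>R i) - f (x + h *\<^sub>R k) + f x
        = h * h * g' k ((x + z *\<^sub>R i) + w *\<^sub>R k)"
      by (simp add: algebra_simps)
  qed
qed

text \<open>
  The symmetry of second derivatives. It enters the computation of the Christoffel symbols in
  \<open>geodesic_equation_iff_normal\<close>.
\<close>

lemma mixed_partials_commute:
  fixes f :: "'a::euclidean_space \<Rightarrow> real"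
  assumes "open U" "x \<in> U" and ik: "i \<in> Basis" "k \<in> Basis"
    and f: "has_partials U f g" and gi: "has_partials U (g i) a" and gk: "has_partials U (g k) b"
    and cont: "isCont (a k) x" "isCont (b i) x"
  shows "a k x = b i x"
proof (rule ccontr)
  assume "a k x \<noteq> b i x"
  define e where "e = \<bar>a k x - b i x\<bar> / 2"
  then have e: "e > 0" using \<open>a k x \<noteq> b i x\<close> by simp
  obtain r where r: "r > 0" "ball x r \<subseteq> U"
    using assms(1,2) open_contains_ball by blast
  obtain d1 where d1: "d1 > 0" "\<And>y. dist y x < d1 \<Longrightarrow> dist (a k y) (a k x) < e"
    using cont(1) e unfolding continuous_at_eps_delta by blast
  obtain d2 where d2: "d2 > 0" "\<And>y. dist y x < d2 \<Longrightarrow> dist (b i y) (b i x) < e"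
    using cont(2) e unfolding continuous_at_eps_delta by blast
  define h where "h = Min {r, d1, d2} / 3"
  \<comment> \<open>The points provided by the mean value theorem are at distance less than \<open>2 * h\<close> from \<open>x\<close>.\<close>
  have m: "Min {r, d1, d2} > 0" using r d1 d2 by simp
  have h: "h > 0" "2 * h < r" "2 * h < d1" "2 * h < d2"
    using m by (auto simp: h_def) 
  have sub: "has_partials (ball x r) F F'" if "has_partials U F F'" for F F' :: "_ \<Rightarrow> _"
    using that r(2) by (auto simp: has_partials_def)
  obtain y where y: "dist x y < 2 * h"
    "f (x + h *\<^sub>R i + h *\<^sub>R k) - f (x + h *\<^sub>R i) - f (x + h *\<^sub>R k) + f x = h * h * a k y"
    using second_difference[OF sub[OF f] sub[OF gi] ik h(1,2)] by blast
  obtain z where z: "dist x z < 2 * h"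
    "f (x + h *\<^sub>R k + h *\<^sub>R i) - f (x + h *\<^sub>R k) - f (x + h *\<^sub>R i) + f x = h * h * b i z"
    using second_difference[OF sub[OF f] sub[OF gk] ik(2,1) h(1,2)] by blast
  have "h * h * a k y = h * h * b i z"
    unfolding y(2)[symmetric] z(2)[symmetric] by (simp add: algebra_simps)
  then have "a k y = b i z" using h(1) by simp
  then have "\<bar>a k x - b i x\<bar> \<le> \<bar>a k y - a k x\<bar> + \<bar>b i z - b i x\<bar>"
    by linarith
  moreover have "\<bar>a k y - a k x\<bar> < e" "\<bar>b i z - b i x\<bar> < e"
    using d1(2)[of y] d2(2)[of z] y(1) z(1) h by (auto simp: dist_commute dist_real_def)
  ultimately show False
    unfolding e_def by (simp add: field_simps)
qed

section \<open>Maps into finite-dimensional subspaces\<close>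

lemma smooth_map_linear_comp:
  assumes "smooth_map U F" "linear l"
  shows "smooth_map U (\<lambda>x. l (F x))"
  unfolding smooth_map_def
proof (intro allI impI)
  fix l' :: "'c \<Rightarrow> real" assume "linear l'"
  then have "linear (l' \<circ> l)"
    using assms(2) by (rule linear_compose[rotated])
  with assms(1) have "smooth_on U (\<lambda>x. (l' \<circ> l) (F x))"
    unfolding smooth_map_def by blast
  then show "smooth_on U (\<lambda>x. l' (l (F x)))" by simp
qed

lemma smooth_map_cong:
  assumes "\<And>x. x \<in> U \<Longrightarrow> F x = G x" "smooth_map U F"
  shows "smooth_map U G"
  unfolding smooth_map_def
proof (intro allI impI)
  fix l :: "'b \<Rightarrow> real" assume "linear l"
  then have "smooth_on U (\<lambda>x. l (F x))" using assms(2) by (simp add: smooth_map_def)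
  then show "smooth_on U (\<lambda>x. l (G x))"
    by (rule smooth_on_cong[rotated]) (simp add: assms(1))
qed

lemma smooth_map_subset:
  assumes "smooth_map U F" "V \<subseteq> U"
  shows "smooth_map V F"
  using assms smooth_on_subset unfolding smooth_map_def by blast

lemma smooth_map_componentwise:
  fixes F :: "'a::euclidean_space \<Rightarrow> 'c::euclidean_space"
  assumes "open U" "\<And>b. b \<in> Basis \<Longrightarrow> smooth_on U (\<lambda>x. F x \<bullet> b)"
  shows "smooth_map U F"
  unfolding smooth_map_def
proof (intro allI impI)
  fix l :: "'c \<Rightarrow> real" assume l: "linear l"
  have "l (F x) = (\<Sum>b\<in>Basis. (F x \<bullet> b) * l b)" for x
    using linear_sum[OF l, of "\<lambda>i. (F x \<bullet> i) *\<^sub>R i" Basis]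
    by (simp add: euclidean_representation linear_scale[OF l])
  then show "smooth_on U (\<lambda>x. l (F x))"
    by (auto intro!: smooth_on_sum smooth_on_mult assms)
qed

lemma smooth_map_component:
  fixes F :: "'a::euclidean_space \<Rightarrow> 'c::euclidean_space"
  assumes "smooth_map U F"
  shows "smooth_on U (\<lambda>x. F x \<bullet> b)"
proof -
  have "linear (\<lambda>v::'c. v \<bullet> b)"
    by (simp add: bounded_linear.linear bounded_linear_inner_left)
  with assms show ?thesis unfolding smooth_map_def by blast
qed

lemma smooth_map_partials:
  fixes F :: "'a::euclidean_space \<Rightarrow> 'c::euclidean_space"
  assumes "smooth_map U F" "open U"
  obtains g where "\<And>i. i \<in> Basis \<Longrightarrow> smooth_map U (g i)" "has_partials U F g"
proof -
  have "\<forall>b. \<exists>g. (\<forall>i\<in>Basis. smooth_on U (g i)) \<and> has_partials U (\<lambda>x. F x \<bullet> b) g"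
    using smooth_map_component[OF assms(1)] smooth_on_partials assms(2) by blast
  then obtain g where g: "\<And>b i. i \<in> Basis \<Longrightarrow> smooth_on U (g b i)"
    "\<And>b. has_partials U (\<lambda>x. F x \<bullet> b) (g b)"
    by metis
  let ?G = "\<lambda>i x. \<Sum>b\<in>Basis. g b i x *\<^sub>R b"
  show ?thesis
  proof
    fix i :: 'a assume "i \<in> Basis"
    then show "smooth_map U (?G i)"
      by (intro smooth_map_componentwise) (simp_all add: assms(2) g)
  next
    show "has_partials U F ?G"
      unfolding has_partials_def
    proof
      fix x assume x: "x \<in> U"
      show "(F has_derivative (\<lambda>d. \<Sum>i\<in>Basis. (d \<bullet> i) *\<^sub>R ?G i x)) (at x)"
        unfolding has_derivative_componentwise_within[of F]
      proof
        fix b :: 'c assume b: "b \<in> Basis"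
        show "((\<lambda>x. F x \<bullet> b) has_derivative (\<lambda>d. (\<Sum>i\<in>Basis. (d \<bullet> i) *\<^sub>R ?G i x) \<bullet> b)) (at x)"
        proof -
          have "(\<Sum>i\<in>Basis. (d \<bullet> i) *\<^sub>R ?G i x) \<bullet> b = (\<Sum>i\<in>Basis. (d \<bullet> i) *\<^sub>R g b i x)" for d
            by (subst inner_sum_left) (simp only: inner_scaleR_left inner_sum_left_Basis[OF b] real_scaleR_def)
          then show ?thesis
            using g(2)[of b] x by (simp only: has_partials_def)
        qed
      qed
    qed
  qed
qed

lemma smooth_map_partial:
  fixes F :: "'a::euclidean_space \<Rightarrow> 'c::euclidean_space"
  assumes "smooth_map U F" "open U" "has_partials U F g" "i \<in> Basis"
  shows "smooth_map U (g i)"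
proof -
  obtain g' where g': "\<And>i. i \<in> Basis \<Longrightarrow> smooth_map U (g' i)" "has_partials U F g'"
    using smooth_map_partials[OF assms(1,2)] by blast
  have "g' i x = g i x" if "x \<in> U" for x
    using has_partials_unique[OF g'(2) assms(3) that assms(4)] .
  then show ?thesis
    using smooth_map_cong g'(1)[OF assms(4)] by blast
qed

text \<open>
  This makes a derivative that is tested by all linear functionals unique, so that the definite
  description in \<open>dirderiv\<close> denotes.
\<close>

lemma linear_functional_separates:
  fixes v w :: "'v::real_vector"
  assumes "\<And>l :: 'v \<Rightarrow> real. linear l \<Longrightarrow> l v = l w"
  shows "v = w"
proof (rule ccontr)
  assume "v \<noteq> w"
  then have "independent {v - w}" by simp
  then obtain l :: "'v \<Rightarrow> real" where "linear l" "\<forall>x\<in>{v - w}. l x = 1"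
    using linear_independent_extend[of "{v - w}" "\<lambda>_. 1"] by blast
  then show False
    using assms[of l] by (simp add: linear_diff)
qed

text \<open>
  Linear coordinates on a finite-dimensional subspace, the range of \<open>\<Phi>\<close>, of a possibly
  infinite-dimensional space. Because \<open>\<Psi>\<close> is linear on the whole space, composition with \<open>\<Phi>\<close> and \<open>\<Psi>\<close>
  translates between linear functionals on both sides, and with them smoothness and derivatives.
\<close>

locale frame =
  fixes \<Phi> :: "'c::euclidean_space \<Rightarrow> 'v::real_vector" and \<Psi> :: "'v \<Rightarrow> 'c"
  assumes linear_\<Phi>: "linear \<Phi>" and linear_\<Psi>: "linear \<Psi>" and \<Psi>_\<Phi> [simp]: "\<Psi> (\<Phi> x) = x"
begin

lemma \<Phi>_eq_iff [simp]: "\<Phi> x = \<Phi> y \<longleftrightarrow> x = y"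
  by (metis \<Psi>_\<Phi>)

lemma dirderiv_eq:
  fixes G :: "'a::euclidean_space \<Rightarrow> 'c"
  assumes G: "(G has_derivative G') (at x)" and "open V" "x \<in> V"
    and F: "\<And>y. y \<in> V \<Longrightarrow> F y = \<Phi> (G y)"
  shows "dirderiv F x d = \<Phi> (G' d)"
proof -
  have D: "((\<lambda>s. l (F (x + s *\<^sub>R d))) has_real_derivative l (\<Phi> (G' d))) (at 0)"
    if l: "linear l" for l :: "'v \<Rightarrow> real"
  proof -
    have bl: "bounded_linear (\<lambda>y. l (\<Phi> y))"
      using linear_compose[OF linear_\<Phi> l] by (simp add: linear_conv_bounded_linear o_def)
    have line: "((\<lambda>s. x + s *\<^sub>R d) has_derivative (\<lambda>h. h *\<^sub>R d)) (at 0)"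
      by (auto intro!: derivative_eq_intros)
    have "(G has_derivative G') (at (x + 0 *\<^sub>R d))" using G by simp
    then have "((\<lambda>s. G (x + s *\<^sub>R d)) has_derivative (\<lambda>h. G' (h *\<^sub>R d))) (at 0)"
      using has_derivative_compose[OF line] by blast
    then have "((\<lambda>s. l (\<Phi> (G (x + s *\<^sub>R d)))) has_derivative (\<lambda>h. l (\<Phi> (G' (h *\<^sub>R d))))) (at 0)"
      by (rule bounded_linear.has_derivative[OF bl])
    moreover have "l (\<Phi> (G' (h *\<^sub>R d))) = l (\<Phi> (G' d)) * h" for h
      using has_derivative_linear[OF G]
      by (simp add: linear_scale linear_scale[OF linear_\<Phi>] linear_scale[OF l])
    ultimately have "((\<lambda>s. l (\<Phi> (G (x + s *\<^sub>R d)))) has_derivative (*) (l (\<Phi> (G' d)))) (at 0)"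
      by simp
    moreover have "open ((\<lambda>s. x + s *\<^sub>R d) -` V)"
      by (rule open_vimage[OF \<open>open V\<close>]) (intro continuous_intros)
    ultimately have "((\<lambda>s. l (F (x + s *\<^sub>R d))) has_derivative (*) (l (\<Phi> (G' d)))) (at 0)"
      by (rule has_derivative_transform_within_open) (use \<open>x \<in> V\<close> F in auto)
    then show ?thesis by (simp add: has_field_derivative_def)
  qed
  show ?thesis
    unfolding dirderiv_def
  proof (rule the_equality)
    show "\<forall>l :: 'v \<Rightarrow> real. linear l \<longrightarrow>
        ((\<lambda>s. l (F (x + s *\<^sub>R d))) has_real_derivative l (\<Phi> (G' d))) (at 0)"
      using D by blast
  next
    fix w assume w: "\<forall>l :: 'v \<Rightarrow> real. linear l \<longrightarrow>
        ((\<lambda>s. l (F (x + s *\<^sub>R d))) has_real_derivative l w) (at 0)"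
    show "w = \<Phi> (G' d)"
      by (rule linear_functional_separates) (use w D DERIV_unique in blast)
  qed
qed

lemma dirderiv_partial:
  assumes "has_partials U G g" "open U" "x \<in> U" "\<And>y. y \<in> U \<Longrightarrow> F y = \<Phi> (G y)" "i \<in> Basis"
  shows "dirderiv F x i = \<Phi> (g i x)"
proof -
  have "(G has_derivative (\<lambda>d. \<Sum>i\<in>Basis. (d \<bullet> i) *\<^sub>R g i x)) (at x)"
    using assms by (simp add: has_partials_def)
  from dirderiv_eq[OF this assms(2,3,4)] show ?thesis
    using assms(5)
    by (simp add: inner_Basis if_distrib[of "\<lambda>c. c *\<^sub>R _"] sum.delta cong: if_cong)
qed

lemma velocity_eq:
  assumes "(G has_vector_derivative v) (at t)" "open V" "t \<in> V" "\<And>s. s \<in> V \<Longrightarrow> F s = \<Phi> (G s)"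
  shows "velocity F t = \<Phi> v"
  using dirderiv_eq[OF assms(1)[unfolded has_vector_derivative_def] assms(2-4)] by simp

end

lemma topspace_functional_topology: "topspace functional_topology = (UNIV :: 'v::real_vector set)"
proof -
  have "UNIV = (\<lambda>_::'v. 0::real) -` UNIV" by simp
  moreover have "linear (\<lambda>_::'v. 0::real)" by (simp add: linear_iff)
  ultimately have "UNIV \<in> {l -` T |(l :: 'v \<Rightarrow> real) T. linear l \<and> open T}"
    using open_UNIV by blast
  then show ?thesis
    unfolding functional_topology_def topology_generated_by_topspace by blast
qed

lemma functional_topology_linear:
  assumes "linear l"
  shows "continuous_map functional_topology (euclidean :: real topology) l"
proof -
  have "openin functional_topology (l -` T)" if "open T" for T
    unfolding functional_topology_def
    by (rule topology_generated_by_Basis) (use assms that in blast)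
  then show ?thesis
    unfolding continuous_map_def by (simp add: vimage_def topspace_functional_topology)
qed

lemma functional_topology_linear_pair:
  fixes \<pi> :: "'v::real_vector \<Rightarrow> real \<times> real"
  assumes "linear \<pi>"
  shows "continuous_map functional_topology euclidean \<pi>"
proof -
  have "linear (fst \<circ> \<pi>)" "linear (snd \<circ> \<pi>)"
    by (auto intro!: linear_compose[OF assms] simp: bounded_linear.linear bounded_linear_fst bounded_linear_snd)
  then show ?thesis
    by (simp add: prod_topology_euclidean[symmetric] continuous_map_pairwise functional_topology_linear del: prod_topology_euclidean)
qed

section \<open>Pseudospheres in Minkowski space\<close>

type_synonym vec3 = "real \<times> real \<times> real"

definition mink :: "vec3 \<Rightarrow> vec3 \<Rightarrow> real" where
  "mink u v = fst u * fst v + fst (snd u) * fst (snd v) - snd (snd u) * snd (snd v)"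

lemma bounded_bilinear_mink: "bounded_bilinear mink"
proof -
  have "bilinear mink"
    by (auto simp: bilinear_def linear_iff mink_def algebra_simps)
  then show ?thesis by (simp add: bilinear_conv_bounded_bilinear)
qed

interpretation mink: bounded_bilinear mink
  by (rule bounded_bilinear_mink)

lemma mink_commute: "mink u v = mink v u"
  by (simp add: mink_def)

lemma mink_nondegenerate:
  assumes "\<And>v. mink u v = 0"
  shows "u = 0"
proof -
  have "mink u (1, 0, 0) = 0" "mink u (0, 1, 0) = 0" "mink u (0, 0, 1) = 0"
    by (rule assms)+
  then show ?thesis by (simp add: mink_def prod_eq_iff)
qed

text \<open>
  The normal space of the quadric is spanned by the position vector: the tangent plane, as the range
  of \<open>L\<close>, and \<open>p\<close> span the whole space, and the component of \<open>w\<close> that is orthogonal to \<open>p\<close> is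
  orthogonal to both.
\<close>

lemma mink_normal:
  fixes L :: "real \<times> real \<Rightarrow> vec3"
  assumes L: "linear L" "inj L" and p: "mink p p = 1"
    and tangent: "\<And>d. mink (L d) p = 0" and normal: "\<And>d. mink w (L d) = 0"
  shows "w = mink w p *\<^sub>R p"
proof -
  \<comment> \<open>The tangent plane and the position vector together: an injective, hence surjective map.\<close>
  define M where "M x = L (fst x, fst (snd x)) + snd (snd x) *\<^sub>R p" for x :: vec3
  have "linear M"
    unfolding M_def
    by (intro linear_compose_add linear_compose[OF _ L(1), unfolded o_def])
      (auto simp: linear_iff algebra_simps)
  moreover have "inj M"
  proof (subst linear_injective_0[OF \<open>linear M\<close>], intro allI impI)
    fix x assume x: "M x = 0"
    have "mink (M x) p = snd (snd x)"
      by (simp add: M_def mink.add_left mink.scaleR_left tangent p)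
    then have z: "snd (snd x) = 0" using x by (simp add: mink.zero_left)
    then have "L (fst x, fst (snd x)) = 0" using x by (simp add: M_def)
    then have "(fst x, fst (snd x)) = 0"
      using L by (simp add: linear_injective_0)
    then show "x = 0" using z by (simp add: prod_eq_iff)
  qed
  ultimately have "surj M"
    by (rule linear_inj_imp_surj)
  have "mink (w - mink w p *\<^sub>R p) v = 0" for v
  proof -
    obtain x where "v = M x" using \<open>surj M\<close> by blast
    then show ?thesis
      by (simp add: M_def mink.add_right mink.scaleR_right mink.diff_left mink.scaleR_left
          normal p mink_commute[of p "L _"] tangent)
  qed
  from mink_nondegenerate[OF this] show ?thesis by simp
qed

text \<open>
  A linear copy of the one-sheeted hyperboloid. For the de Sitter universe the coordinates are matrix
  entries; for the space of inner products they are the values on a basis.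
\<close>

locale pseudosphere = frame \<Phi> \<Psi>
  for \<Phi> :: "vec3 \<Rightarrow> 'v::real_vector" and \<Psi> +
  fixes S :: "'v set" and h :: "'v \<Rightarrow> 'v \<Rightarrow> 'v \<Rightarrow> real"
  assumes S_eq: "S = \<Phi> ` {x. mink x x = 1}"
    and h_eq: "p \<in> S \<Longrightarrow> h p (\<Phi> x) (\<Phi> y) = mink x y"
begin

lemma \<Phi>_\<Psi>: "p \<in> S \<Longrightarrow> \<Phi> (\<Psi> p) = p"
  by (auto simp: S_eq)

lemma mink_\<Psi>: "p \<in> S \<Longrightarrow> mink (\<Psi> p) (\<Psi> p) = 1"
  by (auto simp: S_eq)

text \<open>
  With \<open>b = y - z\<close>, the quadric \<open>x\<^sup>2 + (y - z)(y + z) = 1\<close> is the graph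
  \<open>y + z = (1 - x\<^sup>2) / b\<close> over the \<open>(x, b)\<close>-plane without the line \<open>b = 0\<close>. The chart is the inverse of
  the linear map \<open>\<pi>\<close>, which gives injectivity, the immersion property and openness at once. It
  also makes lifting easy: for a smooth curve \<open>c\<close> in the image, \<open>\<pi> \<circ> c\<close> is smooth.
\<close>

lemma ruled_chart:
  assumes p: "p \<in> S" "fst (snd (\<Psi> p)) \<noteq> snd (snd (\<Psi> p))"
  shows "\<exists>U \<phi> (\<pi> :: 'v \<Rightarrow> real \<times> real) (\<beta> :: 'v \<Rightarrow> real). linear \<pi> \<and> linear \<beta> \<and> \<beta> p \<noteq> 0 \<and> chart S U \<phi> \<and>
    (\<forall>q\<in>S. \<beta> q \<noteq> 0 \<longrightarrow> \<pi> q \<in> U \<and> \<phi> (\<pi> q) = q)"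
proof -
  define \<pi> where "\<pi> v = (fst (\<Psi> v), fst (snd (\<Psi> v)) - snd (snd (\<Psi> v)))" for v
  define \<beta> where "\<beta> v = snd (\<pi> v)" for v
  define U where "U = {x :: real \<times> real. snd x \<noteq> 0}"
  define F :: "real \<times> real \<Rightarrow> vec3" where
    "F x = (fst x, (snd x + (1 - fst x * fst x) * inverse (snd x)) / 2,
                   ((1 - fst x * fst x) * inverse (snd x) - snd x) / 2)" for x
  define \<phi> where "\<phi> x = \<Phi> (F x)" for x
  have lin: "linear \<pi>" "linear \<beta>"
    using linear_\<Psi> by (auto simp: \<pi>_def \<beta>_def linear_iff algebra_simps)
  have "open U"
    unfolding U_def by (intro open_Collect_neq continuous_intros)
  have F_S: "mink (F x) (F x) = 1" if "x \<in> U" for x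
    using that by (simp add: F_def U_def mink_def field_simps power2_eq_square)
  have \<pi>\<phi>: "\<pi> (\<phi> x) = x" for x
    by (simp add: \<pi>_def \<phi>_def F_def prod_eq_iff field_simps)
  have \<phi>\<pi>: "\<pi> q \<in> U \<and> \<phi> (\<pi> q) = q" if "q \<in> S" "\<beta> q \<noteq> 0" for q
  proof -
    obtain a y z where q: "\<Psi> q = (a, y, z)" by (metis surj_pair)
    have *: "a * a + y * y - z * z = 1" "y - z \<noteq> 0"
      using mink_\<Psi>[OF that(1)] that(2) q by (auto simp: mink_def \<beta>_def \<pi>_def)
    have "(1 - a * a) * inverse (y - z) = y + z"
      using * by (simp add: field_simps)
    then have "F (\<pi> q) = \<Psi> q" by (simp add: F_def \<pi>_def q)
    moreover have "\<pi> q \<in> U" using that by (simp add: U_def \<beta>_def)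
    ultimately show ?thesis by (simp add: \<phi>_def \<Phi>_\<Psi> that)
  qed
  have "smooth_map U F"
  proof (rule smooth_map_componentwise[OF \<open>open U\<close>])
    have sm: "smooth_on U fst" "smooth_on U snd" "smooth_on U (\<lambda>x. inverse (snd x))"
      by (intro smooth_on_linear smooth_on_inverse; auto simp: linear_iff U_def)+
    have r: "smooth_on U (\<lambda>x. (1 - fst x * fst x) * inverse (snd x))"
      by (intro smooth_on_mult smooth_on_diff smooth_on_const sm \<open>open U\<close>)
    have "smooth_on U (\<lambda>x. (1/2) * (snd x + (1 - fst x * fst x) * inverse (snd x)))"
      "smooth_on U (\<lambda>x. (1/2) * ((1 - fst x * fst x) * inverse (snd x) - snd x))"
      by (rule smooth_on_mult[OF \<open>open U\<close> smooth_on_const], rule smooth_on_add smooth_on_diff,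
          rule \<open>open U\<close>, fact r sm, fact r sm)+
    then show "smooth_on U (\<lambda>x. F x \<bullet> b)" if "b \<in> Basis" for b
      using that sm(1) by (auto simp: Basis_prod_def F_def)
  qed
  have "smooth_map U \<phi>"
    unfolding \<phi>_def by (rule smooth_map_linear_comp[OF \<open>smooth_map U F\<close> linear_\<Phi>])
  obtain g where g: "has_partials U F g"
    using smooth_map_partials[OF \<open>smooth_map U F\<close> \<open>open U\<close>] by blast
  have "inj (dirderiv \<phi> x)" if x: "x \<in> U" for x
  proof -
    define F' where "F' d = (\<Sum>i\<in>Basis. (d \<bullet> i) *\<^sub>R g i x)" for d
    have F': "(F has_derivative F') (at x)"
      using g x unfolding has_partials_def F'_def by blast
    have d: "dirderiv \<phi> x d = \<Phi> (F' d)" for d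
      by (rule dirderiv_eq[OF F' \<open>open U\<close> x]) (simp add: \<phi>_def)
    have bl: "bounded_linear (\<lambda>y. \<pi> (\<Phi> y))"
      using linear_compose[OF linear_\<Phi> lin(1)] by (simp add: linear_conv_bounded_linear o_def)
    have "((\<lambda>y. \<pi> (\<Phi> (F y))) has_derivative (\<lambda>d. \<pi> (\<Phi> (F' d)))) (at x)"
      by (rule bounded_linear.has_derivative[OF bl F'])
    then have "((\<lambda>y. y) has_derivative (\<lambda>d. \<pi> (\<Phi> (F' d)))) (at x)"
      using \<pi>\<phi> by (simp add: \<phi>_def)
    then have "(\<lambda>d. \<pi> (\<Phi> (F' d))) = (\<lambda>d. d)"
      by (rule has_derivative_unique) (rule has_derivative_ident)
    then have "\<pi> (dirderiv \<phi> x d) = d" for d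
      unfolding d by meson
    then show ?thesis by (rule inj_on_inverseI)
  qed
  moreover have "open_map (top_of_set U) (subtopology functional_topology S) \<phi>"
    unfolding open_map_def
  proof (intro allI impI)
    fix W assume "openin (top_of_set U) W"
    then have W: "open W" "W \<subseteq> U"
      using \<open>open U\<close> by (auto simp: openin_open_eq)
    have "\<phi> ` W = {v \<in> topspace functional_topology. \<pi> v \<in> W} \<inter> S"
    proof
      have "topspace functional_topology = (UNIV :: 'v set)"
        by (rule topspace_functional_topology)
      then show "\<phi> ` W \<subseteq> {v \<in> topspace functional_topology. \<pi> v \<in> W} \<inter> S"
        using W F_S by (auto simp: \<pi>\<phi>[unfolded \<phi>_def] S_eq \<phi>_def)
      show "{v \<in> topspace functional_topology. \<pi> v \<in> W} \<inter> S \<subseteq> \<phi> ` W"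
      proof
        fix v assume v: "v \<in> {v \<in> topspace functional_topology. \<pi> v \<in> W} \<inter> S"
        then have "\<beta> v \<noteq> 0" using W by (auto simp: \<beta>_def U_def)
        then have "v = \<phi> (\<pi> v)" using \<phi>\<pi> v by simp
        then show "v \<in> \<phi> ` W" using v by blast
      qed
    qed
    moreover have "openin functional_topology {v \<in> topspace functional_topology. \<pi> v \<in> W}"
      by (rule openin_continuous_map_preimage[OF functional_topology_linear_pair[OF lin(1)]])
        (use W in simp)
    ultimately show "openin (subtopology functional_topology S) (\<phi> ` W)"
      unfolding openin_subtopology by blast
  qed
  moreover have "inj_on \<phi> U" by (rule inj_on_inverseI) (rule \<pi>\<phi>)
  moreover have "\<phi> ` U \<subseteq> S" using F_S by (auto simp: S_eq \<phi>_def)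
  ultimately have "chart S U \<phi>"
    using \<open>open U\<close> \<open>smooth_map U \<phi>\<close> unfolding chart_def by blast
  moreover have "\<beta> p \<noteq> 0" using p by (simp add: \<beta>_def \<pi>_def)
  ultimately show ?thesis
    using lin \<phi>\<pi> by blast
qed

lemma change_of_frame:
  assumes T: "linear T" "linear T'" "\<And>x. T' (T x) = x" "\<And>x. T (T' x) = x"
    and iso: "\<And>x y. mink (T x) (T y) = mink x y"
  shows "pseudosphere (\<lambda>x. \<Phi> (T x)) (\<lambda>v. T' (\<Psi> v)) S h"
proof (intro pseudosphere.intro frame.intro pseudosphere_axioms.intro)
  show "linear (\<lambda>x. \<Phi> (T x))" "linear (\<lambda>v. T' (\<Psi> v))"
    using linear_compose[OF T(1) linear_\<Phi>] linear_compose[OF linear_\<Psi> T(2)]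
    by (simp_all only: o_def)
  show "T' (\<Psi> (\<Phi> (T x))) = x" for x
    by (simp add: T)
  show "S = (\<lambda>x. \<Phi> (T x)) ` {x. mink x x = 1}"
  proof
    show "S \<subseteq> (\<lambda>x. \<Phi> (T x)) ` {x. mink x x = 1}"
    proof
      fix p assume "p \<in> S"
      then have "p = \<Phi> (T (T' (\<Psi> p)))" "mink (T' (\<Psi> p)) (T' (\<Psi> p)) = 1"
        using mink_\<Psi>[of p] iso[of "T' (\<Psi> p)" "T' (\<Psi> p)"] by (simp_all add: T \<Phi>_\<Psi>)
      then show "p \<in> (\<lambda>x. \<Phi> (T x)) ` {x. mink x x = 1}" by blast
    qed
  qed (auto simp: S_eq iso)
  show "h p (\<Phi> (T x)) (\<Phi> (T y)) = mink x y" if "p \<in> S" for p x y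
    using that by (simp add: h_eq iso)
qed

text \<open>
  A point with \<open>y = z\<close> has \<open>x = \<plusminus>1\<close>, hence \<open>x \<noteq> z\<close> or \<open>x \<noteq> -z\<close>. Two linear isometries of Minkowski
  space carry these cases to \<open>ruled_chart\<close>.
\<close>

lemma chart_with_linear_inverse:
  assumes p: "p \<in> S"
  shows "\<exists>U \<phi> (\<pi> :: 'v \<Rightarrow> real \<times> real) (\<beta> :: 'v \<Rightarrow> real). linear \<pi> \<and> linear \<beta> \<and> \<beta> p \<noteq> 0 \<and> chart S U \<phi> \<and>
    (\<forall>q\<in>S. \<beta> q \<noteq> 0 \<longrightarrow> \<pi> q \<in> U \<and> \<phi> (\<pi> q) = q)"
proof -
  obtain x y z where q: "\<Psi> p = (x, y, z)" by (metis surj_pair)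
  have *: "x * x + y * y - z * z = 1"
    using mink_\<Psi>[OF p] by (simp add: mink_def q)
  consider "y \<noteq> z" | "x \<noteq> z" | "x \<noteq> - z"
    using * by fastforce
  then show ?thesis
  proof cases
    case 1
    then show ?thesis using ruled_chart[OF p] by (simp add: q)
  next
    case 2
    let ?T = "\<lambda>u::vec3. (fst (snd u), fst u, snd (snd u))"
    interpret T: pseudosphere "\<lambda>x. \<Phi> (?T x)" "\<lambda>v. ?T (\<Psi> v)" S h
      by (rule change_of_frame) (auto simp: linear_iff mink_def)
    show ?thesis using T.ruled_chart[OF p] 2 by (simp add: q)
  next
    case 3
    let ?T = "\<lambda>u::vec3. (fst (snd u), fst u, - snd (snd u))"
    interpret T: pseudosphere "\<lambda>x. \<Phi> (?T x)" "\<lambda>v. ?T (\<Psi> v)" S h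
      by (rule change_of_frame) (auto simp: linear_iff mink_def)
    show ?thesis using T.ruled_chart[OF p] 3 by (simp add: q)
  qed
qed

lemma smooth_surface: "smooth_surface S"
  unfolding smooth_surface_def
proof
  fix p assume p: "p \<in> S"
  obtain U \<phi> and \<pi> :: "'v \<Rightarrow> real \<times> real" and \<beta> :: "'v \<Rightarrow> real"
    where "\<beta> p \<noteq> 0" "chart S U \<phi>" "\<forall>q\<in>S. \<beta> q \<noteq> 0 \<longrightarrow> \<pi> q \<in> U \<and> \<phi> (\<pi> q) = q"
    using chart_with_linear_inverse[OF p] by auto
  with p show "\<exists>U \<phi>. chart S U \<phi> \<and> p \<in> \<phi> ` U"
    by (metis image_eqI)
qed

end

section \<open>The geodesic equation\<close>

lemma smooth_on_mink:
  assumes "open U" "smooth_map U F" "smooth_map U G"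
  shows "smooth_on U (\<lambda>x. mink (F x) (G x))"
proof -
  have comp: "smooth_on U (\<lambda>x. fst (H x))" "smooth_on U (\<lambda>x. fst (snd (H x)))" "smooth_on U (\<lambda>x. snd (snd (H x)))"
    if "smooth_map U H" for H :: "'a \<Rightarrow> vec3"
  proof -
    have "linear (fst :: vec3 \<Rightarrow> real)" "linear (\<lambda>v::vec3. fst (snd v))" "linear (\<lambda>v::vec3. snd (snd v))"
      by (simp_all add: linear_iff)
    with that show "smooth_on U (\<lambda>x. fst (H x))" "smooth_on U (\<lambda>x. fst (snd (H x)))" "smooth_on U (\<lambda>x. snd (snd (H x)))"
      unfolding smooth_map_def by blast+
  qed
  then show ?thesis
    unfolding mink_def by (intro smooth_on_diff smooth_on_add smooth_on_mult assms(1)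
        comp[OF assms(2)] comp[OF assms(3)])
qed

lemma smooth_map_isCont:
  fixes F :: "'a::euclidean_space \<Rightarrow> 'c::euclidean_space"
  assumes "smooth_map U F" "open U" "x \<in> U"
  shows "isCont F x"
proof -
  obtain g where "has_partials U F g"
    using smooth_map_partials[OF assms(1,2)] by blast
  with assms(3) show ?thesis
    unfolding has_partials_def by (blast intro: has_derivative_continuous)
qed

lemma mixed_partials_commute_vec:
  fixes F :: "'a::euclidean_space \<Rightarrow> 'c::euclidean_space"
  assumes F: "smooth_map U F" and U: "open U" "x \<in> U"
    and g: "has_partials U F g" and a: "\<And>i. i \<in> Basis \<Longrightarrow> has_partials U (g i) (a i)"
    and ik: "i \<in> Basis" "k \<in> Basis"
  shows "a i k x = a k i x"
proof (rule euclidean_eqI)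
  fix b :: 'c assume "b \<in> Basis"
  have comp: "has_partials U (\<lambda>x. H x \<bullet> b) (\<lambda>i x. H' i x \<bullet> b)"
    if "has_partials U H H'" for H :: "'a \<Rightarrow> 'c" and H'
    using that unfolding has_partials_def
    by (auto dest!: bspec has_derivative_inner_left[where b=b] simp: inner_sum_left)
  have sm: "smooth_map U (a j l)" if "j \<in> Basis" "l \<in> Basis" for j l
    by (rule smooth_map_partial[OF _ U(1) a that(2)])
      (use smooth_map_partial[OF F U(1) g that(1)] that in auto)
  have cont: "isCont (\<lambda>x. a j l x \<bullet> b) x" if "j \<in> Basis" "l \<in> Basis" for j l
    by (intro continuous_intros) (rule smooth_map_isCont[OF sm[OF that] U])
  show "a i k x \<bullet> b = a k i x \<bullet> b"
    by (rule mixed_partials_commute[OF U ik comp[OF g] comp[OF a[OF ik(1)]] comp[OF a[OF ik(2)]]])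
      (use cont ik in auto)
qed

context pseudosphere
begin

text \<open>
  The coordinate representation \<open>F\<close> of a chart with its first derivatives \<open>g\<close> (a basis of the tangent
  plane) and second derivatives \<open>a\<close>. Since the metric is the restriction of a fixed bilinear form, its
  coefficients are the products of the \<open>g i\<close>.
\<close>

lemma chart_calculus:
  assumes "chart S U \<phi>"
  obtains F g a where "\<And>x. F x = \<Psi> (\<phi> x)" "open U" "\<And>x. x \<in> U \<Longrightarrow> \<phi> x = \<Phi> (F x)"
    "has_partials U F g" "\<And>i. i \<in> Basis \<Longrightarrow> smooth_map U (g i)"
    "\<And>i. i \<in> Basis \<Longrightarrow> has_partials U (g i) (a i)"
    "\<And>x i k. x \<in> U \<Longrightarrow> i \<in> Basis \<Longrightarrow> k \<in> Basis \<Longrightarrow> a i k x = a k i x"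
    "\<And>x i j. x \<in> U \<Longrightarrow> i \<in> Basis \<Longrightarrow> j \<in> Basis \<Longrightarrow> metric_coeff h \<phi> i j x = mink (g i x) (g j x)"
    "\<And>x i. x \<in> U \<Longrightarrow> i \<in> Basis \<Longrightarrow> mink (g i x) (F x) = 0"
proof -
  have U: "open U" "\<phi> ` U \<subseteq> S" "smooth_map U \<phi>" using assms by (auto simp: chart_def)
  define F where "F x = \<Psi> (\<phi> x)" for x
  have \<phi>: "\<phi> x = \<Phi> (F x)" "mink (F x) (F x) = 1" if "x \<in> U" for x
    using U(2) that by (auto simp: F_def \<Phi>_\<Psi> mink_\<Psi> image_subset_iff)
  have F: "smooth_map U F"
    unfolding F_def by (rule smooth_map_linear_comp[OF U(3) linear_\<Psi>])
  obtain g where g: "\<And>i. i \<in> Basis \<Longrightarrow> smooth_map U (g i)" "has_partials U F g"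
    using smooth_map_partials[OF F U(1)] by blast
  have "\<forall>i\<in>Basis. \<exists>a. has_partials U (g i) a"
    using smooth_map_partials[OF g(1) U(1)] by metis
  then obtain a where a: "\<And>i. i \<in> Basis \<Longrightarrow> has_partials U (g i) (a i)"
    by metis
  have "mink (g i x) (F x) = 0" if x: "x \<in> U" and i: "i \<in> Basis" for x i
  proof -
    have F': "(F has_derivative (\<lambda>d. \<Sum>i\<in>Basis. (d \<bullet> i) *\<^sub>R g i x)) (at x)"
      using g(2) x by (simp add: has_partials_def)
    have "((\<lambda>x. mink (F x) (F x)) has_derivative
        (\<lambda>d. mink (F x) (\<Sum>i\<in>Basis. (d \<bullet> i) *\<^sub>R g i x) + mink (\<Sum>i\<in>Basis. (d \<bullet> i) *\<^sub>R g i x) (F x))) (at x)"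
      by (rule mink.FDERIV[OF F' F'])
    moreover have "((\<lambda>x. mink (F x) (F x)) has_derivative (\<lambda>d. 0)) (at x)"
      by (rule has_derivative_transform_within_open[OF has_derivative_const U(1) x])
        (simp add: \<phi>)
    ultimately have "(\<lambda>d. mink (F x) (\<Sum>i\<in>Basis. (d \<bullet> i) *\<^sub>R g i x) +
        mink (\<Sum>i\<in>Basis. (d \<bullet> i) *\<^sub>R g i x) (F x)) = (\<lambda>d. 0)"
      by (rule has_derivative_unique)
    from fun_cong[OF this, of i] show ?thesis
      using i mink_commute[of "F x"]
      by (simp add: inner_Basis if_distrib[of "\<lambda>c. c *\<^sub>R _"] sum.delta cong: if_cong)
  qed
  moreover have "metric_coeff h \<phi> i j x = mink (g i x) (g j x)"
    if "x \<in> U" "i \<in> Basis" "j \<in> Basis" for x i j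
  proof -
    have "\<phi> x \<in> S" using U(2) that(1) by blast
    then show ?thesis
      unfolding metric_coeff_def
      using dirderiv_partial[OF g(2) U(1) that(1) \<phi>(1)] that by (simp add: h_eq)
  qed
  moreover note mixed_partials_commute_vec[OF F U(1) _ g(2) a]
  ultimately show ?thesis
    using that[of F g a] F_def U(1) \<phi>(1) g a by blast
qed

lemma smooth_metric_coeff:
  assumes "chart S U \<phi>" "i \<in> Basis" "j \<in> Basis"
  shows "smooth_on U (metric_coeff h \<phi> i j)"
proof -
  obtain F g a where *: "open U" "\<And>i. i \<in> Basis \<Longrightarrow> smooth_map U (g i)"
    "\<And>x i j. x \<in> U \<Longrightarrow> i \<in> Basis \<Longrightarrow> j \<in> Basis \<Longrightarrow> metric_coeff h \<phi> i j x = mink (g i x) (g j x)"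
    using chart_calculus[OF assms(1)] by metis
  show ?thesis
    by (rule smooth_on_cong[OF _ smooth_on_mink[OF *(1) *(2)[OF assms(2)] *(2)[OF assms(3)]]])
      (simp add: * assms)
qed

text \<open>
  The Christoffel symbol \<open>\<Gamma>\<^bsub>k,ij\<^esub>\<close> of an induced metric is the product of \<open>\<partial>\<^sub>i \<partial>\<^sub>j F\<close> with
  \<open>\<partial>\<^sub>k F\<close>. By the chain rule the left-hand side of the geodesic equation is therefore the product of
  the acceleration with \<open>\<partial>\<^sub>k F\<close>, and \<open>mink_normal\<close> applies. The right-hand side of the equivalence
  no longer mentions the chart.
\<close>

lemma geodesic_equation_iff_normal:
  assumes chart: "chart S U \<phi>" and x: "smooth_curve U J x" and t: "t \<in> J"
    and \<gamma>1: "\<And>s. s \<in> J \<Longrightarrow> ((\<lambda>s. \<Psi> (\<phi> (x s))) has_vector_derivative \<gamma>1 s) (at s)"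
    and \<gamma>2: "(\<gamma>1 has_vector_derivative \<gamma>2) (at t)"
  shows "geodesic_equation h \<phi> x t \<longleftrightarrow> \<gamma>2 = mink \<gamma>2 (\<Psi> (\<phi> (x t))) *\<^sub>R \<Psi> (\<phi> (x t))"
proof -
  have J: "open J" "smooth_map J x" "\<And>s. s \<in> J \<Longrightarrow> x s \<in> U"
    using x by (auto simp: smooth_curve_def)
  obtain F g a where F: "\<And>x. F x = \<Psi> (\<phi> x)" "open U" "\<And>x. x \<in> U \<Longrightarrow> \<phi> x = \<Phi> (F x)"
    and g: "has_partials U F g" "\<And>i. i \<in> Basis \<Longrightarrow> smooth_map U (g i)"
    and a: "\<And>i. i \<in> Basis \<Longrightarrow> has_partials U (g i) (a i)"
    and sym: "\<And>x i k. x \<in> U \<Longrightarrow> i \<in> Basis \<Longrightarrow> k \<in> Basis \<Longrightarrow> a i k x = a k i x"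
    and metric: "\<And>x i j. x \<in> U \<Longrightarrow> i \<in> Basis \<Longrightarrow> j \<in> Basis \<Longrightarrow>
        metric_coeff h \<phi> i j x = mink (g i x) (g j x)"
    and tangent: "\<And>x i. x \<in> U \<Longrightarrow> i \<in> Basis \<Longrightarrow> mink (g i x) (F x) = 0"
    by (fact chart_calculus[OF chart])
  define y where "y = x t"
  have y: "y \<in> U" using J t by (simp add: y_def)
  have Dh: "frechet_derivative (metric_coeff h \<phi> i j) (at y) k =
      mink (g i y) (a j k y) + mink (a i k y) (g j y)"
    if ijk: "i \<in> Basis" "j \<in> Basis" "k \<in> Basis" for i j k
  proof -
    have D: "(g i has_derivative (\<lambda>d. \<Sum>k\<in>Basis. (d \<bullet> k) *\<^sub>R a i k y)) (at y)" if "i \<in> Basis" for i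
      using a[OF that] y by (simp add: has_partials_def)
    have "(metric_coeff h \<phi> i j has_derivative
        (\<lambda>d. mink (g i y) (\<Sum>k\<in>Basis. (d \<bullet> k) *\<^sub>R a j k y) +
             mink (\<Sum>k\<in>Basis. (d \<bullet> k) *\<^sub>R a i k y) (g j y))) (at y)"
      by (rule has_derivative_transform_within_open[OF mink.FDERIV[OF D[OF ijk(1)] D[OF ijk(2)]] F(2) y])
        (simp add: metric ijk)
    from frechet_derivative_at[OF this, symmetric] show ?thesis
      using ijk
      by (simp add: inner_Basis if_distrib[of "\<lambda>c. c *\<^sub>R _"] sum.delta cong: if_cong)
  qed
  have Gamma: "christoffel h \<phi> k i j y = mink (g k y) (a i j y)"
    if "k \<in> Basis" "i \<in> Basis" "j \<in> Basis" for k i j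
    unfolding christoffel_def
    using that sym[OF y, of i k] sym[OF y, of j k] sym[OF y, of i j]
    by (simp add: Dh mink_commute[of _ "g k y"] mink_commute[of _ "g i y"] mink_commute[of _ "g j y"])
  obtain x1' where x1': "\<And>i. i \<in> Basis \<Longrightarrow> smooth_map J (x1' i)" "has_partials J x x1'"
    using smooth_map_partials[OF J(2,1)] by blast
  define x1 where "x1 = x1' 1"
  have x1: "smooth_map J x1" "\<And>s. s \<in> J \<Longrightarrow> (x has_vector_derivative x1 s) (at s)"
    using x1' by (auto simp: x1_def has_partials_real)
  obtain x2' where x2': "has_partials J x1 x2'"
    using smooth_map_partials[OF x1(1) J(1)] by blast
  define x2 where "x2 = x2' 1 t"
  have x2: "(x1 has_vector_derivative x2) (at t)"
    using x2' t by (auto simp: x2_def has_partials_real)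
  have vd1: "vector_derivative x (at s) = x1 s" if "s \<in> J" for s
    by (rule vector_derivative_at[OF x1(2)[OF that]])
  have "((\<lambda>s. vector_derivative x (at s)) has_vector_derivative x2) (at t)"
    by (rule has_vector_derivative_transform_within_open[OF x2 J(1) t]) (simp add: vd1)
  then have vd2: "vector_derivative (\<lambda>s. vector_derivative x (at s)) (at t) = x2"
    by (rule vector_derivative_at)
  have chain: "((\<lambda>s. H (x s)) has_vector_derivative (\<Sum>k\<in>Basis. (x1 s \<bullet> k) *\<^sub>R H' k (x s))) (at s)"
    if "has_partials U H H'" "s \<in> J" for H :: "real \<times> real \<Rightarrow> vec3" and H' s
  proof -
    have H: "(H has_derivative (\<lambda>d. \<Sum>k\<in>Basis. (d \<bullet> k) *\<^sub>R H' k (x s))) (at (x s))"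
      using that J(3) by (simp add: has_partials_def)
    have "((\<lambda>s. H (x s)) has_derivative (\<lambda>h. \<Sum>k\<in>Basis. ((h *\<^sub>R x1 s) \<bullet> k) *\<^sub>R H' k (x s))) (at s)"
      by (rule has_derivative_compose[OF x1(2)[OF that(2), unfolded has_vector_derivative_def] H])
    then show ?thesis
      by (simp add: has_vector_derivative_def scaleR_sum_right)
  qed
  have \<gamma>1_eq: "\<gamma>1 s = (\<Sum>i\<in>Basis. (x1 s \<bullet> i) *\<^sub>R g i (x s))" if "s \<in> J" for s
    using vector_derivative_unique_at[OF \<gamma>1[OF that]] chain[OF g(1) that] by (simp add: F(1))
  have "((\<lambda>s. \<Sum>i\<in>Basis. (x1 s \<bullet> i) *\<^sub>R g i (x s)) has_vector_derivative
      (\<Sum>i\<in>Basis. (x1 t \<bullet> i) *\<^sub>R (\<Sum>k\<in>Basis. (x1 t \<bullet> k) *\<^sub>R a i k y) + (x2 \<bullet> i) *\<^sub>R g i y)) (at t)"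
  proof (rule has_vector_derivative_sum)
    fix i :: "real \<times> real" assume i: "i \<in> Basis"
    have "((\<lambda>s. x1 s \<bullet> i) has_vector_derivative (x2 \<bullet> i)) (at t)"
      by (rule bounded_linear.has_vector_derivative[OF bounded_linear_inner_left x2])
    then have "((\<lambda>s. x1 s \<bullet> i) has_field_derivative (x2 \<bullet> i)) (at t)"
      by (simp add: has_real_derivative_iff_has_vector_derivative)
    from has_vector_derivative_scaleR[OF this chain[OF a[OF i] t]]
    show "((\<lambda>s. (x1 s \<bullet> i) *\<^sub>R g i (x s)) has_vector_derivative
      (x1 t \<bullet> i) *\<^sub>R (\<Sum>k\<in>Basis. (x1 t \<bullet> k) *\<^sub>R a i k y) + (x2 \<bullet> i) *\<^sub>R g i y) (at t)"
      by (simp add: y_def)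
  qed
  then have "(\<gamma>1 has_vector_derivative
      (\<Sum>i\<in>Basis. (x1 t \<bullet> i) *\<^sub>R (\<Sum>k\<in>Basis. (x1 t \<bullet> k) *\<^sub>R a i k y) + (x2 \<bullet> i) *\<^sub>R g i y)) (at t)"
    by (rule has_vector_derivative_transform_within_open[OF _ J(1) t]) (simp add: \<gamma>1_eq)
  then have \<gamma>2_eq: "\<gamma>2 = (\<Sum>i\<in>Basis. (x1 t \<bullet> i) *\<^sub>R (\<Sum>k\<in>Basis. (x1 t \<bullet> k) *\<^sub>R a i k y) + (x2 \<bullet> i) *\<^sub>R g i y)"
    by (rule vector_derivative_unique_at[OF \<gamma>2])
  have "geodesic_equation h \<phi> x t \<longleftrightarrow> (\<forall>k\<in>Basis. mink (g k y) \<gamma>2 = 0)"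
  proof -
    have "(\<Sum>j\<in>Basis. metric_coeff h \<phi> k j y * (x2 \<bullet> j)) +
       (\<Sum>i\<in>Basis. \<Sum>j\<in>Basis. christoffel h \<phi> k i j y * (x1 t \<bullet> i) * (x1 t \<bullet> j)) = mink (g k y) \<gamma>2"
      if k: "k \<in> Basis" for k
      unfolding \<gamma>2_eq using k y
      by (simp add: metric Gamma mink.sum_right mink.add_right mink.scaleR_right sum.distrib
          sum_distrib_left algebra_simps)
    then show ?thesis
      unfolding geodesic_equation_def Let_def vd2 vd1[OF t] y_def[symmetric] by simp
  qed
  also have "\<dots> \<longleftrightarrow> \<gamma>2 = mink \<gamma>2 (F y) *\<^sub>R F y"
  proof
    assume normal: "\<forall>k\<in>Basis. mink (g k y) \<gamma>2 = 0"
    define L where "L d = (\<Sum>i\<in>Basis. (d \<bullet> i) *\<^sub>R g i y)" for d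
    have L: "(F has_derivative L) (at y)"
      using g(1) y unfolding has_partials_def L_def by blast
    have "dirderiv \<phi> y d = \<Phi> (L d)" for d
      by (rule dirderiv_eq[OF L F(2) y F(3)])
    moreover have "inj (dirderiv \<phi> y)" using chart y by (simp add: chart_def)
    ultimately have "inj L" unfolding inj_def by metis
    show "\<gamma>2 = mink \<gamma>2 (F y) *\<^sub>R F y"
    proof (rule mink_normal[OF has_derivative_linear[OF L] \<open>inj L\<close>])
      have "\<phi> y \<in> S" using chart y by (auto simp: chart_def)
      then show "mink (F y) (F y) = 1" by (simp add: F(1) mink_\<Psi>)
    qed (use normal tangent y in \<open>simp_all add: L_def mink.sum_left mink.sum_right
          mink.scaleR_left mink.scaleR_right mink_commute[of \<gamma>2]\<close>)
  next
    assume eq: "\<gamma>2 = mink \<gamma>2 (F y) *\<^sub>R F y"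
    have "mink (g k y) \<gamma>2 = 0" if "k \<in> Basis" for k
      by (subst eq) (simp add: mink.scaleR_right tangent y that)
    then show "\<forall>k\<in>Basis. mink (g k y) \<gamma>2 = 0" by blast
  qed
  finally show ?thesis by (simp add: F(1) y_def)
qed

lemma smooth_curve_velocity:
  assumes c: "smooth_curve S J c"
  obtains \<gamma>1 \<gamma>2 where "\<And>t. t \<in> J \<Longrightarrow> ((\<lambda>s. \<Psi> (c s)) has_vector_derivative \<gamma>1 t) (at t)"
    "\<And>t. t \<in> J \<Longrightarrow> (\<gamma>1 has_vector_derivative \<gamma>2 t) (at t)"
    "\<And>t. t \<in> J \<Longrightarrow> velocity c t = \<Phi> (\<gamma>1 t)"
    "\<And>t. t \<in> J \<Longrightarrow> mink (\<gamma>1 t) (\<Psi> (c t)) = 0"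
proof -
  have J: "open J" "smooth_map J c" "\<And>t. t \<in> J \<Longrightarrow> c t \<in> S"
    using c by (auto simp: smooth_curve_def)
  have "smooth_map J (\<lambda>s. \<Psi> (c s))"
    by (rule smooth_map_linear_comp[OF J(2) linear_\<Psi>])
  then obtain g where g: "\<And>i. i \<in> Basis \<Longrightarrow> smooth_map J (g i)" "has_partials J (\<lambda>s. \<Psi> (c s)) g"
    using smooth_map_partials J(1) by blast
  have d: "((\<lambda>s. \<Psi> (c s)) has_vector_derivative g 1 t) (at t)" if "t \<in> J" for t
    using g that by (simp add: has_partials_real)
  obtain a where a: "has_partials J (g 1) a"
    using smooth_map_partials[OF g(1) J(1)] by (metis Basis_real_def singletonI)
  show ?thesis
  proof
    fix t assume t: "t \<in> J"
    show "((\<lambda>s. \<Psi> (c s)) has_vector_derivative g 1 t) (at t)" by (rule d[OF t])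
    show "(g 1 has_vector_derivative a 1 t) (at t)"
      using a t by (simp add: has_partials_real)
    show "velocity c t = \<Phi> (g 1 t)"
      by (rule velocity_eq[OF d[OF t] J(1) t]) (simp add: \<Phi>_\<Psi> J(3))
    have "((\<lambda>s. mink (\<Psi> (c s)) (\<Psi> (c s))) has_vector_derivative
        mink (\<Psi> (c t)) (g 1 t) + mink (g 1 t) (\<Psi> (c t))) (at t)"
      by (rule mink.has_vector_derivative[OF d[OF t] d[OF t]])
    moreover have "((\<lambda>s. mink (\<Psi> (c s)) (\<Psi> (c s))) has_vector_derivative 0) (at t)"
      by (rule has_vector_derivative_transform_within_open[OF has_vector_derivative_const J(1) t])
        (simp add: mink_\<Psi> J(3))
    ultimately have "mink (\<Psi> (c t)) (g 1 t) + mink (g 1 t) (\<Psi> (c t)) = 0"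
      by (rule vector_derivative_unique_at)
    then show "mink (g 1 t) (\<Psi> (c t)) = 0"
      by (simp add: mink_commute[of "\<Psi> (c t)"])
  qed
qed

text \<open>
  The definition of a geodesic only asks for some chart around each point. The previous lemma makes
  the choice irrelevant, and the charts with linear inverse show that every smooth curve lifts.
\<close>

lemma geodesic_iff_acceleration_normal:
  assumes c: "smooth_curve S J c"
    and \<gamma>1: "\<And>t. t \<in> J \<Longrightarrow> ((\<lambda>s. \<Psi> (c s)) has_vector_derivative \<gamma>1 t) (at t)"
    and \<gamma>2: "\<And>t. t \<in> J \<Longrightarrow> (\<gamma>1 has_vector_derivative \<gamma>2 t) (at t)"
  shows "geodesic S h J c \<longleftrightarrow>
    (\<forall>t\<in>J. \<gamma>1 t \<noteq> 0 \<and> \<gamma>2 t = mink (\<gamma>2 t) (\<Psi> (c t)) *\<^sub>R \<Psi> (c t))"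
proof -
  have J: "open J" "smooth_map J c" "\<And>t. t \<in> J \<Longrightarrow> c t \<in> S"
    using c by (auto simp: smooth_curve_def)
  have vel: "velocity c t = \<Phi> (\<gamma>1 t)" if "t \<in> J" for t
    by (rule velocity_eq[OF \<gamma>1[OF that] J(1) that]) (simp add: \<Phi>_\<Psi> J(3))
  have vel0: "velocity c t \<noteq> 0 \<longleftrightarrow> \<gamma>1 t \<noteq> 0" if "t \<in> J" for t
    using \<Phi>_eq_iff[of "\<gamma>1 t" 0] by (simp add: vel[OF that] linear_0[OF linear_\<Phi>])
  have local: "geodesic_equation h \<phi> x s \<longleftrightarrow> \<gamma>2 s = mink (\<gamma>2 s) (\<Psi> (c s)) *\<^sub>R \<Psi> (c s)"
    if ch: "chart S U \<phi>" and x: "smooth_curve U J' x" and J': "J' \<subseteq> J"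
      and eq: "\<And>s. s \<in> J' \<Longrightarrow> \<phi> (x s) = c s" and s: "s \<in> J'" for U \<phi> J' x s
  proof -
    have "((\<lambda>s. \<Psi> (\<phi> (x s))) has_vector_derivative \<gamma>1 s) (at s)" if "s \<in> J'" for s
      by (rule has_vector_derivative_transform_within_open[OF \<gamma>1 _ that])
        (use that J' x eq in \<open>auto simp: smooth_curve_def\<close>)
    from geodesic_equation_iff_normal[OF ch x s this \<gamma>2] show ?thesis
      using J' s eq[OF s] by auto
  qed
  show ?thesis
  proof
    assume geo: "geodesic S h J c"
    show "\<forall>t\<in>J. \<gamma>1 t \<noteq> 0 \<and> \<gamma>2 t = mink (\<gamma>2 t) (\<Psi> (c t)) *\<^sub>R \<Psi> (c t)"
    proof
      fix t assume t: "t \<in> J"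
      then obtain U \<phi> J' x where "chart S U \<phi>" "t \<in> J'" "J' \<subseteq> J" "smooth_curve U J' x"
        "\<forall>s\<in>J'. \<phi> (x s) = c s \<and> geodesic_equation h \<phi> x s"
        using geo unfolding geodesic_def by blast
      with local[of U \<phi> J' x t] vel0[OF t] geo t
      show "\<gamma>1 t \<noteq> 0 \<and> \<gamma>2 t = mink (\<gamma>2 t) (\<Psi> (c t)) *\<^sub>R \<Psi> (c t)"
        by (auto simp: geodesic_def)
    qed
  next
    assume normal: "\<forall>t\<in>J. \<gamma>1 t \<noteq> 0 \<and> \<gamma>2 t = mink (\<gamma>2 t) (\<Psi> (c t)) *\<^sub>R \<Psi> (c t)"
    have "\<exists>U \<phi> J' x. chart S U \<phi> \<and> t \<in> J' \<and> J' \<subseteq> J \<and> smooth_curve U J' x \<and>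
        (\<forall>s\<in>J'. \<phi> (x s) = c s \<and> geodesic_equation h \<phi> x s)" if t: "t \<in> J" for t
    proof -
      obtain U \<phi> and \<pi> :: "'v \<Rightarrow> real \<times> real" and \<beta> :: "'v \<Rightarrow> real"
        where lin: "linear \<pi>" "linear \<beta>" and "\<beta> (c t) \<noteq> 0" and ch: "chart S U \<phi>"
          and inv: "\<And>q. q \<in> S \<Longrightarrow> \<beta> q \<noteq> 0 \<Longrightarrow> \<pi> q \<in> U \<and> \<phi> (\<pi> q) = q"
        using chart_with_linear_inverse[OF J(3)[OF t]] by blast
      have "smooth_map J (\<lambda>s. \<beta> (c s))"
        by (rule smooth_map_linear_comp[OF J(2) lin(2)])
      then have "continuous_on J (\<lambda>s. \<beta> (c s))"
        using smooth_map_isCont[OF _ J(1)] continuous_at_imp_continuous_on by blast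
      then have "open (J \<inter> (\<lambda>s. \<beta> (c s)) -` (- {0}))"
        by (rule continuous_open_preimage[OF _ J(1)]) auto
      moreover have "t \<in> J \<inter> (\<lambda>s. \<beta> (c s)) -` (- {0})"
        using t \<open>\<beta> (c t) \<noteq> 0\<close> by simp
      ultimately obtain e where e: "e > 0" "ball t e \<subseteq> J \<inter> (\<lambda>s. \<beta> (c s)) -` (- {0})"
        using open_contains_ball by blast
      have lift: "\<pi> (c s) \<in> U \<and> \<phi> (\<pi> (c s)) = c s" if "s \<in> ball t e" for s
        using inv[OF J(3)] that e by blast
      have x: "smooth_curve U (ball t e) (\<lambda>s. \<pi> (c s))"
        unfolding smooth_curve_def
      proof (intro conjI)
        show "smooth_map (ball t e) (\<lambda>s. \<pi> (c s))"
          by (rule smooth_map_linear_comp[OF smooth_map_subset[OF J(2)] lin(1)]) (use e in blast)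
      qed (use e lift in \<open>auto simp: is_interval_ball_real\<close>)
      have "ball t e \<subseteq> J" using e by blast
      with local[OF ch x this] lift normal
      have "\<forall>s\<in>ball t e. \<phi> (\<pi> (c s)) = c s \<and> geodesic_equation h \<phi> (\<lambda>s. \<pi> (c s)) s" by blast
      with ch x \<open>ball t e \<subseteq> J\<close> e(1) show ?thesis
        by (intro exI[of _ U] exI[of _ \<phi>] exI[of _ "ball t e"] exI[of _ "\<lambda>s. \<pi> (c s)"]) auto
    qed
    then show "geodesic S h J c"
      unfolding geodesic_def using c normal vel0 by auto
  qed
qed

end

section \<open>Explicit geodesics\<close>

text \<open>
  The fundamental solutions of \<open>f'' = -\<kappa> f\<close>, with initial values \<open>(1, 0)\<close> and \<open>(0, 1)\<close>; having all signs
  of \<open>\<kappa>\<close> in one function allows the three causal types to be treated together.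
\<close>

definition gcos :: "real \<Rightarrow> real \<Rightarrow> real" where
  "gcos \<kappa> t = (if \<kappa> > 0 then cos (sqrt \<kappa> * t) else if \<kappa> = 0 then 1 else cosh (sqrt (- \<kappa>) * t))"

definition gsin :: "real \<Rightarrow> real \<Rightarrow> real" where
  "gsin \<kappa> t = (if \<kappa> > 0 then sin (sqrt \<kappa> * t) / sqrt \<kappa> else if \<kappa> = 0 then t
     else sinh (sqrt (- \<kappa>) * t) / sqrt (- \<kappa>))"

lemma gcos_0 [simp]: "gcos \<kappa> 0 = 1" and gsin_0 [simp]: "gsin \<kappa> 0 = 0"
  by (simp_all add: gcos_def gsin_def)

lemma gcos_gsin_sq: "gcos \<kappa> t ^ 2 + \<kappa> * gsin \<kappa> t ^ 2 = 1"
  using cosh_square_eq[of "sqrt (- \<kappa>) * t"]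
  by (auto simp: gcos_def gsin_def power_divide)

lemma DERIV_gcos: "(gcos \<kappa> has_real_derivative - \<kappa> * gsin \<kappa> t) (at t)"
proof -
  consider "\<kappa> > 0" | "\<kappa> = 0" | "\<kappa> < 0" by linarith
  then show ?thesis
  proof cases
    case 1
    then have "gcos \<kappa> = (\<lambda>t. cos (sqrt \<kappa> * t))" by (auto simp: gcos_def)
    then show ?thesis
      using 1 by (auto intro!: derivative_eq_intros simp: gsin_def field_simps)
  next
    case 2
    then have "gcos \<kappa> = (\<lambda>t. 1)" by (auto simp: gcos_def)
    then show ?thesis using 2 by simp
  next
    case 3
    define r where "r = sqrt (- \<kappa>)"
    have r: "r > 0" "\<kappa> = - (r * r)" using 3 by (simp_all add: r_def)
    then have "gcos \<kappa> = (\<lambda>t. cosh (r * t))" "gsin \<kappa> = (\<lambda>t. sinh (r * t) / r)"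
      by (auto simp: gcos_def gsin_def)
    then show ?thesis
      using r by (auto intro!: derivative_eq_intros)
  qed
qed

lemma DERIV_gsin: "(gsin \<kappa> has_real_derivative gcos \<kappa> t) (at t)"
proof -
  consider "\<kappa> > 0" | "\<kappa> = 0" | "\<kappa> < 0" by linarith
  then show ?thesis
  proof cases
    case 1
    then have "gsin \<kappa> = (\<lambda>t. sin (sqrt \<kappa> * t) / sqrt \<kappa>)" by (auto simp: gsin_def)
    then show ?thesis
      using 1 by (auto intro!: derivative_eq_intros simp: gcos_def mult.assoc)
  next
    case 2
    then have "gsin \<kappa> = (\<lambda>t. t)" by (auto simp: gsin_def)
    then show ?thesis using 2 by (simp add: gcos_def)
  next
    case 3
    define r where "r = sqrt (- \<kappa>)"
    have r: "r > 0" "\<kappa> = - (r * r)" using 3 by (simp_all add: r_def)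
    then have "gcos \<kappa> = (\<lambda>t. cosh (r * t))" "gsin \<kappa> = (\<lambda>t. sinh (r * t) / r)"
      by (auto simp: gcos_def gsin_def)
    then show ?thesis
      using r by (auto intro!: derivative_eq_intros)
  qed
qed

lemma DERIV_gcos_shift:
  "((\<lambda>t. gcos \<kappa> (t - t\<^sub>0)) has_real_derivative - \<kappa> * gsin \<kappa> (t - t\<^sub>0)) (at t)"
  and DERIV_gsin_shift:
  "((\<lambda>t. gsin \<kappa> (t - t\<^sub>0)) has_real_derivative gcos \<kappa> (t - t\<^sub>0)) (at t)"
proof -
  have "((\<lambda>t. t - t\<^sub>0) has_real_derivative 1) (at t)"
    by (auto intro!: derivative_eq_intros)
  from DERIV_chain2[OF DERIV_gcos this] DERIV_chain2[OF DERIV_gsin this]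
  show "((\<lambda>t. gcos \<kappa> (t - t\<^sub>0)) has_real_derivative - \<kappa> * gsin \<kappa> (t - t\<^sub>0)) (at t)"
    "((\<lambda>t. gsin \<kappa> (t - t\<^sub>0)) has_real_derivative gcos \<kappa> (t - t\<^sub>0)) (at t)"
    by simp_all
qed

lemma gcos_scale: "gcos (a * a * \<kappa>) t = gcos \<kappa> (a * t)"
  and gsin_scale: "a * gsin (a * a * \<kappa>) t = gsin \<kappa> (a * t)"
proof -
  have root: "sqrt (a * a * k) = \<bar>a\<bar> * sqrt k" for k
    by (simp add: real_sqrt_mult)
  have "gcos (a * a * \<kappa>) t = gcos \<kappa> (a * t) \<and> a * gsin (a * a * \<kappa>) t = gsin \<kappa> (a * t)"
  proof (cases "a = 0 \<or> \<kappa> = 0")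
    case True
    then show ?thesis by (auto simp: gcos_def gsin_def)
  next
    case False
    then have "a * a > 0" by (simp add: zero_less_mult_iff) linarith
    have sgn: "a < 0 \<or> a > 0" using False by linarith
    show ?thesis
    proof (cases "\<kappa> > 0")
      case True
      then have "a * a * \<kappa> > 0" using \<open>a * a > 0\<close> by simp
      then have "gcos (a * a * \<kappa>) t = cos (\<bar>a\<bar> * sqrt \<kappa> * t)"
        "gsin (a * a * \<kappa>) t = sin (\<bar>a\<bar> * sqrt \<kappa> * t) / (\<bar>a\<bar> * sqrt \<kappa>)"
        unfolding gcos_def gsin_def root by simp_all
      moreover have "gcos \<kappa> (a * t) = cos (a * sqrt \<kappa> * t)"
        "gsin \<kappa> (a * t) = sin (a * sqrt \<kappa> * t) / sqrt \<kappa>"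
        using True by (simp_all add: gcos_def gsin_def mult.left_commute mult.assoc)
      ultimately show ?thesis using sgn by auto
    next
      case neg: False
      then have "\<kappa> < 0" using False by linarith
      then have "a * a * \<kappa> < 0" using \<open>a * a > 0\<close> by (rule mult_pos_neg[rotated])
      then have neg: "\<not> a * a * \<kappa> > 0" "a * a * \<kappa> \<noteq> 0" by linarith+
      have "sqrt (- (a * a * \<kappa>)) = \<bar>a\<bar> * sqrt (- \<kappa>)"
        using root[of "- \<kappa>"] by simp
      then have "gcos (a * a * \<kappa>) t = cosh (\<bar>a\<bar> * sqrt (- \<kappa>) * t)"
        "gsin (a * a * \<kappa>) t = sinh (\<bar>a\<bar> * sqrt (- \<kappa>) * t) / (\<bar>a\<bar> * sqrt (- \<kappa>))"
        unfolding gcos_def gsin_def if_not_P[OF neg(1)] if_not_P[OF neg(2)] by (rule arg_cong)+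
      moreover have "gcos \<kappa> (a * t) = cosh (a * sqrt (- \<kappa>) * t)"
        "gsin \<kappa> (a * t) = sinh (a * sqrt (- \<kappa>) * t) / sqrt (- \<kappa>)"
        using \<open>\<kappa> < 0\<close> by (simp_all add: gcos_def gsin_def mult.left_commute mult.assoc)
      ultimately show ?thesis using sgn by auto
    qed
  qed
  then show "gcos (a * a * \<kappa>) t = gcos \<kappa> (a * t)"
    "a * gsin (a * a * \<kappa>) t = gsin \<kappa> (a * t)" by blast+
qed

lemma gcos_ge_1: "\<kappa> \<le> 0 \<Longrightarrow> gcos \<kappa> t \<ge> 1"
  by (auto simp: gcos_def cosh_real_ge_1)

lemma gcos_ge_minus_1: "gcos \<kappa> t \<ge> - 1"
  using gcos_ge_1[of \<kappa> t] by (cases "\<kappa> > 0") (auto simp: gcos_def)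

lemma gcos_le_1: "\<kappa> \<ge> 0 \<Longrightarrow> gcos \<kappa> t \<le> 1"
  by (auto simp: gcos_def)

text \<open>
  The time at which the geodesic from \<open>p\<close> with initial velocity \<open>q - \<tau> p\<close>, where
  \<open>\<tau> = mink p q\<close>, arrives at \<open>q\<close>. For \<open>\<tau> < -1\<close> there is none, since \<open>gcos\<close> is bounded below by \<open>-1\<close>.
\<close>

lemma ex_gcos_gsin:
  assumes "\<tau> > - 1"
  shows "\<exists>t. gcos (1 - \<tau>\<^sup>2) t = \<tau> \<and> gsin (1 - \<tau>\<^sup>2) t = 1"
proof -
  consider "\<tau> > 1" | "\<tau> = 1" | "\<tau> < 1" by linarith
  then show ?thesis
  proof cases
    case 1
    then have pos: "\<tau>\<^sup>2 - 1 > 0" by (simp add: one_less_power)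
    let ?t = "arcosh \<tau> / sqrt (\<tau>\<^sup>2 - 1)"
    have "gcos (1 - \<tau>\<^sup>2) ?t = cosh (arcosh \<tau>)" "gsin (1 - \<tau>\<^sup>2) ?t = sinh (arcosh \<tau>) / sqrt (\<tau>\<^sup>2 - 1)"
      using pos by (auto simp: gcos_def gsin_def)
    then show ?thesis
      using 1 pos by (intro exI[of _ ?t]) (simp add: cosh_arcosh_real sinh_arcosh_real)
  next
    case 2
    then show ?thesis by (auto simp: gcos_def gsin_def)
  next
    case 3
    then have pos: "1 - \<tau>\<^sup>2 > 0" using assms by (simp add: power2_less_1_iff abs_less_iff abs_square_less_1)
    let ?t = "arccos \<tau> / sqrt (1 - \<tau>\<^sup>2)"
    have "gcos (1 - \<tau>\<^sup>2) ?t = cos (arccos \<tau>)" "gsin (1 - \<tau>\<^sup>2) ?t = sin (arccos \<tau>) / sqrt (1 - \<tau>\<^sup>2)"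
      using pos by (auto simp: gcos_def gsin_def)
    then show ?thesis
      using 3 pos assms by (intro exI[of _ ?t]) (simp add: sin_arccos)
  qed
qed

definition geod :: "vec3 \<Rightarrow> vec3 \<Rightarrow> real \<Rightarrow> vec3" where
  "geod p v t = gcos (mink v v) t *\<^sub>R p + gsin (mink v v) t *\<^sub>R v"

lemma geod_0 [simp]: "geod p v 0 = p"
  by (simp add: geod_def)

lemma geod_deriv:
  "((\<lambda>t. geod p v (t - t\<^sub>0)) has_vector_derivative
    (- mink v v * gsin (mink v v) (t - t\<^sub>0)) *\<^sub>R p + gcos (mink v v) (t - t\<^sub>0) *\<^sub>R v) (at t)"
  unfolding geod_def
  by (auto intro!: derivative_eq_intros DERIV_gcos_shift DERIV_gsin_shift)

lemma geod_deriv2: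
  "((\<lambda>t. (- mink v v * gsin (mink v v) (t - t\<^sub>0)) *\<^sub>R p + gcos (mink v v) (t - t\<^sub>0) *\<^sub>R v)
    has_vector_derivative - mink v v *\<^sub>R geod p v (t - t\<^sub>0)) (at t)"
  unfolding geod_def
  by (auto intro!: derivative_eq_intros DERIV_gcos_shift DERIV_gsin_shift simp: scaleR_add_right)

lemma smooth_geod: "smooth_map UNIV (\<lambda>t. geod p v (t - t\<^sub>0))"
proof -
  let ?C = "\<lambda>t. gcos (mink v v) (t - t\<^sub>0)" and ?S = "\<lambda>t. gsin (mink v v) (t - t\<^sub>0)"
  let ?P = "\<lambda>f. f = ?C \<or> f = ?S"
  note C = DERIV_gcos_shift[of "mink v v" t\<^sub>0] and S = DERIV_gsin_shift[of "mink v v" t\<^sub>0]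
  have step: "\<exists>g. (\<forall>i\<in>Basis. poly_in ?P (g i)) \<and> has_partials UNIV f g" if "?P f" for f
    using that
  proof
    assume f: "f = ?C"
    show ?thesis
    proof (intro exI[of _ "\<lambda>_ t. - mink v v * ?S t"] conjI ballI)
      show "poly_in ?P (\<lambda>t. - mink v v * ?S t)"
        by (rule poly_in.mult[OF poly_in.const poly_in.base]) simp
    qed (use C in \<open>simp add: f has_partials_real has_real_derivative_iff_has_vector_derivative\<close>)
  next
    assume f: "f = ?S"
    show ?thesis
    proof (intro exI[of _ "\<lambda>_. ?C"] conjI ballI)
      show "poly_in ?P ?C"
        by (rule poly_in.base) simp
    qed (use S in \<open>simp add: f has_partials_real has_real_derivative_iff_has_vector_derivative\<close>)
  qed
  have "smooth_on UNIV ?C" "smooth_on UNIV ?S"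
    by (rule smooth_on_coinduct[of ?P, OF step]; simp add: poly_in.base)+
  then show ?thesis
    by (intro smooth_map_componentwise)
      (auto simp: geod_def inner_add_left intro!: smooth_on_add smooth_on_mult)
qed

lemma mink_geod:
  assumes "mink p p = 1" "mink p v = 0"
  shows "mink (geod p v t) (geod p v t) = 1" "mink p (geod p v t) = gcos (mink v v) t"
  using assms gcos_gsin_sq[of "mink v v" t] mink_commute[of v p]
  by (simp_all add: geod_def mink.add_left mink.add_right mink.scaleR_left mink.scaleR_right
      power2_eq_square mult_ac)

text \<open>
  Rescaling the initial velocity rescales time, so the trace only depends on its direction.
\<close>

lemma geod_scale: "geod p (a *\<^sub>R v) t = geod p v (a * t)"
proof -
  have "mink (a *\<^sub>R v) (a *\<^sub>R v) = a * a * mink v v"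
    by (simp add: mink.scaleR_left mink.scaleR_right)
  moreover have "s *\<^sub>R a *\<^sub>R v = (a * s) *\<^sub>R v" for s
    by (simp add: mult.commute)
  ultimately show ?thesis
    by (simp only: geod_def gcos_scale gsin_scale)
qed

lemma range_geod_scale:
  assumes "a \<noteq> 0"
  shows "range (geod p (a *\<^sub>R v)) = range (geod p v)"
proof -
  have "geod p v t \<in> range (geod p (a *\<^sub>R v))" for t
    using geod_scale[of p a v "t / a"] assms by (metis nonzero_mult_div_cancel_left rangeI times_divide_eq_right)
  moreover have "geod p (a *\<^sub>R v) t \<in> range (geod p v)" for t
    unfolding geod_scale by (rule rangeI)
  ultimately show ?thesis by blast
qed

lemma range_shift: "range (\<lambda>t. f (t - t\<^sub>0)) = range (f :: real \<Rightarrow> _)"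
  by (auto simp: image_iff) (metis add_diff_cancel)

context pseudosphere
begin

lemma geodesic_geod:
  assumes p: "mink p p = 1" "mink p v = 0" "v \<noteq> 0"
    and J: "open J" "is_interval J" "J \<noteq> {}"
  shows "geodesic S h J (\<lambda>t. \<Phi> (geod p v (t - t\<^sub>0)))"
proof -
  let ?c = "\<lambda>t. \<Phi> (geod p v (t - t\<^sub>0))"
  let ?\<kappa> = "mink v v"
  have "smooth_map J ?c"
    by (rule smooth_map_linear_comp[OF smooth_map_subset[OF smooth_geod] linear_\<Phi>]) simp
  then have c: "smooth_curve S J ?c"
    using J p by (auto simp: smooth_curve_def S_eq mink_geod)
  have d: "((\<lambda>s. \<Psi> (?c s)) has_vector_derivative
      (- ?\<kappa> * gsin ?\<kappa> (t - t\<^sub>0)) *\<^sub>R p + gcos ?\<kappa> (t - t\<^sub>0) *\<^sub>R v) (at t)" for t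
    using geod_deriv by simp
  \<comment> \<open>Since \<open>p\<close> and \<open>v\<close> are orthogonal, a vanishing velocity would make both coefficients vanish,
    contrary to \<open>gcos_gsin_sq\<close>.\<close>
  have "(- ?\<kappa> * gsin ?\<kappa> s) *\<^sub>R p + gcos ?\<kappa> s *\<^sub>R v \<noteq> 0" for s
  proof
    assume *: "(- ?\<kappa> * gsin ?\<kappa> s) *\<^sub>R p + gcos ?\<kappa> s *\<^sub>R v = 0"
    from arg_cong[OF this, of "mink p"] have "?\<kappa> * gsin ?\<kappa> s = 0"
      by (simp add: mink.add_right mink.diff_right mink.scaleR_right p mink.zero_right)
    then have "gcos ?\<kappa> s = 0" "?\<kappa> * gsin ?\<kappa> s ^ 2 = 0"
      using * p by (auto simp: power2_eq_square)
    then show False using gcos_gsin_sq[of ?\<kappa> s] by (metis add_0 power_zero_numeral zero_neq_one)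
  qed
  moreover have "- ?\<kappa> *\<^sub>R geod p v s = mink (- ?\<kappa> *\<^sub>R geod p v s) (geod p v s) *\<^sub>R geod p v s" for s
    by (simp only: mink.scaleR_left mink_geod(1)[OF p(1,2)] real_scaleR_def mult_1_right)
  ultimately show ?thesis
    unfolding geodesic_iff_acceleration_normal[OF c d geod_deriv2] by simp
qed

text \<open>
  Differentiating \<open>mink \<gamma> \<gamma> = 1\<close> gives one inclusion; for the other, every vector orthogonal to the
  position vector is the initial velocity of one of the explicit curves.
\<close>

lemma tangent_space_eq:
  assumes p: "p \<in> S"
  shows "tangent_space S p = \<Phi> ` {v. mink v (\<Psi> p) = 0}"
proof
  show "tangent_space S p \<subseteq> \<Phi> ` {v. mink v (\<Psi> p) = 0}"
  proof
    fix w assume "w \<in> tangent_space S p"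
    then obtain c J where c: "smooth_curve S J c" "0 \<in> J" "c 0 = p" and w: "w = velocity c 0"
      by (auto simp: tangent_space_def)
    obtain \<gamma>1 \<gamma>2 where "\<And>t. t \<in> J \<Longrightarrow> ((\<lambda>s. \<Psi> (c s)) has_vector_derivative \<gamma>1 t) (at t)"
      "\<And>t. t \<in> J \<Longrightarrow> (\<gamma>1 has_vector_derivative \<gamma>2 t) (at t)"
      and vel: "\<And>t. t \<in> J \<Longrightarrow> velocity c t = \<Phi> (\<gamma>1 t)"
      and tangent: "\<And>t. t \<in> J \<Longrightarrow> mink (\<gamma>1 t) (\<Psi> (c t)) = 0"
      by (fact smooth_curve_velocity[OF c(1)])
    show "w \<in> \<Phi> ` {v. mink v (\<Psi> p) = 0}"
      using vel[OF c(2)] tangent[OF c(2)] by (simp add: w c(3))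
  qed
  show "\<Phi> ` {v. mink v (\<Psi> p) = 0} \<subseteq> tangent_space S p"
  proof
    fix w assume "w \<in> \<Phi> ` {v. mink v (\<Psi> p) = 0}"
    then obtain v where v: "w = \<Phi> v" "mink (\<Psi> p) v = 0" by (auto simp: mink_commute)
    let ?c = "\<lambda>t. \<Phi> (geod (\<Psi> p) v (t - 0))"
    have "smooth_curve S UNIV ?c"
      using smooth_map_linear_comp[OF smooth_geod[of "\<Psi> p" v 0] linear_\<Phi>] mink_geod(1)[OF mink_\<Psi>[OF p] v(2)]
      by (auto simp: smooth_curve_def S_eq)
    moreover have "velocity ?c 0 = w"
      using velocity_eq[OF geod_deriv open_UNIV UNIV_I, of ?c "\<Psi> p" v 0 0] by (simp add: v(1))
    ultimately show "w \<in> tangent_space S p"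
      unfolding tangent_space_def using \<Phi>_\<Psi>[OF p]
      by (intro CollectI exI[of _ ?c] conjI exI[of _ UNIV]) simp_all
  qed
qed

text \<open>
  At \<open>(x, y, z)\<close> the unit vector \<open>e\<close> along the horizontal circle is spacelike and the unit vector \<open>f\<close> along
  the meridian is timelike; \<open>r\<close> is the radius of the circle, with \<open>r\<^sup>2 = 1 + z\<^sup>2\<close>.
\<close>

lemma lorentzian_tangent_space:
  assumes p: "p \<in> S"
  shows "lorentzian_on (tangent_space S p) (h p)"
proof -
  obtain x y z where q: "\<Psi> p = (x, y, z)" by (metis surj_pair)
  have Q: "x * x + y * y - z * z = 1"
    using mink_\<Psi>[OF p] by (simp add: mink_def q)
  define r where "r = sqrt (x * x + y * y)"
  have r2: "r * r = x * x + y * y" by (simp add: r_def)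
  have "x * x + y * y > 0" using Q zero_le_square[of z] by linarith
  then have r: "r \<noteq> 0" unfolding r_def using real_sqrt_gt_zero by fastforce
  define e f :: vec3 where "e = (- y / r, x / r, 0)" and "f = (x * z / r, y * z / r, r)"
  have e: "mink e e = 1" and f: "mink f f = - 1" and ef: "mink e f = 0"
    and ep: "mink e (\<Psi> p) = 0" and fp: "mink f (\<Psi> p) = 0"
  proof -
    have "mink e e = (x * x + y * y) / (r * r)"
      by (simp add: mink_def e_def add_divide_distrib)
    then show "mink e e = 1" using r by (simp add: r2[symmetric])
    have "mink f f = (x * x + y * y) / (r * r) * (z * z) - r * r"
      by (simp add: mink_def f_def add_divide_distrib algebra_simps)
    then show "mink f f = - 1" using r Q by (simp add: r2[symmetric])
    show "mink e f = 0" by (simp add: mink_def e_def f_def)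
    show "mink e (\<Psi> p) = 0" by (simp add: mink_def e_def q)
    have "mink f (\<Psi> p) = (x * x + y * y) / r * z - r * z"
      by (simp add: mink_def f_def q add_divide_distrib algebra_simps)
    then show "mink f (\<Psi> p) = 0" using r by (simp add: r2[symmetric])
  qed
  have decomp: "v = mink v e *\<^sub>R e - mink v f *\<^sub>R f" if "mink v (\<Psi> p) = 0" for v
  proof -
    obtain a b c where v: "v = (a, b, c)" by (metis surj_pair)
    have t: "a * x + b * y = c * z" using that by (simp add: v q mink_def)
    have ve: "mink v e = (b * x - a * y) / r"
      by (simp add: mink_def v e_def diff_divide_distrib)
    have "mink v f = (a * x + b * y) * z / r - c * r"
      by (simp add: mink_def v f_def add_divide_distrib algebra_simps)
    also have "\<dots> = c * (z * z - r * r) / r"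
      using r by (simp add: t field_simps)
    also have "z * z - r * r = - 1" using Q by (simp add: r2)
    finally have vf: "mink v f = - c / r" by simp
    have "(b * x - a * y) / r * (- y / r) + c / r * (x * z / r) = (a * (y * y) - b * x * y + x * (c * z)) / (r * r)"
      by (simp add: add_divide_distrib diff_divide_distrib algebra_simps)
    also have "\<dots> = a * (x * x + y * y) / (r * r)"
      by (simp add: t[symmetric] algebra_simps)
    finally have 1: "(b * x - a * y) / r * (- y / r) + c / r * (x * z / r) = a"
      using r by (simp add: r2[symmetric])
    have "(b * x - a * y) / r * (x / r) + c / r * (y * z / r) = (b * (x * x) - a * x * y + y * (c * z)) / (r * r)"
      by (simp add: add_divide_distrib diff_divide_distrib algebra_simps)
    also have "\<dots> = b * (x * x + y * y) / (r * r)"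
      by (simp add: t[symmetric] algebra_simps)
    finally have 2: "(b * x - a * y) / r * (x / r) + c / r * (y * z / r) = b"
      using r by (simp add: r2[symmetric])
    show ?thesis
      unfolding ve vf using 1 2 r by (simp add: v e_def f_def)
  qed
  have span_ef: "tangent_space S p = span {\<Phi> e, \<Phi> f}"
  proof -
    have "span {\<Phi> e, \<Phi> f} = \<Phi> ` span {e, f}"
      using linear_span_image[OF linear_\<Phi>, of "{e, f}"] by simp
    also have "span {e, f} = {v. mink v (\<Psi> p) = 0}"
    proof
      have "subspace {v. mink v (\<Psi> p) = 0}"
        by (auto simp: subspace_def mink.zero_left mink.add_left mink.scaleR_left)
      then show "span {e, f} \<subseteq> {v. mink v (\<Psi> p) = 0}"
        by (rule span_minimal[rotated]) (simp add: ep fp)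
      show "{v. mink v (\<Psi> p) = 0} \<subseteq> span {e, f}"
      proof
        fix v assume "v \<in> {v. mink v (\<Psi> p) = 0}"
        then have "v = mink v e *\<^sub>R e - mink v f *\<^sub>R f" using decomp by simp
        moreover have "mink v e *\<^sub>R e - mink v f *\<^sub>R f \<in> span {e, f}"
          by (intro span_diff span_scale span_base) simp_all
        ultimately show "v \<in> span {e, f}" by simp
      qed
    qed
    finally show ?thesis by (simp add: tangent_space_eq[OF p])
  qed
  have lin: "h p (a *\<^sub>R \<Phi> u + b *\<^sub>R \<Phi> v) (\<Phi> w) = a * h p (\<Phi> u) (\<Phi> w) + b * h p (\<Phi> v) (\<Phi> w)" for a b u v w
  proof -
    have "a *\<^sub>R \<Phi> u + b *\<^sub>R \<Phi> v = \<Phi> (a *\<^sub>R u + b *\<^sub>R v)"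
      by (simp add: linear_add[OF linear_\<Phi>] linear_scale[OF linear_\<Phi>])
    then show ?thesis
      by (simp add: h_eq[OF p] mink.add_left mink.scaleR_left)
  qed
  show ?thesis
    unfolding lorentzian_on_def
  proof (intro conjI)
    show "\<forall>u\<in>tangent_space S p. \<forall>v\<in>tangent_space S p. h p u v = h p v u"
      unfolding tangent_space_eq[OF p] by (auto simp: h_eq[OF p] intro: mink_commute)
    show "\<forall>u\<in>tangent_space S p. \<forall>v\<in>tangent_space S p. \<forall>w\<in>tangent_space S p. \<forall>a b.
        h p (a *\<^sub>R u + b *\<^sub>R v) w = a * h p u w + b * h p v w"
      unfolding tangent_space_eq[OF p] by (auto simp: lin h_eq[OF p])
    show "\<exists>e f. tangent_space S p = span {e, f} \<and> h p e e = 1 \<and> h p f f = - 1 \<and> h p e f = 0"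
      by (rule exI[of _ "\<Phi> e"], rule exI[of _ "\<Phi> f"]) (simp add: span_ef h_eq[OF p] e f ef)
  qed
qed

lemma lorentzian_surface: "lorentzian_surface S h"
  unfolding lorentzian_surface_def
  using smooth_surface lorentzian_tangent_space smooth_metric_coeff by blast

text \<open>
  Tangency and normality of the acceleration give \<open>\<gamma>'' = -\<kappa> \<gamma>\<close> with \<open>\<kappa>\<close> constant. The Wronskians of \<open>\<gamma>\<close>
  with \<open>gsin\<close> and \<open>gcos\<close> are then constant, and solving these two linear equations for \<open>\<gamma>\<close> yields the
  explicit form.
\<close>

lemma geodesic_eq_geod:
  assumes geo: "geodesic S h J c" and t0: "t\<^sub>0 \<in> J"
  obtains v where "v \<noteq> 0" "mink (\<Psi> (c t\<^sub>0)) v = 0"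
    "\<And>t. t \<in> J \<Longrightarrow> c t = \<Phi> (geod (\<Psi> (c t\<^sub>0)) v (t - t\<^sub>0))"
    "\<And>t. t \<in> J \<Longrightarrow> h (c t) (velocity c t) (velocity c t) = mink v v"
proof -
  have c: "smooth_curve S J c" using geo by (simp add: geodesic_def)
  then have J: "open J" "convex J" "\<And>t. t \<in> J \<Longrightarrow> c t \<in> S"
    by (auto simp: smooth_curve_def is_interval_convex)
  define \<gamma> where "\<gamma> t = \<Psi> (c t)" for t
  obtain \<gamma>1 \<gamma>2 where
    d: "\<And>t. t \<in> J \<Longrightarrow> ((\<lambda>s. \<Psi> (c s)) has_vector_derivative \<gamma>1 t) (at t)"
      "\<And>t. t \<in> J \<Longrightarrow> (\<gamma>1 has_vector_derivative \<gamma>2 t) (at t)"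
    and vel: "\<And>t. t \<in> J \<Longrightarrow> velocity c t = \<Phi> (\<gamma>1 t)"
    and tangent: "\<And>t. t \<in> J \<Longrightarrow> mink (\<gamma>1 t) (\<Psi> (c t)) = 0"
    by (fact smooth_curve_velocity[OF c])
  have normal: "\<gamma>1 t \<noteq> 0" "\<gamma>2 t = mink (\<gamma>2 t) (\<gamma> t) *\<^sub>R \<gamma> t" if "t \<in> J" for t
    using iffD1[OF geodesic_iff_acceleration_normal[OF c d] geo] that unfolding \<gamma>_def by blast+
  note d = d[folded \<gamma>_def]
  note tangent = tangent[folded \<gamma>_def]
  have const: "f t = f t\<^sub>0" if f: "\<And>t. t \<in> J \<Longrightarrow> (f has_vector_derivative 0) (at t)" and t: "t \<in> J"
    for f :: "real \<Rightarrow> 'w::real_normed_vector" and t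
  proof -
    have "(f has_vector_derivative 0) (at x within J)" if "x \<in> J" for x
      by (rule has_vector_derivative_at_within) (rule f[OF that])
    then show ?thesis
      by (rule has_vector_derivative_zero_constant[OF J(2)]) (use t0 t in auto)
  qed
  define \<kappa> where "\<kappa> = mink (\<gamma>1 t\<^sub>0) (\<gamma>1 t\<^sub>0)"
  have \<kappa>: "mink (\<gamma>1 t) (\<gamma>1 t) = \<kappa>" if "t \<in> J" for t
    unfolding \<kappa>_def
  proof (rule const[OF _ that])
    fix t assume t: "t \<in> J"
    have "((\<lambda>s. mink (\<gamma>1 s) (\<gamma>1 s)) has_vector_derivative
        mink (\<gamma>1 t) (\<gamma>2 t) + mink (\<gamma>2 t) (\<gamma>1 t)) (at t)"
      by (rule mink.has_vector_derivative[OF d(2) d(2)]) (rule t)+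
    moreover have "mink (\<gamma>2 t) (\<gamma>1 t) = 0"
      using tangent[OF t] mink_commute[of "\<gamma> t"]
      by (subst normal(2)[OF t]) (simp add: mink.scaleR_left)
    ultimately show "((\<lambda>s. mink (\<gamma>1 s) (\<gamma>1 s)) has_vector_derivative 0) (at t)"
      by (simp add: mink_commute[of "\<gamma>1 t"])
  qed
  have acc: "\<gamma>2 t = - \<kappa> *\<^sub>R \<gamma> t" if t: "t \<in> J" for t
  proof -
    have "((\<lambda>s. mink (\<gamma>1 s) (\<gamma> s)) has_vector_derivative
        mink (\<gamma>1 t) (\<gamma>1 t) + mink (\<gamma>2 t) (\<gamma> t)) (at t)"
      by (rule mink.has_vector_derivative[OF d(2) d(1)]) (rule t)+
    moreover have "((\<lambda>s. mink (\<gamma>1 s) (\<gamma> s)) has_vector_derivative 0) (at t)"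
      by (rule has_vector_derivative_transform_within_open[OF has_vector_derivative_const J(1) t])
        (simp add: tangent)
    ultimately have "mink (\<gamma>1 t) (\<gamma>1 t) + mink (\<gamma>2 t) (\<gamma> t) = 0"
      by (rule vector_derivative_unique_at)
    then have "mink (\<gamma>2 t) (\<gamma> t) = - \<kappa>" using \<kappa>[OF t] by simp
    then show ?thesis using normal(2)[OF t] by simp
  qed
  define p v where "p = \<gamma> t\<^sub>0" and "v = \<gamma>1 t\<^sub>0"
  let ?C = "\<lambda>t. gcos \<kappa> (t - t\<^sub>0)" and ?S = "\<lambda>t. gsin \<kappa> (t - t\<^sub>0)"
  note CS = DERIV_gcos_shift[of \<kappa> t\<^sub>0] DERIV_gsin_shift[of \<kappa> t\<^sub>0]
  have A: "?C t *\<^sub>R \<gamma> t - ?S t *\<^sub>R \<gamma>1 t = p" if "t \<in> J" for t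
  proof -
    have "?C t *\<^sub>R \<gamma> t - ?S t *\<^sub>R \<gamma>1 t = ?C t\<^sub>0 *\<^sub>R \<gamma> t\<^sub>0 - ?S t\<^sub>0 *\<^sub>R \<gamma>1 t\<^sub>0"
    proof (rule const[OF _ that])
      fix t assume t: "t \<in> J"
      show "((\<lambda>t. ?C t *\<^sub>R \<gamma> t - ?S t *\<^sub>R \<gamma>1 t) has_vector_derivative 0) (at t)"
        by (rule has_vector_derivative_eq_rhs[OF has_vector_derivative_diff[OF
            has_vector_derivative_scaleR[OF CS(1) d(1)[OF t]]
            has_vector_derivative_scaleR[OF CS(2) d(2)[OF t]]]])
          (simp add: acc[OF t])
    qed
    then show ?thesis by (simp add: p_def)
  qed
  have B: "(\<kappa> * ?S t) *\<^sub>R \<gamma> t + ?C t *\<^sub>R \<gamma>1 t = v" if "t \<in> J" for t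
  proof -
    have "(\<kappa> * ?S t) *\<^sub>R \<gamma> t + ?C t *\<^sub>R \<gamma>1 t = (\<kappa> * ?S t\<^sub>0) *\<^sub>R \<gamma> t\<^sub>0 + ?C t\<^sub>0 *\<^sub>R \<gamma>1 t\<^sub>0"
    proof (rule const[OF _ that])
      fix t assume t: "t \<in> J"
      show "((\<lambda>t. (\<kappa> * ?S t) *\<^sub>R \<gamma> t + ?C t *\<^sub>R \<gamma>1 t) has_vector_derivative 0) (at t)"
        by (rule has_vector_derivative_eq_rhs[OF has_vector_derivative_add[OF
            has_vector_derivative_scaleR[OF DERIV_cmult[OF CS(2)] d(1)[OF t]]
            has_vector_derivative_scaleR[OF CS(1) d(2)[OF t]]]])
          (simp add: acc[OF t])
    qed
    then show ?thesis by (simp add: v_def)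
  qed
  have sol: "\<gamma> t = geod p v (t - t\<^sub>0)" if "t \<in> J" for t
  proof -
    have "geod p v (t - t\<^sub>0) = ?C t *\<^sub>R p + ?S t *\<^sub>R v"
      by (simp add: geod_def v_def \<kappa>_def)
    also have "\<dots> = (?C t ^ 2 + \<kappa> * ?S t ^ 2) *\<^sub>R \<gamma> t"
      unfolding A[OF that, symmetric] B[OF that, symmetric]
      by (simp add: power2_eq_square algebra_simps)
    finally show ?thesis by (simp add: gcos_gsin_sq)
  qed
  show ?thesis
  proof
    show "v \<noteq> 0" using normal(1)[OF t0] by (simp add: v_def)
    show "mink (\<Psi> (c t\<^sub>0)) v = 0"
      using tangent[OF t0] by (simp add: v_def \<gamma>_def mink_commute)
    fix t assume t: "t \<in> J"
    show "c t = \<Phi> (geod (\<Psi> (c t\<^sub>0)) v (t - t\<^sub>0))"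
      using sol[OF t] J(3)[OF t] by (metis \<Phi>_\<Psi> \<gamma>_def p_def)
    show "h (c t) (velocity c t) (velocity c t) = mink v v"
      using \<kappa>[OF t] J(3)[OF t] by (simp add: vel[OF t] h_eq v_def \<kappa>_def)
  qed
qed

lemma maximal_geodesic_geod:
  assumes "mink p p = 1" "mink p v = 0" "v \<noteq> 0"
  shows "maximal_geodesic S h UNIV (\<lambda>t. \<Phi> (geod p v (t - t\<^sub>0)))"
  unfolding maximal_geodesic_def using geodesic_geod[OF assms, of UNIV t\<^sub>0] by auto

text \<open>
  The explicit solution continues any geodesic to the whole line, so a maximal one already lives there.
\<close>

lemma maximal_geodesic_eq_geod:
  assumes max: "maximal_geodesic S h J c" and t0: "t\<^sub>0 \<in> J"
  obtains v where "J = UNIV" "v \<noteq> 0" "mink (\<Psi> (c t\<^sub>0)) v = 0"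
    "\<And>t. c t = \<Phi> (geod (\<Psi> (c t\<^sub>0)) v (t - t\<^sub>0))"
    "\<And>t. h (c t) (velocity c t) (velocity c t) = mink v v"
proof -
  have geo: "geodesic S h J c" using max by (simp add: maximal_geodesic_def)
  then have "c t\<^sub>0 \<in> S" using t0 by (auto simp: geodesic_def smooth_curve_def)
  obtain v where v: "v \<noteq> 0" "mink (\<Psi> (c t\<^sub>0)) v = 0"
    "\<And>t. t \<in> J \<Longrightarrow> c t = \<Phi> (geod (\<Psi> (c t\<^sub>0)) v (t - t\<^sub>0))"
    "\<And>t. t \<in> J \<Longrightarrow> h (c t) (velocity c t) (velocity c t) = mink v v"
    by (fact geodesic_eq_geod[OF geo t0])
  let ?c = "\<lambda>t. \<Phi> (geod (\<Psi> (c t\<^sub>0)) v (t - t\<^sub>0))"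
  have "geodesic S h UNIV ?c"
    using geodesic_geod[OF mink_\<Psi>[OF \<open>c t\<^sub>0 \<in> S\<close>] v(2,1)] by simp
  moreover have "\<forall>t\<in>J. ?c t = c t" by (intro ballI) (rule v(3)[symmetric])
  ultimately have "UNIV = J"
    using max unfolding maximal_geodesic_def by blast
  then have J: "J = UNIV" by (rule sym)
  show ?thesis
    by (rule that[OF J v(1,2)]) (use J in \<open>auto intro: v(3,4)\<close>)
qed

lemma geodesic_joining_eq_geod:
  assumes "geodesic_joining S h g g' J c"
  obtains v t\<^sub>0 t where "J = UNIV" "v \<noteq> 0" "mink (\<Psi> g) v = 0"
    "\<And>t. c t = \<Phi> (geod (\<Psi> g) v (t - t\<^sub>0))" "\<Psi> g' = geod (\<Psi> g) v t"
    "\<And>t. h (c t) (velocity c t) (velocity c t) = mink v v"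
proof -
  obtain t\<^sub>0 t where max: "maximal_geodesic S h J c" and t: "t\<^sub>0 \<in> J" "c t\<^sub>0 = g" "c t = g'"
    using assms by (auto simp: geodesic_joining_def)
  obtain v where v: "J = UNIV" "v \<noteq> 0" "mink (\<Psi> (c t\<^sub>0)) v = 0"
    "\<And>t. c t = \<Phi> (geod (\<Psi> (c t\<^sub>0)) v (t - t\<^sub>0))"
    "\<And>t. h (c t) (velocity c t) (velocity c t) = mink v v"
    by (fact maximal_geodesic_eq_geod[OF max t(1)])
  note v = v[unfolded t(2)]
  show ?thesis
  proof (rule that[OF v(1-4)])
    show "\<Psi> g' = geod (\<Psi> g) v (t - t\<^sub>0)"
      unfolding t(3)[symmetric] by (subst v(4)) simp
  qed (rule v(5))
qed

text \<open>
  All conclusions come from \<open>\<tau> = gcos \<kappa> t\<close> and \<open>\<tau>\<^sup>2 + \<kappa> (gsin \<kappa> t)\<^sup>2 = 1\<close>, where \<open>\<kappa>\<close> is the square of the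
  velocity and \<open>t\<close> is the time from \<open>g\<close> to \<open>g'\<close>.
\<close>

lemma geodesic_joining_causal_type:
  assumes g: "g \<in> S" "g' \<in> S" "g \<noteq> g'" and joining: "geodesic_joining S h g g' J c"
    and \<tau>: "\<tau> = mink (\<Psi> g) (\<Psi> g')"
  shows "\<tau> \<ge> - 1" "\<tau> = - 1 \<Longrightarrow> g = - g'" "\<tau> > 1 \<Longrightarrow> timelike_curve h J c"
    "\<tau> = 1 \<Longrightarrow> null_curve h J c" "- 1 < \<tau> \<Longrightarrow> \<tau> < 1 \<Longrightarrow> spacelike_curve h J c"
    "\<tau> \<noteq> - 1 \<Longrightarrow> c ` J = \<Phi> ` range (geod (\<Psi> g) (\<Psi> g' - \<tau> *\<^sub>R \<Psi> g))"
proof -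
  obtain v t\<^sub>0 t where v: "J = UNIV" "v \<noteq> 0" "mink (\<Psi> g) v = 0"
    "\<And>t. c t = \<Phi> (geod (\<Psi> g) v (t - t\<^sub>0))" and t: "\<Psi> g' = geod (\<Psi> g) v t"
    and vel: "\<And>t. h (c t) (velocity c t) (velocity c t) = mink v v"
    by (fact geodesic_joining_eq_geod[OF joining])
  define \<kappa> where "\<kappa> = mink v v"
  have \<tau>_eq: "\<tau> = gcos \<kappa> t"
    unfolding \<tau> t \<kappa>_def by (rule mink_geod(2)[OF mink_\<Psi>[OF g(1)] v(3)])
  have g': "\<Psi> g' = \<tau> *\<^sub>R \<Psi> g + gsin \<kappa> t *\<^sub>R v"
    unfolding t \<tau>_eq by (simp add: geod_def \<kappa>_def)
  have sq: "\<tau>\<^sup>2 + \<kappa> * (gsin \<kappa> t)\<^sup>2 = 1"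
    using gcos_gsin_sq by (simp add: \<tau>_eq)
  have ne: "\<Psi> g \<noteq> \<Psi> g'" using g by (metis \<Phi>_\<Psi>)
  have conj: "gsin \<kappa> t = 0 \<Longrightarrow> \<tau> = - 1 \<and> \<Psi> g' = - \<Psi> g"
  proof -
    assume *: "gsin \<kappa> t = 0"
    then have "\<tau>\<^sup>2 = 1" using sq by simp
    then have "\<tau> = 1 \<or> \<tau> = - 1" by (simp add: power2_eq_1_iff)
    then show "\<tau> = - 1 \<and> \<Psi> g' = - \<Psi> g" using * g' ne by auto
  qed
  show "\<tau> \<ge> - 1" by (simp add: \<tau>_eq gcos_ge_minus_1)
  show "g = - g'" if "\<tau> = - 1"
  proof -
    have "gsin \<kappa> t = 0"
      using sq that gcos_ge_1[of 0 t] \<tau>_eq by auto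
    then have "\<Phi> (\<Psi> g') = \<Phi> (- \<Psi> g)" using conj by simp
    then show ?thesis using g by (simp add: linear_neg[OF linear_\<Phi>] \<Phi>_\<Psi>)
  qed
  show "timelike_curve h J c" if "\<tau> > 1"
    using that gcos_le_1[of \<kappa> t] \<tau>_eq by (auto simp: timelike_curve_def vel \<kappa>_def[symmetric] not_le[symmetric])
  show "null_curve h J c" if "\<tau> = 1"
    using that sq conj by (auto simp: null_curve_def vel \<kappa>_def[symmetric])
  show "spacelike_curve h J c" if "- 1 < \<tau>" "\<tau> < 1"
    using that gcos_ge_1[of \<kappa> t] \<tau>_eq by (auto simp: spacelike_curve_def vel \<kappa>_def[symmetric] not_le[symmetric])
  show "c ` J = \<Phi> ` range (geod (\<Psi> g) (\<Psi> g' - \<tau> *\<^sub>R \<Psi> g))" if "\<tau> \<noteq> - 1"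
  proof -
    have "gsin \<kappa> t \<noteq> 0" using conj that by blast
    then have "range (geod (\<Psi> g) (\<Psi> g' - \<tau> *\<^sub>R \<Psi> g)) = range (geod (\<Psi> g) v)"
      by (simp add: g' range_geod_scale)
    also have "\<dots> = range (\<lambda>t. geod (\<Psi> g) v (t - t\<^sub>0))"
      by (rule range_shift[symmetric])
    finally show ?thesis by (simp add: v(1,4) image_image)
  qed
qed

text \<open>
  For \<open>\<tau> = mink p q\<close> the vector \<open>v = q - \<tau> p\<close> is tangent at \<open>p\<close> and has square \<open>1 - \<tau>\<^sup>2\<close>, so the geodesic
  in its direction passes through \<open>q\<close> by \<open>ex_gcos_gsin\<close>.
\<close>

lemma unique_geodesic_joining:
  assumes g: "g \<in> S" "g' \<in> S" "g \<noteq> g'" and \<tau>: "mink (\<Psi> g) (\<Psi> g') > - 1"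
  shows "unique_geodesic_joining S h g g'"
proof -
  define p q \<tau> where "p = \<Psi> g" and "q = \<Psi> g'" and "\<tau> = mink (\<Psi> g) (\<Psi> g')"
  define v where "v = q - \<tau> *\<^sub>R p"
  have p: "mink p p = 1" and q: "mink q q = 1" and pq: "mink p q = \<tau>" "mink q p = \<tau>"
    using g by (simp_all add: p_def q_def \<tau>_def mink_\<Psi> mink_commute)
  have v: "mink p v = 0" "mink v v = 1 - \<tau>\<^sup>2"
    by (simp_all add: v_def mink.diff_right mink.diff_left mink.scaleR_left mink.scaleR_right
        p q pq power2_eq_square)
  have "v \<noteq> 0"
  proof
    assume "v = 0"
    then have q': "q = \<tau> *\<^sub>R p" by (simp add: v_def)
    have "\<tau>\<^sup>2 = 1" using v(2) \<open>v = 0\<close> by (simp add: mink.zero_left)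
    then have "\<tau> = 1" using \<tau> by (auto simp: power2_eq_1_iff \<tau>_def)
    then have "\<Psi> g = \<Psi> g'" using q' by (simp add: p_def q_def)
    then show False using g by (metis \<Phi>_\<Psi>)
  qed
  obtain t where t: "gcos (1 - \<tau>\<^sup>2) t = \<tau>" "gsin (1 - \<tau>\<^sup>2) t = 1"
    using ex_gcos_gsin \<tau> unfolding \<tau>_def by blast
  then have "geod p v t = q"
    by (simp add: geod_def v(2)) (simp add: v_def)
  then have "\<Phi> (geod p v (t - 0)) = g'" "\<Phi> (geod p v (0 - 0)) = g"
    using g by (simp_all add: p_def q_def \<Phi>_\<Psi>)
  then have "geodesic_joining S h g g' UNIV (\<lambda>t. \<Phi> (geod p v (t - 0)))"
    unfolding geodesic_joining_def using maximal_geodesic_geod[OF p v(1) \<open>v \<noteq> 0\<close>, of 0]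
    by (metis rangeI)
  moreover have "c ` J = \<Phi> ` range (geod p v)" if "geodesic_joining S h g g' J c" for J c
    using geodesic_joining_causal_type(6)[OF g that \<tau>_def] \<tau>
    by (simp add: p_def q_def v_def \<tau>_def)
  ultimately show ?thesis
    unfolding unique_geodesic_joining_def by metis
qed

text \<open>
  A spacelike geodesic is periodic and reaches the antipode after half a period. For the other types
  the product of the position with the starting point stays at least \<open>1\<close>, whereas it is \<open>-1\<close> at the antipode.
\<close>

lemma antipodal_point:
  assumes max: "maximal_geodesic S h J c" and t0: "t\<^sub>0 \<in> J" "c t\<^sub>0 = g"
  shows "spacelike_curve h J c \<Longrightarrow> \<exists>t\<in>J. t\<^sub>0 < t \<and> c t = - g"
    and "timelike_curve h J c \<or> null_curve h J c \<Longrightarrow> \<forall>t\<in>J. c t \<noteq> - g"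
proof -
  obtain v where v: "J = UNIV" "v \<noteq> 0" "mink (\<Psi> (c t\<^sub>0)) v = 0"
    "\<And>t. c t = \<Phi> (geod (\<Psi> (c t\<^sub>0)) v (t - t\<^sub>0))"
    "\<And>t. h (c t) (velocity c t) (velocity c t) = mink v v"
    by (fact maximal_geodesic_eq_geod[OF max t0(1)])
  note v = v[unfolded t0(2)]
  define \<kappa> where "\<kappa> = mink v v"
  have "g \<in> S"
    using max t0 by (auto simp: maximal_geodesic_def geodesic_def smooth_curve_def)
  then have g: "mink (\<Psi> g) (\<Psi> g) = 1" "\<Phi> (\<Psi> g) = g" by (simp_all add: mink_\<Psi> \<Phi>_\<Psi>)
  show "\<exists>t\<in>J. t\<^sub>0 < t \<and> c t = - g" if "spacelike_curve h J c"
  proof (intro bexI conjI)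
    have pos: "\<kappa> > 0" using that v(1,5) by (simp add: spacelike_curve_def \<kappa>_def)
    let ?t = "t\<^sub>0 + pi / sqrt \<kappa>"
    show "t\<^sub>0 < ?t" using pos by simp
    have "gcos \<kappa> (pi / sqrt \<kappa>) = - 1" "gsin \<kappa> (pi / sqrt \<kappa>) = 0"
      using pos by (simp_all add: gcos_def gsin_def)
    then show "c ?t = - g"
      by (subst v(4)) (simp add: geod_def \<kappa>_def[symmetric] linear_neg[OF linear_\<Phi>] g)
    show "?t \<in> J" by (simp add: v(1))
  qed
  show "\<forall>t\<in>J. c t \<noteq> - g" if "timelike_curve h J c \<or> null_curve h J c"
  proof (intro ballI notI)
    fix t assume "c t = - g"
    then have "\<Phi> (geod (\<Psi> g) v (t - t\<^sub>0)) = \<Phi> (- \<Psi> g)"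
      using v(4)[of t] by (simp add: linear_neg[OF linear_\<Phi>] g)
    then have "mink (\<Psi> g) (geod (\<Psi> g) v (t - t\<^sub>0)) = - 1"
      by (simp add: mink.minus_right g)
    then have "gcos \<kappa> (t - t\<^sub>0) = - 1"
      using mink_geod(2)[OF g(1), of v "t - t\<^sub>0"] v(3) by (simp add: \<kappa>_def)
    moreover have "\<kappa> \<le> 0"
      using that v(1,5) by (auto simp: timelike_curve_def null_curve_def \<kappa>_def)
    ultimately show False using gcos_ge_1[of \<kappa> "t - t\<^sub>0"] by simp
  qed
qed

end

text \<open>
  In linear coordinates \<open>F\<close> is the identity.
\<close>

lemma surface_isometry_of_frames:
  assumes "pseudosphere \<Phi> \<Psi> S h" "pseudosphere \<Phi>' \<Psi>' S' h'"
    and F: "\<And>p. p \<in> S \<Longrightarrow> F p = \<Phi>' (\<Psi> p)"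
  shows "surface_isometry S h S' h' F"
proof -
  interpret A: pseudosphere \<Phi> \<Psi> S h by fact
  interpret B: pseudosphere \<Phi>' \<Psi>' S' h' by fact
  have F_S: "F p \<in> S'" if "p \<in> S" for p
    using that by (auto simp: F B.S_eq A.mink_\<Psi>)
  have G_S: "\<Phi> (\<Psi>' q) \<in> S" "F (\<Phi> (\<Psi>' q)) = q" if "q \<in> S'" for q
  proof -
    show *: "\<Phi> (\<Psi>' q) \<in> S" using that by (auto simp: A.S_eq B.mink_\<Psi>)
    show "F (\<Phi> (\<Psi>' q)) = q" using that by (simp add: F[OF *] B.\<Phi>_\<Psi>)
  qed
  have GF: "\<Phi> (\<Psi>' (F p)) = p" if "p \<in> S" for p
    using that by (simp add: F A.\<Phi>_\<Psi>)
  have bij: "bij_betw F S S'"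
    by (rule bij_betw_byWitness[of _ "\<lambda>q. \<Phi> (\<Psi>' q)"]) (use F_S G_S GF in auto)
  have inv: "inv_into S F q = \<Phi> (\<Psi>' q)" if "q \<in> S'" for q
    by (rule inv_into_f_eq) (use bij G_S[OF that] in \<open>auto simp: bij_betw_def\<close>)
  have "smooth_map U (F \<circ> \<phi>)" if ch: "chart S U \<phi>" for U \<phi>
  proof -
    have "smooth_map U (\<lambda>x. \<Phi>' (\<Psi> (\<phi> x)))"
      using ch by (intro smooth_map_linear_comp[OF _ B.linear_\<Phi>] smooth_map_linear_comp[OF _ A.linear_\<Psi>])
        (simp add: chart_def)
    then show ?thesis
      by (rule smooth_map_cong[rotated]) (use ch F in \<open>auto simp: chart_def image_subset_iff\<close>)
  qed
  moreover have "smooth_map U (inv_into S F \<circ> \<phi>)" if ch: "chart S' U \<phi>" for U \<phi>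
  proof -
    have "smooth_map U (\<lambda>x. \<Phi> (\<Psi>' (\<phi> x)))"
      using ch by (intro smooth_map_linear_comp[OF _ A.linear_\<Phi>] smooth_map_linear_comp[OF _ B.linear_\<Psi>])
        (simp add: chart_def)
    then show ?thesis
      by (rule smooth_map_cong[rotated]) (use ch inv in \<open>auto simp: chart_def image_subset_iff\<close>)
  qed
  ultimately have "diffeomorphism S S' F"
    unfolding diffeomorphism_def using bij by blast
  moreover have vel: "\<exists>v. velocity c 0 = \<Phi> v \<and> velocity (F \<circ> c) 0 = \<Phi>' v"
    if c: "smooth_curve S J c" and 0: "0 \<in> J" for J c
  proof -
    have J: "open J" "\<And>t. t \<in> J \<Longrightarrow> c t \<in> S" using c by (auto simp: smooth_curve_def)
    obtain \<gamma>1 \<gamma>2 where d: "\<And>t. t \<in> J \<Longrightarrow> ((\<lambda>s. \<Psi> (c s)) has_vector_derivative \<gamma>1 t) (at t)"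
      "\<And>t. t \<in> J \<Longrightarrow> (\<gamma>1 has_vector_derivative \<gamma>2 t) (at t)"
      and v: "\<And>t. t \<in> J \<Longrightarrow> velocity c t = \<Phi> (\<gamma>1 t)"
      and "\<And>t. t \<in> J \<Longrightarrow> mink (\<gamma>1 t) (\<Psi> (c t)) = 0"
      by (fact A.smooth_curve_velocity[OF c])
    have "velocity (F \<circ> c) 0 = \<Phi>' (\<gamma>1 0)"
      by (rule B.velocity_eq[OF d(1)[OF 0] J(1) 0]) (simp add: F J(2))
    then show ?thesis using v[OF 0] by blast
  qed
  have "h' (F (c 0)) (velocity (F \<circ> c) 0) (velocity (F \<circ> c') 0) =
      h (c 0) (velocity c 0) (velocity c' 0)"
    if c: "smooth_curve S J c" "0 \<in> J" "smooth_curve S J' c'" "0 \<in> J'" for J c J' c'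
  proof -
    obtain v v' where "velocity c 0 = \<Phi> v" "velocity (F \<circ> c) 0 = \<Phi>' v"
      "velocity c' 0 = \<Phi> v'" "velocity (F \<circ> c') 0 = \<Phi>' v'"
      using vel[OF c(1,2)] vel[OF c(3,4)] by blast
    moreover have "c 0 \<in> S" using c by (auto simp: smooth_curve_def)
    ultimately show ?thesis by (simp add: A.h_eq B.h_eq F_S)
  qed
  ultimately show ?thesis
    unfolding surface_isometry_def by blast
qed

section \<open>Linear algebra of the plane\<close>

text \<open>
  The defining basis of trace and determinant, with names for its two members.
\<close>

locale plane =
  fixes b1 b2 :: "'e::real_vector"
  assumes some_basis_eq: "some_basis = {b1, b2}" and b_neq: "b1 \<noteq> b2"
    and indep: "independent {b1, b2}" and span_b: "span {b1, b2} = UNIV"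
begin

definition r1 :: "'e \<Rightarrow> real" where "r1 u = representation {b1, b2} u b1"
definition r2 :: "'e \<Rightarrow> real" where "r2 u = representation {b1, b2} u b2"

lemma expand: "u = r1 u *\<^sub>R b1 + r2 u *\<^sub>R b2"
  using sum_representation_eq[OF indep, of u "{b1, b2}"] b_neq
  by (simp add: span_b r1_def r2_def)

lemma r_linear [simp]:
  "r1 (u + v) = r1 u + r1 v" "r2 (u + v) = r2 u + r2 v"
  "r1 (a *\<^sub>R u) = a * r1 u" "r2 (a *\<^sub>R u) = a * r2 u"
  "r1 b1 = 1" "r1 b2 = 0" "r2 b1 = 0" "r2 b2 = 1"
  using b_neq
  by (simp_all add: r1_def r2_def representation_add[OF indep] representation_scale[OF indep]
      representation_basis[OF indep] span_b)

lemma plane_eq_iff: "u = v \<longleftrightarrow> r1 u = r1 v \<and> r2 u = r2 v"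
  using expand[of u] expand[of v] by metis

lemma linear_expand:
  assumes "linear f"
  shows "f u = r1 u *\<^sub>R f b1 + r2 u *\<^sub>R f b2"
  by (subst expand[of u]) (simp only: linear_add[OF assms] linear_scale[OF assms])

lemma lin_trace_eq: "lin_trace f = r1 (f b1) + r2 (f b2)"
  using b_neq by (simp add: lin_trace_def some_basis_eq r1_def r2_def)

lemma lin_det_eq: "lin_det f = r1 (f b1) * r2 (f b2) - r2 (f b1) * r1 (f b2)"
proof -
  have "{p. p permutes {b1, b2}} = {id, Transposition.transpose b1 b2}"
    by (auto simp: permutes_doubleton_iff)
  moreover have "id \<noteq> Transposition.transpose b1 b2"
    using b_neq by (metis id_apply transpose_apply_first)
  ultimately show ?thesis
    using b_neq by (simp add: lin_det_def some_basis_eq r1_def r2_def sign_swap_id)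
qed

text \<open>
  The endomorphism with matrix \<open>[[x, y + z], [y - z, -x]]\<close>, whose determinant is
  \<open>-(x\<^sup>2 + y\<^sup>2 - z\<^sup>2)\<close>.
\<close>

definition sl_frame :: "vec3 \<Rightarrow> 'e \<Rightarrow> 'e" where
  "sl_frame p u = (fst p * r1 u + (fst (snd p) + snd (snd p)) * r2 u) *\<^sub>R b1 +
     ((fst (snd p) - snd (snd p)) * r1 u - fst p * r2 u) *\<^sub>R b2"

text \<open>
  The matrix entries of a trace-free \<open>f\<close>. For other functions \<open>f\<close> the formula is one of many choices
  that are linear in \<open>f\<close>, as is required of a coordinate map in \<open>frame\<close>.
\<close>

definition sl_coords :: "('e \<Rightarrow> 'e) \<Rightarrow> vec3" where
  "sl_coords f = (r1 (f b1), (r1 (f b2) + r2 (f b1)) / 2, (r1 (f b2) - r2 (f b1)) / 2)"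

lemma r_sl_frame [simp]:
  "r1 (sl_frame p u) = fst p * r1 u + (fst (snd p) + snd (snd p)) * r2 u"
  "r2 (sl_frame p u) = (fst (snd p) - snd (snd p)) * r1 u - fst p * r2 u"
  by (simp_all add: sl_frame_def)

lemma linear_sl_frame: "linear (sl_frame p)"
  by (rule linearI) (simp_all add: plane_eq_iff algebra_simps)

lemma sl_form_frame: "sl_form (sl_frame p) (sl_frame q) = mink p q"
  by (simp add: sl_form_def lin_trace_eq mink_def field_simps)

lemma lin_trace_frame: "lin_trace (sl_frame p) = 0"
  by (simp add: lin_trace_eq)

lemma traceless_eq_frame:
  assumes "linear f" "lin_trace f = 0"
  shows "f = sl_frame (sl_coords f)"
proof
  fix u
  have "r2 (f b2) = - r1 (f b1)" using assms(2) by (simp add: lin_trace_eq)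
  then show "f u = sl_frame (sl_coords f) u"
    by (subst linear_expand[OF assms(1)])
      (simp add: plane_eq_iff sl_coords_def field_simps)
qed

text \<open>
  The Cayley--Hamilton theorem: the trace is \<open>0\<close> and the determinant is \<open>-1\<close>.
\<close>

lemma sl_frame_involution:
  assumes "mink p p = 1"
  shows "sl_frame p (sl_frame p u) = u"
proof -
  have *: "fst p * fst p + fst (snd p) * fst (snd p) - snd (snd p) * snd (snd p) = 1"
    using assms by (simp add: mink_def)
  have "r1 (sl_frame p (sl_frame p u)) =
      (fst p * fst p + fst (snd p) * fst (snd p) - snd (snd p) * snd (snd p)) * r1 u"
    "r2 (sl_frame p (sl_frame p u)) =
      (fst p * fst p + fst (snd p) * fst (snd p) - snd (snd p) * snd (snd p)) * r2 u"
    by (simp_all add: algebra_simps)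
  then show ?thesis
    unfolding * plane_eq_iff by simp
qed

lemma de_sitter_eq: "(de_sitter :: ('e \<Rightarrow> 'e) set) = sl_frame ` {x. mink x x = 1}"
proof
  show "(de_sitter :: ('e \<Rightarrow> 'e) set) \<subseteq> sl_frame ` {x. mink x x = 1}"
  proof
    fix f :: "'e \<Rightarrow> 'e" assume "f \<in> de_sitter"
    then have f: "f = sl_frame (sl_coords f)" "sl_form f f = 1"
      using traceless_eq_frame by (auto simp: de_sitter_def)
    then have "mink (sl_coords f) (sl_coords f) = 1"
      by (metis sl_form_frame)
    with f(1) show "f \<in> sl_frame ` {x. mink x x = 1}" by blast
  qed
qed (auto simp: de_sitter_def linear_sl_frame lin_trace_frame sl_form_frame)

lemma pseudosphere_de_sitter:
  "pseudosphere sl_frame sl_coords (de_sitter :: ('e \<Rightarrow> 'e) set) de_sitter_metric"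
proof (intro pseudosphere.intro frame.intro pseudosphere_axioms.intro)
  show "linear sl_frame"
    by (rule linearI) (simp_all add: fun_eq_iff plane_eq_iff algebra_simps)
  show "linear sl_coords"
    by (rule linearI) (simp_all add: sl_coords_def field_simps)
  show "sl_coords (sl_frame x) = x" for x
    by (simp add: sl_coords_def prod_eq_iff)
  show "de_sitter = sl_frame ` {x. mink x x = 1}" by (rule de_sitter_eq)
  show "de_sitter_metric p (sl_frame x) (sl_frame y) = mink x y" for p x y
    by (simp add: de_sitter_metric_def sl_form_frame)
qed

end

lemma dim_2_plane:
  assumes "dim (UNIV :: 'e::real_vector set) = 2"
  obtains b1 b2 :: "'e::real_vector" where "plane b1 b2"
proof -
  have "\<exists>B :: 'e set. independent B \<and> span B = UNIV"
    using maximal_independent_subset_extend[of "{}" "UNIV :: 'e set"] by (metis empty_subsetI independent_empty top.extremum_uniqueI)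
  then have B: "independent (some_basis :: 'e set)" "span (some_basis :: 'e set) = UNIV"
    unfolding some_basis_def by (metis (mono_tags, lifting) someI_ex)+
  have "card (some_basis :: 'e set) = 2"
    using dim_eq_card[of some_basis "UNIV :: 'e set"] B assms by simp
  then obtain b1 b2 :: 'e where "some_basis = {b1, b2}" "b1 \<noteq> b2"
    by (auto simp: card_2_iff)
  with B have "plane b1 b2" by (simp add: plane_def)
  then show ?thesis by (rule that)
qed

section \<open>Lorentzian inner products and the de Sitter universe\<close>

locale oriented_plane = plane b1 b2 for b1 b2 :: "'e::real_vector" +
  fixes Or :: "('e \<times> 'e) set" and \<omega> :: "'e \<Rightarrow> 'e \<Rightarrow> real"
  assumes orientation: "orientation2 Or" and positive: "positive_area_form Or \<omega>"
begin

definition basis_area :: real where "basis_area = \<omega> b1 b2"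

lemma area_form_eq:
  assumes \<sigma>: "area_form \<sigma>"
  shows "\<sigma> u v = \<sigma> b1 b2 * (r1 u * r2 v - r2 u * r1 v)"
proof -
  have bil: "bilinear \<sigma>" and alt: "\<sigma> x x = 0" for x using \<sigma> by (auto simp: area_form_def)
  have "\<sigma> (b1 + b2) (b1 + b2) = \<sigma> b1 b2 + \<sigma> b2 b1"
    by (simp only: bilinear_ladd[OF bil] bilinear_radd[OF bil] alt[of b1] alt[of b2]
        add_0_left add_0_right)
  then have "\<sigma> b2 b1 = - \<sigma> b1 b2" unfolding alt[of "b1 + b2"] by simp
  then show ?thesis
    by (subst expand[of u], subst expand[of v])
      (simp add: bilinear_ladd[OF bil] bilinear_radd[OF bil] bilinear_lmul[OF bil]
        bilinear_rmul[OF bil] alt algebra_simps)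
qed

lemma \<omega>_eq: "\<omega> u v = basis_area * (r1 u * r2 v - r2 u * r1 v)"
  unfolding basis_area_def by (rule area_form_eq) (use positive in \<open>simp add: positive_area_form_def\<close>)

lemma basis_area_nonzero: "basis_area \<noteq> 0"
proof
  assume "basis_area = 0"
  then have "\<omega> u v = 0" for u v by (simp add: \<omega>_eq)
  moreover obtain u v where "(u, v) \<in> Or"
    using orientation by (auto simp: orientation2_def)
  ultimately show False using positive by (fastforce simp: positive_area_form_def)
qed

lemma \<omega>_det:
  assumes "linear f"
  shows "\<omega> (f u) (f v) = lin_det f * \<omega> u v"
  by (subst (1 2) linear_expand[OF assms]) (simp add: \<omega>_eq lin_det_eq algebra_simps)

lemma \<omega>_trace:
  assumes "linear f"
  shows "\<omega> (f u) v + \<omega> u (f v) = lin_trace f * \<omega> u v"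
  by (subst (1 2) linear_expand[OF assms]) (simp add: \<omega>_eq lin_trace_eq algebra_simps)

lemma \<omega>_nondegenerate:
  assumes "\<And>v. \<omega> u v = \<omega> u' v"
  shows "u = u'"
  using assms[of b1] assms[of b2] basis_area_nonzero by (simp add: \<omega>_eq plane_eq_iff)

lemma \<omega>_antisym: "\<omega> u v = - \<omega> v u"
  by (simp add: \<omega>_eq algebra_simps)

lemma expand_\<omega>:
  assumes "\<omega> e f \<noteq> 0"
  shows "u = (\<omega> u f / \<omega> e f) *\<^sub>R e + (\<omega> e u / \<omega> e f) *\<^sub>R f"
proof -
  have "\<omega> e f * r1 u = \<omega> u f * r1 e + \<omega> e u * r1 f" "\<omega> e f * r2 u = \<omega> u f * r2 e + \<omega> e u * r2 f"
    by (simp_all add: \<omega>_eq algebra_simps)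
  then show ?thesis
    using assms by (simp add: plane_eq_iff field_simps)
qed

lemma span_\<omega>:
  assumes "\<omega> e f \<noteq> 0"
  shows "span {e, f} = UNIV"
proof -
  have "u \<in> span {e, f}" for u
    by (subst expand_\<omega>[OF assms, of u]) (intro span_add span_scale span_base; simp)
  then show ?thesis by blast
qed

text \<open>
  The linear map that carries an oriented basis \<open>(u, v)\<close> to \<open>(e, f)\<close> has determinant
  \<open>\<omega> e f / \<omega> u v > 0\<close>, hence preserves the orientation.
\<close>

lemma positive_imp_oriented:
  assumes ef: "\<omega> e f > 0"
  shows "(e, f) \<in> Or"
proof -
  obtain u v where uv: "(u, v) \<in> Or" using orientation by (auto simp: orientation2_def)
  then have \<omega>uv: "\<omega> u v > 0" using positive by (auto simp: positive_area_form_def)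
  define T where "T a b c d x = (\<omega> x b / \<omega> a b) *\<^sub>R c + (\<omega> a x / \<omega> a b) *\<^sub>R d" for a b c d x :: 'e
  have lin: "linear (T u v e f)"
    by (rule linearI) (simp_all add: plane_eq_iff T_def \<omega>_eq add_divide_distrib diff_divide_distrib algebra_simps)
  have inv: "T c d a b (T a b c d x) = x" if "\<omega> a b \<noteq> 0" "\<omega> c d \<noteq> 0" for a b c d x
  proof -
    have "\<omega> (T a b c d x) d = (\<omega> x b / \<omega> a b) * \<omega> c d" "\<omega> c (T a b c d x) = (\<omega> a x / \<omega> a b) * \<omega> c d"
      unfolding T_def \<omega>_eq[of _ d] \<omega>_eq[of c] by (simp_all add: algebra_simps)
    then have "T c d a b (T a b c d x) = (\<omega> x b / \<omega> a b) *\<^sub>R a + (\<omega> a x / \<omega> a b) *\<^sub>R b"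
      using that by (simp add: T_def[of c d a b])
    also have "\<dots> = x" by (rule expand_\<omega>[OF that(1), symmetric])
    finally show ?thesis .
  qed
  have "bij (T u v e f)"
    by (rule o_bij[of "T e f u v"]) (use inv ef \<omega>uv in \<open>auto simp: fun_eq_iff\<close>)
  have img: "T u v e f u = e" "T u v e f v = f"
    using \<omega>uv by (simp_all add: T_def) (simp_all add: \<omega>_eq)
  have "lin_det (T u v e f) * \<omega> u v = \<omega> e f"
    using \<omega>_det[OF lin, of u v] by (simp add: img)
  then have "lin_det (T u v e f) > 0" using ef \<omega>uv by (metis zero_less_mult_pos2)
  then have "(T u v e f u, T u v e f v) \<in> Or"
    using orientation uv lin \<open>bij (T u v e f)\<close> by (auto simp: orientation2_def)
  then show ?thesis by (simp add: img)
qed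

definition form_frame :: "vec3 \<Rightarrow> 'e \<Rightarrow> 'e \<Rightarrow> real" where
  "form_frame p u v = \<omega> u (sl_frame p v)"

text \<open>
  The coordinates of \<open>I\<close> read off from the values of \<open>g = \<omega>(\<sqdot>, I\<sqdot>)\<close> on the basis.
\<close>

definition form_coords :: "('e \<Rightarrow> 'e \<Rightarrow> real) \<Rightarrow> vec3" where
  "form_coords g = (- g b1 b2 / basis_area, (g b1 b1 - g b2 b2) / (2 * basis_area), (- g b1 b1 - g b2 b2) / (2 * basis_area))"

lemma form_endo_unique:
  assumes "linear I"
  shows "form_endo \<omega> (\<lambda>u v. \<omega> u (I v)) = I"
  unfolding form_endo_def
proof (rule the_equality)
  fix I' assume I': "linear I' \<and> (\<lambda>u v. \<omega> u (I v)) = (\<lambda>u v. \<omega> u (I' v))"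
  have "\<omega> (I' v) u = \<omega> (I v) u" for u v
    using fun_cong[OF fun_cong[OF conjunct2[OF I'], of u], of v]
      \<omega>_antisym[of u "I v"] \<omega>_antisym[of u "I' v"] by simp
  then show "I' = I"
    using \<omega>_nondegenerate by blast
qed (simp add: assms)

lemma form_endo_frame: "form_endo \<omega> (form_frame p) = sl_frame p"
  using form_endo_unique[OF linear_sl_frame, of p] unfolding form_frame_def[abs_def] .

lemma form_frame_sym: "form_frame p u v = form_frame p v u"
  by (simp add: form_frame_def \<omega>_eq algebra_simps)

text \<open>
  This identity links both defining conditions of the space of inner products to the equation of the
  quadric: it determines the signature and normalizes the volume.
\<close>

lemma gram_determinant:
  "form_frame p e e * form_frame p f f - form_frame p e f ^ 2 = - mink p p * \<omega> e f ^ 2"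
  by (simp add: form_frame_def \<omega>_eq mink_def power2_eq_square algebra_simps)

lemma form_frame_linear:
  "form_frame p (a *\<^sub>R u + b *\<^sub>R v) z = a * form_frame p u z + b * form_frame p v z"
  by (simp add: form_frame_def \<omega>_eq algebra_simps)

lemma form_frame_scale: "form_frame p (a *\<^sub>R u) (b *\<^sub>R v) = a * b * form_frame p u v"
  by (simp add: form_frame_def \<omega>_eq algebra_simps)

lemma form_frame_involution:
  assumes "mink p p = 1"
  shows "form_frame p u (sl_frame p v) = \<omega> u v"
  by (simp add: form_frame_def sl_frame_involution[OF assms])

text \<open>
  If \<open>I\<^sup>2 = 1\<close>, then \<open>x\<close> and \<open>I x\<close> are orthogonal with opposite squares, so any \<open>x\<close> that is not null can be
  normalized to an orthonormal basis. One of \<open>b1\<close>, \<open>b2\<close>, \<open>b1 + b2\<close> is not null.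
\<close>

lemma form_frame_orthonormal:
  assumes p: "mink p p = 1"
  obtains e f where "form_frame p e e = 1" "form_frame p f f = - 1" "form_frame p e f = 0"
proof -
  let ?g = "form_frame p" and ?I = "sl_frame p"
  have "\<exists>x. ?g x x \<noteq> 0"
  proof (rule ccontr)
    assume "\<not> ?thesis"
    then have z: "?g x x = 0" for x by blast
    have "?g b1 b1 = 0" "?g b2 b2 = 0" "?g (b1 + b2) (b1 + b2) = 0" by (rule z)+
    then have "fst p = 0 \<and> fst (snd p) = 0 \<and> snd (snd p) = 0"
      using basis_area_nonzero by (simp add: form_frame_def \<omega>_eq)
    then show False using p by (simp add: mink_def)
  qed
  then obtain x where x: "?g x x \<noteq> 0" by blast
  have xI: "?g x (?I x) = 0"
    by (simp add: form_frame_involution[OF p]) (simp add: \<omega>_eq)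
  then have Ix: "?g (?I x) x = 0" by (simp add: form_frame_sym)
  have II: "?g (?I x) (?I x) = - ?g x x"
    unfolding form_frame_involution[OF p] by (simp add: form_frame_def \<omega>_antisym[of x])
  show ?thesis
  proof (cases "?g x x > 0")
    case True
    define s where "s = 1 / sqrt (?g x x)"
    have s: "s * s * ?g x x = 1" using True by (simp add: s_def)
    show ?thesis
    proof (rule that[of "s *\<^sub>R x" "s *\<^sub>R ?I x"])
      show "?g (s *\<^sub>R x) (s *\<^sub>R x) = 1" unfolding form_frame_scale by (rule s)
      show "?g (s *\<^sub>R ?I x) (s *\<^sub>R ?I x) = - 1" unfolding form_frame_scale II using s by simp
      show "?g (s *\<^sub>R x) (s *\<^sub>R ?I x) = 0" unfolding form_frame_scale xI by simp
    qed
  next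
    case False
    define s where "s = 1 / sqrt (- ?g x x)"
    have s: "s * s * ?g x x = - 1" using False x by (simp add: s_def)
    show ?thesis
    proof (rule that[of "s *\<^sub>R ?I x" "s *\<^sub>R x"])
      show "?g (s *\<^sub>R x) (s *\<^sub>R x) = - 1" unfolding form_frame_scale by (rule s)
      show "?g (s *\<^sub>R ?I x) (s *\<^sub>R ?I x) = 1" unfolding form_frame_scale II using s by simp
      show "?g (s *\<^sub>R ?I x) (s *\<^sub>R x) = 0" unfolding form_frame_scale Ix by simp
    qed
  qed
qed

lemma lorentz_forms_eq: "lorentz_forms Or \<omega> = form_frame ` {x. mink x x = 1}"
proof (intro equalityI subsetI)
  fix g assume "g \<in> form_frame ` {x. mink x x = 1}"
  then obtain p where p: "mink p p = 1" and g: "g = form_frame p" by auto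
  obtain e f where ef: "g e e = 1" "g f f = - 1" "g e f = 0"
    unfolding g by (rule form_frame_orthonormal[OF p])
  have "\<omega> e f \<noteq> 0" using gram_determinant[of p e f] ef by (auto simp: g)
  then have "lorentzian_on UNIV g"
    unfolding lorentzian_on_def using span_\<omega> ef form_frame_sym form_frame_linear
    by (metis g)
  moreover have "is_volume_form Or g \<omega>"
    unfolding is_volume_form_def
  proof (intro conjI)
    show "area_form \<omega>" using positive by (simp add: positive_area_form_def)
    show "\<forall>(e, f)\<in>Or. \<bar>g e e\<bar> = 1 \<and> \<bar>g f f\<bar> = 1 \<and> g e f = 0 \<longrightarrow> \<omega> e f = 1"
    proof (clarify)
      fix e f assume ef: "(e, f) \<in> Or" "\<bar>g e e\<bar> = 1" "\<bar>g f f\<bar> = 1" "g e f = 0"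
      have "\<omega> e f ^ 2 = \<bar>g e e * g f f\<bar>"
        using gram_determinant[of p e f] ef(4) p by (simp add: g)
      then have "\<omega> e f ^ 2 = 1" using ef by (simp add: abs_mult)
      moreover have "\<omega> e f > 0" using positive ef(1) by (auto simp: positive_area_form_def)
      ultimately show "\<omega> e f = 1" by (auto simp: power2_eq_1_iff)
    qed
  qed
  ultimately show "g \<in> lorentz_forms Or \<omega>" by (simp add: lorentz_forms_def)
next
  fix g assume "g \<in> lorentz_forms Or \<omega>"
  then have g: "lorentzian_on UNIV g" and vol: "is_volume_form Or g \<omega>"
    by (simp_all add: lorentz_forms_def)
  have sym: "g u v = g v u" for u v using g by (simp add: lorentzian_on_def)
  have lin: "g (a *\<^sub>R u + b *\<^sub>R v) z = a * g u z + b * g v z" for a b u v z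
    using g unfolding lorentzian_on_def by blast
  have expand_g: "g u v = r1 u * (r1 v * g b1 b1 + r2 v * g b1 b2) + r2 u * (r1 v * g b1 b2 + r2 v * g b2 b2)" for u v
  proof -
    have lin_b: "g u v = r1 u * g b1 v + r2 u * g b2 v" for u v
      by (subst expand[of u]) (rule lin)
    have "g b1 v = r1 v * g b1 b1 + r2 v * g b1 b2" "g b2 v = r1 v * g b1 b2 + r2 v * g b2 b2"
      using lin_b[of v b1] lin_b[of v b2] sym by metis+
    then show ?thesis by (simp add: lin_b[of u v])
  qed
  define p where "p = form_coords g"
  have gp: "g = form_frame p"
    unfolding fun_eq_iff
  proof (intro allI)
    fix u v
    show "g u v = form_frame p u v"
      unfolding expand_g[of u v] using basis_area_nonzero
      by (simp add: form_frame_def p_def form_coords_def \<omega>_eq field_simps)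
  qed
  obtain e f where ef: "g e e = 1" "g f f = - 1" "g e f = 0"
    using g by (auto simp: lorentzian_on_def)
  have gram: "mink p p * \<omega> e f ^ 2 = 1"
    using gram_determinant[of p e f] ef by (simp add: gp)
  then have "\<omega> e f > 0 \<or> \<omega> f e > 0"
    using \<omega>_antisym[of e f] by (cases "\<omega> e f" "0::real" rule: linorder_cases) auto
  then have "(e, f) \<in> Or \<or> (f, e) \<in> Or"
    using positive_imp_oriented by blast
  then have "\<omega> e f = 1 \<or> \<omega> f e = 1"
    using vol ef sym[of f e] unfolding is_volume_form_def by fastforce
  then have "\<omega> e f ^ 2 = 1" using \<omega>_antisym[of e f] by auto
  then have "mink p p = 1" using gram by simp
  then show "g \<in> form_frame ` {x. mink x x = 1}" using gp by blast
qed

lemma pseudosphere_lorentz_forms: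
  "pseudosphere form_frame form_coords (lorentz_forms Or \<omega>) (natural_metric \<omega>)"
proof (intro pseudosphere.intro frame.intro pseudosphere_axioms.intro)
  show "linear form_frame"
    by (rule linearI) (simp_all add: fun_eq_iff form_frame_def \<omega>_eq algebra_simps)
  show "linear form_coords"
    by (rule linearI) (simp_all add: form_coords_def add_divide_distrib diff_divide_distrib algebra_simps)
  show "form_coords (form_frame x) = x" for x
    using basis_area_nonzero by (simp add: form_coords_def form_frame_def \<omega>_eq prod_eq_iff field_simps)
  show "lorentz_forms Or \<omega> = form_frame ` {x. mink x x = 1}" by (rule lorentz_forms_eq)
  show "natural_metric \<omega> p (form_frame x) (form_frame y) = mink x y" for p x y
    by (simp add: natural_metric_def de_sitter_metric_def form_endo_frame sl_form_frame)
qed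

lemma form_endo_isometry:
  "surface_isometry (lorentz_forms Or \<omega>) (natural_metric \<omega>) de_sitter de_sitter_metric (form_endo \<omega>)"
proof (rule surface_isometry_of_frames[OF pseudosphere_lorentz_forms pseudosphere_de_sitter])
  interpret M: pseudosphere form_frame form_coords "lorentz_forms Or \<omega>" "natural_metric \<omega>"
    by (rule pseudosphere_lorentz_forms)
  show "form_endo \<omega> g = sl_frame (form_coords g)" if "g \<in> lorentz_forms Or \<omega>" for g
    using form_endo_frame[of "form_coords g"] M.\<Phi>_\<Psi>[OF that] by simp
qed

text \<open>
  Since \<open>\<gamma>\<close> preserves \<open>\<omega>\<close>, \<open>\<omega>(\<gamma>\<^sup>-\<^sup>1 u, I \<gamma>\<^sup>-\<^sup>1 v) = \<omega>(u, \<gamma> I \<gamma>\<^sup>-\<^sup>1 v)\<close>, and conjugation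
  preserves \<open>tr I = 0\<close> and \<open>I\<^sup>2 = 1\<close>.
\<close>

lemma SL_equivariance:
  assumes \<gamma>: "\<gamma> \<in> SL" and g: "g \<in> lorentz_forms Or \<omega>"
  shows "act_form \<gamma> g \<in> lorentz_forms Or \<omega>"
    and "form_endo \<omega> (act_form \<gamma> g) = act_endo \<gamma> (form_endo \<omega> g)"
proof -
  obtain p where p: "mink p p = 1" and gp: "g = form_frame p"
    using g by (auto simp: lorentz_forms_eq)
  have lin: "linear \<gamma>" and area: "\<omega> (\<gamma> u) (\<gamma> v) = \<omega> u v" for u v
    using \<gamma> \<omega>_det[of \<gamma>] by (auto simp: SL_def)
  have "inj \<gamma>"
  proof (rule injI)
    fix u u' assume "\<gamma> u = \<gamma> u'"
    then show "u = u'" using area \<omega>_nondegenerate by metis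
  qed
  have "surj \<gamma>"
  proof (rule surjI)
    fix v
    have "\<omega> (\<gamma> b1) (\<gamma> b2) \<noteq> 0" using basis_area_nonzero by (simp add: area basis_area_def)
    from expand_\<omega>[OF this, of v]
    show "\<gamma> ((\<omega> v (\<gamma> b2) / \<omega> (\<gamma> b1) (\<gamma> b2)) *\<^sub>R b1 + (\<omega> (\<gamma> b1) v / \<omega> (\<gamma> b1) (\<gamma> b2)) *\<^sub>R b2) = v"
      by (simp add: linear_add[OF lin] linear_scale[OF lin])
  qed
  have inv: "\<gamma> (inv \<gamma> u) = u" "inv \<gamma> (\<gamma> u) = u" for u
    using \<open>inj \<gamma>\<close> \<open>surj \<gamma>\<close> by (simp_all add: surj_f_inv_f)
  have lin_inv: "linear (inv \<gamma>)"
  proof (rule linearI)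
    show "inv \<gamma> (u + v) = inv \<gamma> u + inv \<gamma> v" for u v
      by (rule inv_f_eq[OF \<open>inj \<gamma>\<close>]) (simp add: linear_add[OF lin] inv)
    show "inv \<gamma> (a *\<^sub>R u) = a *\<^sub>R inv \<gamma> u" for a u
      by (rule inv_f_eq[OF \<open>inj \<gamma>\<close>]) (simp add: linear_scale[OF lin] inv)
  qed
  define I where "I = act_endo \<gamma> (sl_frame p)"
  have I: "I u = \<gamma> (sl_frame p (inv \<gamma> u))" for u by (simp add: I_def act_endo_def)
  have lin_I: "linear I"
    unfolding I_def act_endo_def by (intro linear_compose lin lin_inv linear_sl_frame)
  have "lin_trace I * basis_area = 0"
  proof -
    have "lin_trace I * \<omega> (\<gamma> b1) (\<gamma> b2) = lin_trace (sl_frame p) * \<omega> b1 b2"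
      unfolding \<omega>_trace[OF lin_I, symmetric] \<omega>_trace[OF linear_sl_frame, symmetric]
      by (simp add: I inv area)
    then show ?thesis by (simp add: lin_trace_frame area basis_area_def)
  qed
  then have trace: "lin_trace I = 0" using basis_area_nonzero by simp
  have "I \<circ> I = (\<lambda>u. u)"
    by (simp add: fun_eq_iff I inv sl_frame_involution[OF p])
  then have "sl_form I I = 1" by (simp add: sl_form_def lin_trace_eq)
  then have "I \<in> de_sitter" by (simp add: de_sitter_def lin_I trace)
  then obtain q where q: "mink q q = 1" "I = sl_frame q" by (auto simp: de_sitter_eq)
  have "act_form \<gamma> g = form_frame q"
  proof (intro ext)
    fix u v
    have "act_form \<gamma> g u v = \<omega> (\<gamma> (inv \<gamma> u)) (\<gamma> (sl_frame p (inv \<gamma> v)))"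
      unfolding area by (simp add: act_form_def gp form_frame_def)
    then show "act_form \<gamma> g u v = form_frame q u v"
      by (simp add: form_frame_def q(2)[symmetric] I inv)
  qed
  then show "act_form \<gamma> g \<in> lorentz_forms Or \<omega>"
    and "form_endo \<omega> (act_form \<gamma> g) = act_endo \<gamma> (form_endo \<omega> g)"
    using q by (auto simp: lorentz_forms_eq form_endo_frame gp I_def)
qed

text \<open>
  An endomorphism \<open>I\<close> of determinant \<open>-1\<close> satisfies \<open>\<omega>(I x, I y) = -\<omega>(x, y)\<close>, so
  \<open>\<omega>(I I' u, I v) = \<omega>(v, I' u)\<close>, which is \<open>\<omega>(u, I' v)\<close> by the symmetry of the second inner
  product. Uniqueness is the nondegeneracy of \<open>\<omega>\<close>.
\<close>

lemma relative_endomorphism: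
  assumes p: "mink p p = 1"
  shows "linear A \<and> form_frame q = (\<lambda>u v. form_frame p (A u) v) \<longleftrightarrow> A = sl_frame p \<circ> sl_frame q"
proof
  have skew: "\<omega> (sl_frame p x) (sl_frame p y) = - \<omega> x y" for x y
  proof -
    have "\<omega> (sl_frame p x) (sl_frame p y) = - \<omega> (sl_frame p (sl_frame p x)) y"
      by (simp add: \<omega>_eq algebra_simps)
    then show ?thesis by (simp only: sl_frame_involution[OF p])
  qed
  have comp: "form_frame q u v = form_frame p ((sl_frame p \<circ> sl_frame q) u) v" for u v
    using \<omega>_antisym[of v] by (simp add: form_frame_def skew) (metis form_frame_def form_frame_sym)
  {
    assume A: "linear A \<and> form_frame q = (\<lambda>u v. form_frame p (A u) v)"
    have "\<omega> (A u) v = \<omega> ((sl_frame p \<circ> sl_frame q) u) v" for u v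
    proof -
      have "form_frame p (A u) (sl_frame p v) = form_frame p ((sl_frame p \<circ> sl_frame q) u) (sl_frame p v)"
        using comp[of u "sl_frame p v"] A by metis
      then show ?thesis by (simp only: form_frame_involution[OF p])
    qed
    then show "A = sl_frame p \<circ> sl_frame q" using \<omega>_nondegenerate by blast
  next
    assume A: "A = sl_frame p \<circ> sl_frame q"
    show "linear A \<and> form_frame q = (\<lambda>u v. form_frame p (A u) v)"
      unfolding A using comp by (auto intro!: linear_compose linear_sl_frame)
  }
qed

end

theorem proposition9p1:
  fixes Or :: "('e::real_vector \<times> 'e) set" and \<omega> :: "'e \<Rightarrow> 'e \<Rightarrow> real"
  assumes "dim (UNIV :: 'e set) = 2"
    and "orientation2 Or"
    and "positive_area_form Or \<omega>"
  shows
    "lorentzian_surface (lorentz_forms Or \<omega>) (natural_metric \<omega>) \<and>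
     lorentzian_surface (de_sitter :: ('e \<Rightarrow> 'e) set) de_sitter_metric \<and>
     surface_isometry (lorentz_forms Or \<omega>) (natural_metric \<omega>) de_sitter de_sitter_metric (form_endo \<omega>) \<and>
     (\<forall>\<gamma>\<in>SL. \<forall>g\<in>lorentz_forms Or \<omega>. act_form \<gamma> g \<in> lorentz_forms Or \<omega> \<and>
        form_endo \<omega> (act_form \<gamma> g) = act_endo \<gamma> (form_endo \<omega> g)) \<and>
     (\<forall>g\<in>lorentz_forms Or \<omega>. \<forall>g'\<in>lorentz_forms Or \<omega>.
        (\<exists>!A. linear A \<and> g' = (\<lambda>u v. g (A u) v)) \<and>
        (\<forall>A. linear A \<and> g' = (\<lambda>u v. g (A u) v) \<longrightarrow>
          (lin_trace A > 2 \<longrightarrow>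
             unique_geodesic_joining (lorentz_forms Or \<omega>) (natural_metric \<omega>) g g' \<and>
             (\<forall>J c. geodesic_joining (lorentz_forms Or \<omega>) (natural_metric \<omega>) g g' J c \<longrightarrow>
                timelike_curve (natural_metric \<omega>) J c)) \<and>
          (lin_trace A = 2 \<and> g \<noteq> g' \<longrightarrow>
             unique_geodesic_joining (lorentz_forms Or \<omega>) (natural_metric \<omega>) g g' \<and>
             (\<forall>J c. geodesic_joining (lorentz_forms Or \<omega>) (natural_metric \<omega>) g g' J c \<longrightarrow>
                null_curve (natural_metric \<omega>) J c)) \<and>
          (-2 < lin_trace A \<and> lin_trace A < 2 \<longrightarrow>
             unique_geodesic_joining (lorentz_forms Or \<omega>) (natural_metric \<omega>) g g' \<and>
             (\<forall>J c. geodesic_joining (lorentz_forms Or \<omega>) (natural_metric \<omega>) g g' J c \<longrightarrow>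
                spacelike_curve (natural_metric \<omega>) J c)) \<and>
          (lin_trace A < -2 \<longrightarrow>
             (\<nexists>J c. geodesic_joining (lorentz_forms Or \<omega>) (natural_metric \<omega>) g g' J c)) \<and>
          (lin_trace A = -2 \<and> g \<noteq> - g' \<longrightarrow>
             (\<nexists>J c. geodesic_joining (lorentz_forms Or \<omega>) (natural_metric \<omega>) g g' J c)) \<and>
          (lin_trace A = -2 \<and> g = - g' \<longrightarrow>
             (\<forall>J c t\<^sub>0. maximal_geodesic (lorentz_forms Or \<omega>) (natural_metric \<omega>) J c \<and> t\<^sub>0 \<in> J \<and> c t\<^sub>0 = g \<longrightarrow>
                (spacelike_curve (natural_metric \<omega>) J c \<longrightarrow> (\<exists>t\<in>J. t\<^sub>0 < t \<and> c t = g')) \<and>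
                (timelike_curve (natural_metric \<omega>) J c \<or> null_curve (natural_metric \<omega>) J c \<longrightarrow>
                   (\<forall>t\<in>J. c t \<noteq> g'))))))"
proof -
  obtain b1 b2 :: 'e where "plane b1 b2" by (rule dim_2_plane[OF assms(1)])
  then interpret oriented_plane b1 b2 Or \<omega>
    using assms(2,3) by (simp add: oriented_plane_def oriented_plane_axioms_def)
  interpret M: pseudosphere form_frame form_coords "lorentz_forms Or \<omega>" "natural_metric \<omega>"
    by (rule pseudosphere_lorentz_forms)
  interpret D: pseudosphere sl_frame sl_coords "de_sitter :: ('e \<Rightarrow> 'e) set" de_sitter_metric
    by (rule pseudosphere_de_sitter)
  let ?M = "lorentz_forms Or \<omega>" and ?h = "natural_metric \<omega>"
  have relative: "linear A \<and> g' = (\<lambda>u v. g (A u) v) \<longleftrightarrow>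
      A = sl_frame (form_coords g) \<circ> sl_frame (form_coords g')"
    if g: "g \<in> ?M" "g' \<in> ?M" for g g' A
    using relative_endomorphism[OF M.mink_\<Psi>[OF g(1)], of A "form_coords g'"]
    by (simp only: M.\<Phi>_\<Psi> g)
  have cases: "
      (lin_trace A > 2 \<longrightarrow> unique_geodesic_joining ?M ?h g g' \<and>
         (\<forall>J c. geodesic_joining ?M ?h g g' J c \<longrightarrow> timelike_curve ?h J c)) \<and>
      (lin_trace A = 2 \<and> g \<noteq> g' \<longrightarrow> unique_geodesic_joining ?M ?h g g' \<and>
         (\<forall>J c. geodesic_joining ?M ?h g g' J c \<longrightarrow> null_curve ?h J c)) \<and>
      (-2 < lin_trace A \<and> lin_trace A < 2 \<longrightarrow> unique_geodesic_joining ?M ?h g g' \<and>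
         (\<forall>J c. geodesic_joining ?M ?h g g' J c \<longrightarrow> spacelike_curve ?h J c)) \<and>
      (lin_trace A < -2 \<longrightarrow> (\<nexists>J c. geodesic_joining ?M ?h g g' J c)) \<and>
      (lin_trace A = -2 \<and> g \<noteq> - g' \<longrightarrow> (\<nexists>J c. geodesic_joining ?M ?h g g' J c)) \<and>
      (lin_trace A = -2 \<and> g = - g' \<longrightarrow>
         (\<forall>J c t\<^sub>0. maximal_geodesic ?M ?h J c \<and> t\<^sub>0 \<in> J \<and> c t\<^sub>0 = g \<longrightarrow>
            (spacelike_curve ?h J c \<longrightarrow> (\<exists>t\<in>J. t\<^sub>0 < t \<and> c t = g')) \<and>
            (timelike_curve ?h J c \<or> null_curve ?h J c \<longrightarrow> (\<forall>t\<in>J. c t \<noteq> g'))))"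
    if g: "g \<in> ?M" "g' \<in> ?M" and A: "linear A \<and> g' = (\<lambda>u v. g (A u) v)" for g g' A
  proof -
    define \<tau> where "\<tau> = mink (form_coords g) (form_coords g')"
    have "A = sl_frame (form_coords g) \<circ> sl_frame (form_coords g')"
      using relative[OF g] A by blast
    then have tr: "lin_trace A = 2 * \<tau>"
      using sl_form_frame[of "form_coords g" "form_coords g'"] by (simp add: sl_form_def \<tau>_def)
    have same: "\<tau> = 1" if "g = g'"
      using M.mink_\<Psi>[OF g(1)] that by (simp add: \<tau>_def)
    have unique: "unique_geodesic_joining ?M ?h g g'" if "g \<noteq> g'" "\<tau> > - 1"
      by (rule M.unique_geodesic_joining[OF g that(1)]) (use that(2) in \<open>simp add: \<tau>_def\<close>)
    note causal = M.geodesic_joining_causal_type[OF g _ _ \<tau>_def]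
    have antipodal: "g' = - g" if "g = - g'" using that by simp
    show ?thesis
      unfolding tr
    proof (intro conjI impI allI; (elim conjE exE)?)
      show "unique_geodesic_joining ?M ?h g g'" if "2 < 2 * \<tau>"
        using unique same that by fastforce
      show "timelike_curve ?h J c" if "2 < 2 * \<tau>" "geodesic_joining ?M ?h g g' J c" for J c
        using causal(3)[OF _ that(2)] same that(1) by fastforce
      show "unique_geodesic_joining ?M ?h g g'" if "2 * \<tau> = 2" "g \<noteq> g'"
        using unique that by simp
      show "null_curve ?h J c" if "2 * \<tau> = 2" "g \<noteq> g'" "geodesic_joining ?M ?h g g' J c" for J c
        using causal(4)[OF that(2,3)] that(1) by simp
      show "unique_geodesic_joining ?M ?h g g'" if "- 2 < 2 * \<tau>" "2 * \<tau> < 2"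
        using unique same that by fastforce
      show "spacelike_curve ?h J c" if "- 2 < 2 * \<tau>" "2 * \<tau> < 2" "geodesic_joining ?M ?h g g' J c" for J c
        using causal(5)[OF _ that(3)] same that(1,2) by fastforce
      show "\<nexists>J c. geodesic_joining ?M ?h g g' J c" if "2 * \<tau> < - 2"
        using causal(1) same that by fastforce
      show "\<nexists>J c. geodesic_joining ?M ?h g g' J c" if "2 * \<tau> = - 2" "g \<noteq> - g'"
        using causal(2) same that by fastforce
      fix J c t\<^sub>0
      assume anti: "2 * \<tau> = - 2" "g = - g'" "maximal_geodesic ?M ?h J c" "t\<^sub>0 \<in> J" "c t\<^sub>0 = g"
      note hit = M.antipodal_point[OF anti(3-5)]
      show "\<exists>t\<in>J. t\<^sub>0 < t \<and> c t = g'" if "spacelike_curve ?h J c"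
        using hit(1)[OF that] antipodal[OF anti(2)] by metis
      show "\<forall>t\<in>J. c t \<noteq> g'" if "timelike_curve ?h J c \<or> null_curve ?h J c"
        using hit(2)[OF that] antipodal[OF anti(2)] by metis
    qed
  qed
  have unique_A: "\<exists>!A. linear A \<and> g' = (\<lambda>u v. g (A u) v)" if "g \<in> ?M" "g' \<in> ?M" for g g'
    unfolding relative[OF that] by simp
  show ?thesis
  proof (intro conjI)
    show "\<forall>\<gamma>\<in>SL. \<forall>g\<in>?M. act_form \<gamma> g \<in> ?M \<and>
        form_endo \<omega> (act_form \<gamma> g) = act_endo \<gamma> (form_endo \<omega> g)"
      using SL_equivariance by blast
  qed (fact M.lorentzian_surface D.lorentzian_surface form_endo_isometry |
      (intro ballI, rule conjI, rule unique_A, assumption, assumption,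
        intro allI impI, rule cases, assumption+))+
qed

end
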